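(* Let $\ell,T>0$, let $r,\widetilde{r},P,Q\in C^1[0,\ell]$ and $\sigma\in\mathbb{C}\setminus\{0\}$, and suppose $r(0)=\widetilde{r}(0)$. Let $u,\widetilde{u}\in C^{1,2}([0,T]\times[0,\ell])$ satisfy $$\sigma\partial_tu=\partial_x^2u-r(x)\partial_xu-P(x)u,\qquad u(0,x)=0,\qquad 0<x<\ell,\ 0<t<T,$$ $$\sigma\partial_t\widetilde{u}=\partial_x^2\widetilde{u}-\widetilde{r}(x)\partial_x\widetilde{u}-Q(x)\widetilde{u},\qquad \widetilde{u}(0,x)=0,\qquad 0<x<\ell,\ 0<t<T.$$ Assume that there exists $m\in\mathbb{N}$ such that $$\partial_t^mu,\ \partial_t^m\widetilde{u}\in C^{1,2}([0,T]\times[0,\ell]),$$ $$\partial_t^m\partial_xu(0,0)\ne0,\qquad \partial_t^j\partial_xu(0,0)=0\ \text{ for all }0\le j\le m-1.$$ If $u(t,0)=\widetilde{u}(t,0)$ and $\partial_xu(t,0)=\partial_x\widetilde{u}(t,0)$ for all $t\in(0,T)$, then $$P+\frac14r^2-\frac12r'=Q+\frac14\widetilde{r}^2-\frac12\widetilde{r}'\quad\text{on }\left[0,\frac{\ell}{2}\right].$$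
   Context: $C^{1,2}([0,T]\times[0,\ell])$ denotes the set of $u\in C([0,T]\times[0,\ell])$ such that $\partial_tu,\partial_xu,\partial_x^2u\in C([0,T]\times[0,\ell])$, and $r'=\frac{dr}{dx}$. Functions may be complex-valued. *)

theory Defs
  imports "HOL-Analysis.Analysis"
begin

(* All derivatives are taken within the closed interval, hence are one-sided at its endpoints.
   This is why C1_differentiable_on is not used: it asks for two-sided derivatives. *)

definition C1_interval :: "real \<Rightarrow> (real \<Rightarrow> complex) \<Rightarrow> bool" where
  "C1_interval l f \<longleftrightarrow>
     (\<forall>x\<in>{0..l}. f differentiable (at x within {0..l})) \<and>
     continuous_on {0..l} (\<lambda>x. vector_derivative f (at x within {0..l}))"

definition dt :: "real \<Rightarrow> (real \<Rightarrow> real \<Rightarrow> complex) \<Rightarrow> real \<Rightarrow> real \<Rightarrow> complex" where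
  "dt T u = (\<lambda>t x. vector_derivative (\<lambda>s. u s x) (at t within {0..T}))"

definition dx :: "real \<Rightarrow> (real \<Rightarrow> real \<Rightarrow> complex) \<Rightarrow> real \<Rightarrow> real \<Rightarrow> complex" where
  "dx l u = (\<lambda>t x. vector_derivative (u t) (at x within {0..l}))"

definition C0_rect :: "real \<Rightarrow> real \<Rightarrow> (real \<Rightarrow> real \<Rightarrow> complex) \<Rightarrow> bool" where
  "C0_rect T l u \<longleftrightarrow> continuous_on ({0..T} \<times> {0..l}) (\<lambda>(t, x). u t x)"

(* vector_derivative is total, so the existence of a derivative has to be required separately. *)

definition has_dt :: "real \<Rightarrow> real \<Rightarrow> (real \<Rightarrow> real \<Rightarrow> complex) \<Rightarrow> bool" where
  "has_dt T l u \<longleftrightarrow>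
     (\<forall>t\<in>{0..T}. \<forall>x\<in>{0..l}. (\<lambda>s. u s x) differentiable (at t within {0..T}))"

definition has_dx :: "real \<Rightarrow> real \<Rightarrow> (real \<Rightarrow> real \<Rightarrow> complex) \<Rightarrow> bool" where
  "has_dx T l u \<longleftrightarrow>
     (\<forall>t\<in>{0..T}. \<forall>x\<in>{0..l}. u t differentiable (at x within {0..l}))"

definition C12 :: "real \<Rightarrow> real \<Rightarrow> (real \<Rightarrow> real \<Rightarrow> complex) \<Rightarrow> bool" where
  "C12 T l u \<longleftrightarrow>
     C0_rect T l u \<and>
     has_dt T l u \<and> C0_rect T l (dt T u) \<and>
     has_dx T l u \<and> C0_rect T l (dx l u) \<and>
     has_dx T l (dx l u) \<and> C0_rect T l (dx l (dx l u))"

definition dt_pow_C12 :: "real \<Rightarrow> real \<Rightarrow> nat \<Rightarrow> (real \<Rightarrow> real \<Rightarrow> complex) \<Rightarrow> bool" where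
  "dt_pow_C12 T l m u \<longleftrightarrow>
     (\<forall>j<m. has_dt T l ((dt T ^^ j) u)) \<and> C12 T l ((dt T ^^ m) u)"

end

theory Submission
  imports Defs "HOL-Complex_Analysis.Complex_Analysis"
begin

text \<open>
  The finite Laplace transform in time, followed by multiplication with \<open>exp (- (1/2) * integral {0..x} r)\<close>,
  turns the two evolution equations into \<open>V'' = (p + k\<^sup>2) V + g\<close> and \<open>W'' = (q + k\<^sup>2) W + h\<close>, where
  \<open>k\<^sup>2 = \<sigma> s\<close>, where \<open>p\<close> and \<open>q\<close> are the two sides of the claim, and where the sources come from the values
  at the final time only and are of size \<open>exp (- T * Re s)\<close>.  Along a ray in the \<open>k\<close>-plane on which both
  \<open>Re k\<close> and \<open>Re s\<close> are positive this is negligible against \<open>exp (- c * Re k)\<close> for every \<open>c\<close>.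
  On such a ray \<open>V\<close> and \<open>W\<close> stay bounded on \<open>[0, l]\<close>, which forces them to be \<open>O(exp (- x * Re k))\<close> on the first
  half of the interval.  As they have the same Cauchy data at \<open>0\<close>, the entire function
  \<open>D = C\<^sub>p S\<^sub>q - S\<^sub>p C\<^sub>q\<close> of \<open>k\<close>, formed from fundamental solutions at a point \<open>x \<le> l / 2\<close>, grows at most
  polynomially on the ray; here the condition at \<open>(0, 0)\<close> gives a polynomial lower bound for
  the transformed Neumann datum.  Since \<open>D\<close> is even, of exponential type and tends to \<open>0\<close> along the imaginary
  axis, the theorems of Phragmen-Lindelof and Liouville yield \<open>D = 0\<close>, as in Bennewitz's proof of
  the local Borg-Marchenko theorem.  Then \<open>C\<^sub>p\<^sup>2 = C\<^sub>q\<^sup>2\<close>, so \<open>C\<^sub>p = C\<^sub>q\<close> for large real \<open>k\<close>, and \<open>p = q\<close>.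
\<close>

section \<open>The Phragmen-Lindelof principle\<close>

text \<open>Nothing is known about the solutions at \<open>x = l\<close> except a bound. They may
  therefore contain a part of size \<open>exp (- (l - x) * Re k)\<close>, which is dominated by
  \<open>exp (- x * Re k)\<close> only for \<open>x \<le> l / 2\<close>; hence the half interval.
  The sources are negligible because \<open>s\<close> is quadratic in \<open>k\<close>: on a ray,
  \<open>T * Re s\<close> outgrows every multiple of \<open>Re k\<close>. \<open>D\<close> arises by
  elimination. Up to small errors, \<open>V\<close> and \<open>W\<close> have the same coefficients
  with respect to the two fundamental systems, and \<open>C\<^sub>p W - C\<^sub>q V\<close> removes
  the Dirichlet coefficient and leaves \<open>D\<close> times the Neumann one. Giving
  \<open>C\<^sub>p\<close> and \<open>C\<^sub>q\<close> the slope \<open>- r 0 / 2\<close> at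
  \<open>0\<close> makes that coefficient exactly the transform of the Neumann datum of
  \<open>u\<close>; \<open>r 0 = rt 0\<close> lets one slope serve both equations. A separate
  obstacle is regularity. Only \<open>u\<close> and its \<open>m\<close>-th time derivative are
  assumed smooth in \<open>x\<close>, yet the condition at the origin concerns time derivatives of
  \<open>dx l u\<close>. To interchange the two derivatives, smoothness in \<open>x\<close> of the
  intermediate time derivatives is recovered from a Taylor expansion in time.\<close>

lemma phragmen_lindelof_half_strip:
  fixes G :: "complex \<Rightarrow> complex"
  assumes hol: "G holomorphic_on UNIV" and ab: "a < b" "b - a < pi" and M: "0 < M"
    and growth: "\<And>w. c \<le> Re w \<Longrightarrow> a \<le> Im w \<Longrightarrow> Im w \<le> b \<Longrightarrow> norm (G w) \<le> A * exp (B * exp (Re w))"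
    and bdry: "\<And>w. c \<le> Re w \<Longrightarrow> a \<le> Im w \<Longrightarrow> Im w \<le> b \<Longrightarrow> Re w = c \<or> Im w = a \<or> Im w = b
                 \<Longrightarrow> norm (G w) \<le> M"
    and z: "c \<le> Re z" "a \<le> Im z" "Im z \<le> b"
  shows "norm (G z) \<le> M"
proof -
  define mid where "mid = (a + b) / 2"
  define al where "al = (b - a) / 2"
  \<comment> \<open>The midpoint of the admissible interval. \<open>1 < rho\<close> lets the damping
    \<open>exp (- e * E w)\<close> beat \<open>exp (B * exp (Re w))\<close>, and
    \<open>rho * al < pi / 2\<close> keeps \<open>Re (E w)\<close> positive on the strip. Both are
    possible because the width is below \<open>pi\<close>.\<close>
  define rho where "rho = (1 + pi / (2 * al)) / 2"
  define dl where "dl = cos (rho * al)"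
  have al: "0 < al" "al < pi / 2"
    using ab by (auto simp: al_def)
  have "1 < pi / (2 * al)"
    using al by (simp add: field_simps)
  then have rho1: "1 < rho" and "rho < pi / (2 * al)"
    by (auto simp: rho_def)
  then have rho: "rho * al < pi / 2"
    using al by (simp add: field_simps)
  then have dl: "0 < dl"
    using al rho1 by (auto simp: dl_def intro!: cos_gt_zero)
  define E where "E w = exp (complex_of_real rho * (w - \<i> * complex_of_real mid))" for w
  have ReE: "dl * exp (rho * Re w) \<le> Re (E w)" if "a \<le> Im w" "Im w \<le> b" for w
  proof -
    have "\<bar>Im w - mid\<bar> \<le> al"
      using that by (auto simp: mid_def al_def abs_le_iff field_simps)
    then have "\<bar>rho * (Im w - mid)\<bar> \<le> rho * al"
      using rho1 by (simp add: abs_mult)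
    then have "cos (rho * al) \<le> cos \<bar>rho * (Im w - mid)\<bar>"
      using rho pi_gt_zero by (intro cos_monotone_0_pi_le) auto
    then have "dl \<le> cos (rho * (Im w - mid))"
      by (simp add: dl_def)
    then show ?thesis
      by (simp add: E_def Re_exp mult.commute)
  qed
  have key: "norm (G z) \<le> M * exp (e * Re (E z))" if e: "0 < e" for e :: real
  proof -
    define F where "F w = G w * exp (- complex_of_real e * E w)" for w
    have nF: "norm (F w) = norm (G w) * exp (- e * Re (E w))" for w
      by (simp add: F_def norm_mult)
    have "((\<lambda>R. A * exp (B * exp R - e * dl * exp (rho * R))) \<longlongrightarrow> 0) at_top"
    proof -
      have "filterlim (\<lambda>R. e * dl * exp ((rho - 1) * R) - B) at_top at_top"
      proof -
        have "filterlim (\<lambda>R. exp ((rho - 1) * R)) at_top at_top"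
          using rho1
          by (intro filterlim_compose[OF exp_at_top] filterlim_tendsto_pos_mult_at_top[OF tendsto_const])
             (auto intro: filterlim_ident)
        then have "filterlim (\<lambda>R. - B + (e * dl) * exp ((rho - 1) * R)) at_top at_top"
          using e dl
          by (intro filterlim_tendsto_add_at_top[OF tendsto_const]
                    filterlim_tendsto_pos_mult_at_top[OF tendsto_const]) auto
        then show ?thesis by simp
      qed
      then have "filterlim (\<lambda>R. exp R * (e * dl * exp ((rho - 1) * R) - B)) at_top at_top"
        by (intro filterlim_at_top_mult_at_top[OF exp_at_top])
      then have "((\<lambda>R. exp (- (exp R * (e * dl * exp ((rho - 1) * R) - B)))) \<longlongrightarrow> 0) at_top"
        by (intro filterlim_compose[OF exp_at_bot] filterlim_compose[OF filterlim_uminus_at_bot_at_top])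
      then have "((\<lambda>R. A * exp (- (exp R * (e * dl * exp ((rho - 1) * R) - B)))) \<longlongrightarrow> 0) at_top"
        by (rule tendsto_mult_right_zero)
      moreover have "exp R * (e * dl * exp ((rho - 1) * R) - B) = - (B * exp R - e * dl * exp (rho * R))" for R
        by (simp add: algebra_simps flip: exp_add)
      ultimately show ?thesis by simp
    qed
    then have "\<forall>\<^sub>F R in at_top. A * exp (B * exp R - e * dl * exp (rho * R)) < M"
      using M by (rule order_tendstoD(2))
    then have "\<forall>\<^sub>F R in at_top. A * exp (B * exp R - e * dl * exp (rho * R)) < M \<and> Re z < R \<and> c < R"
      by (intro eventually_conj eventually_gt_at_top)
    then obtain R where R: "A * exp (B * exp R - e * dl * exp (rho * R)) < M" "Re z < R" "c < R"
      by (metis (mono_tags, lifting) eventually_at_top_linorder order_refl)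
    \<comment> \<open>The half-strip is cut at an \<open>R\<close> so large that on the new right
      side growth and damping together already give \<open>M\<close>; the other three sides are
      covered by \<open>bdry\<close>.\<close>
    define S where "S = cbox (Complex c a) (Complex R b)"
    have "norm (F z) \<le> M"
    proof (rule maximum_modulus_frontier[of F S])
      have "F holomorphic_on UNIV"
        unfolding F_def E_def by (intro holomorphic_intros hol)
      then show "F holomorphic_on interior S" "continuous_on (closure S) F"
        by (auto intro: holomorphic_on_subset holomorphic_on_imp_continuous_on)
      show "bounded S" by (simp add: S_def bounded_cbox)
      show "z \<in> S"
        using z R by (auto simp: S_def in_cbox_complex_iff)
      fix w assume "w \<in> frontier S"
      then have w: "w \<in> cbox (Complex c a) (Complex R b)" "w \<notin> box (Complex c a) (Complex R b)"
        by (auto simp: S_def frontier_def interior_cbox)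
      then have w1: "c \<le> Re w" "Re w \<le> R" "a \<le> Im w" "Im w \<le> b"
        by (auto simp: in_cbox_complex_iff)
      from w w1 have w2: "Re w = c \<or> Im w = a \<or> Im w = b \<or> Re w = R"
        by (auto simp: in_box_complex_iff)
      have E0: "0 \<le> e * Re (E w)"
        using ReE[OF w1(3,4)] dl e by (intro mult_nonneg_nonneg) (auto intro: order_trans[rotated])
      show "norm (F w) \<le> M"
      proof (cases "Re w = R")
        case True
        have "norm (F w) \<le> (A * exp (B * exp (Re w))) * exp (- e * Re (E w))"
          unfolding nF using growth[OF w1(1,3,4)] by (intro mult_right_mono) auto
        also have "\<dots> = A * exp (B * exp (Re w) - e * Re (E w))"
          by (simp add: exp_diff exp_minus field_simps)
        also have "\<dots> \<le> A * exp (B * exp (Re w) - e * dl * exp (rho * Re w))"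
        proof -
          have "0 \<le> A * exp (B * exp (Re w))"
            using growth[OF w1(1,3,4)] by (rule order_trans[OF norm_ge_zero])
          then have "0 \<le> A" by (simp add: zero_le_mult_iff)
          then show ?thesis using ReE[OF w1(3,4)] e by (intro mult_left_mono) auto
        qed
        also have "\<dots> \<le> M" using R(1) True by simp
        finally show ?thesis .
      next
        case False
        then have "norm (G w) \<le> M" using bdry w1 w2 by blast
        then have "norm (G w) * exp (- e * Re (E w)) \<le> M * 1"
          using E0 M by (intro mult_mono) auto
        then show ?thesis by (simp add: nF)
      qed
    qed
    then show ?thesis
      by (simp add: nF exp_minus field_simps)
  qed
  \<comment> \<open>The point \<open>z\<close> is fixed, so the damping strength \<open>e\<close>
    may now tend to \<open>0\<close>.\<close>
  have "((\<lambda>e. M * exp (e * Re (E z))) \<longlongrightarrow> M * exp (0 * Re (E z))) (at_right 0)"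
    by (intro tendsto_intros)
  then have "((\<lambda>e. M * exp (e * Re (E z))) \<longlongrightarrow> M) (at_right 0)"
    by simp
  moreover have "\<forall>\<^sub>F e in at_right 0. norm (G z) \<le> M * exp (e * Re (E z))"
    using key by (auto simp: eventually_at_right_field intro!: exI[of _ 1])
  ultimately show ?thesis
    by (rule tendsto_lowerbound) simp
qed

text \<open>The ray and the imaginary axis bound two sectors of opening less than \<open>pi\<close>,
  which \<open>w = Ln k\<close> turns into half-strips; exponential type in \<open>k\<close> becomes
  the growth allowed there. On the imaginary axis \<open>growth\<close> is itself a constant bound,
  since \<open>Re k = 0\<close>.\<close>

lemma entire_even_eq_0:
  fixes D :: "complex \<Rightarrow> complex"
  assumes hol: "D holomorphic_on UNIV" and even: "\<And>k. D (- k) = D k"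
    and growth: "\<And>k. R \<le> norm k \<Longrightarrow> norm (D k) \<le> A * exp (B * \<bar>Re k\<bar>)"
    and B: "0 \<le> B"
    and k0: "0 < Re k0" and ray: "\<And>t. R \<le> t \<Longrightarrow> norm (D (of_real t * k0)) \<le> K * t ^ N"
    and lim: "((\<lambda>t. D (\<i> * of_real t)) \<longlongrightarrow> 0) at_top"
  shows "D k = 0"
proof -
  define th where "th = Arg k0"
  have k0': "k0 \<noteq> 0" using k0 by auto
  have th: "- pi / 2 < th" "th < pi / 2"
    using k0 Re_Ln_pos_lt[of k0] k0' by (auto simp: th_def Arg_eq_Im_Ln)
  have k0_eq: "k0 = of_real (norm k0) * exp (\<i> * of_real th)"
    using Arg_eq[OF k0'] by (simp add: th_def)
  \<comment> \<open>For \<open>c \<le> Re w\<close> both \<open>exp (Re w)\<close> and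
    \<open>exp (Re w) / norm k0\<close> are at least \<open>R\<close>, so \<open>growth\<close> and
    \<open>ray\<close> apply at \<open>exp w\<close>. Inside the logarithms \<open>max 1 R\<close>
    covers nonpositive \<open>R\<close>; \<open>0 \<le> c\<close> gives
    \<open>exp (- N * Re w) \<le> 1\<close>.\<close>
  define c where "c = max 0 (max (ln (max 1 R)) (ln (max 1 R) + ln (norm k0)))"
  have c0: "0 \<le> c" by (simp add: c_def)
  have R1: "R \<le> exp x" if "c \<le> x" for x
  proof -
    have "ln (max 1 R) \<le> x" using that by (simp add: c_def)
    then have "max 1 R \<le> exp x" by (metis exp_le_cancel_iff exp_ln max.strict_coboundedI1 zero_less_one)
    then show ?thesis by simp
  qed
  have R2: "R \<le> exp x / norm k0" if "c \<le> x" for x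
  proof -
    have "ln (max 1 R) + ln (norm k0) \<le> x" using that by (simp add: c_def)
    then have "exp (ln (max 1 R) + ln (norm k0)) \<le> exp x" by (simp only: exp_le_cancel_iff)
    then have "max 1 R * norm k0 \<le> exp x" using k0' by (simp add: exp_add)
    moreover have "R * norm k0 \<le> max 1 R * norm k0" by (intro mult_right_mono) auto
    ultimately have "R * norm k0 \<le> exp x" by linarith
    then show ?thesis using k0' by (simp add: pos_le_divide_eq)
  qed
  have A0: "0 \<le> A"
  proof -
    have "norm (D (of_real \<bar>R\<bar>)) \<le> A * exp (B * \<bar>Re (of_real \<bar>R\<bar>)\<bar>)"
      by (rule growth) simp
    then have "0 \<le> A * exp (B * \<bar>Re (of_real \<bar>R\<bar>)\<bar>)" by (rule order_trans[OF norm_ge_zero])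
    then show ?thesis by (simp add: zero_le_mult_iff)
  qed
  \<comment> \<open>In the variable \<open>k = exp w\<close> this is \<open>D k / k ^ N\<close>: the
    polynomial bound on the ray becomes a constant.\<close>
  define G where "G w = D (exp w) * exp (- of_nat N * w)" for w
  have Ghol: "G holomorphic_on UNIV"
    unfolding G_def by (intro holomorphic_intros holomorphic_on_compose_gen[OF _ hol, unfolded o_def]) auto
  have nG: "norm (G w) = norm (D (exp w)) * exp (- real N * Re w)" for w
    by (simp add: G_def norm_mult)
  have Ggr: "norm (G w) \<le> A * exp (B * \<bar>Re (exp w)\<bar>)" if "c \<le> Re w" for w
  proof -
    have "norm (D (exp w)) \<le> A * exp (B * \<bar>Re (exp w)\<bar>)"
      using R1[OF that] by (intro growth) simp
    moreover have "exp (- real N * Re w) \<le> 1" using that c0 by auto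
    ultimately show ?thesis unfolding nG
      using mult_mono[of "norm (D (exp w))" "A * exp (B * \<bar>Re (exp w)\<bar>)" "exp (- real N * Re w)" 1] A0 by auto
  qed
  have Ggr': "norm (G w) \<le> A * exp (B * exp (Re w))" if "c \<le> Re w" for w
  proof -
    have "\<bar>Re (exp w)\<bar> \<le> exp (Re w)"
      using abs_Re_le_cmod[of "exp w"] by simp
    then have "A * exp (B * \<bar>Re (exp w)\<bar>) \<le> A * exp (B * exp (Re w))"
      using A0 B by (intro mult_left_mono) (auto intro: mult_left_mono)
    then show ?thesis using Ggr[OF that] by simp
  qed
  define M where "M = max 1 (max (A * exp (B * exp c)) (\<bar>K\<bar> / norm k0 ^ N))"
  have M0: "0 < M" by (simp add: M_def)
  have Mc: "norm (G w) \<le> M" if "Re w = c" for w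
    using Ggr'[of w] that by (simp add: M_def)
  have Mi: "norm (G w) \<le> M" if "c \<le> Re w" "Im w = pi / 2 \<or> Im w = - pi / 2" for w
  proof -
    have "cos (Im w) = 0" using that(2) cos_pi_half cos_minus minus_divide_left by metis
    then have "Re (exp w) = 0" by (simp add: Re_exp)
    then have "norm (G w) \<le> A" using Ggr[OF that(1)] by simp
    also have "A \<le> A * exp (B * exp c)" using A0 B by (auto simp: mult_le_cancel_left1)
    finally show ?thesis by (simp add: M_def)
  qed
  have Mray: "norm (G w) \<le> M" if "c \<le> Re w" "Im w = th" for w
  proof -
    define t where "t = exp (Re w) / norm k0"
    have "exp w = of_real (exp (Re w)) * exp (\<i> * of_real th)"
      using that(2) by (metis complex_eq exp_add exp_of_real)
    also have "\<dots> = of_real t * (of_real (norm k0) * exp (\<i> * of_real th))"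
      using k0' by (simp add: t_def)
    also have "\<dots> = of_real t * k0"
      by (rule arg_cong[OF k0_eq[symmetric]])
    finally have ew: "exp w = of_real t * k0" .
    have "norm (D (exp w)) \<le> K * t ^ N"
      unfolding ew by (rule ray) (use R2[OF that(1)] in \<open>simp add: t_def\<close>)
    also have "\<dots> \<le> \<bar>K\<bar> * t ^ N" by (intro mult_right_mono) (auto simp: t_def)
    also have "\<dots> = \<bar>K\<bar> / norm k0 ^ N * exp (real N * Re w)"
      by (simp add: t_def power_divide exp_of_nat_mult)
    finally have "norm (D (exp w)) * exp (- real N * Re w) \<le> \<bar>K\<bar> / norm k0 ^ N * exp (real N * Re w) * exp (- real N * Re w)"
      by (intro mult_right_mono) auto
    also have "\<dots> = \<bar>K\<bar> / norm k0 ^ N"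
      by (simp add: exp_minus)
    finally show ?thesis by (simp add: nG M_def)
  qed
  \<comment> \<open>The full strip has width \<open>pi\<close>, the critical case for exponential
    type. The ray at height \<open>th\<close> cuts it into two strictly narrower strips.\<close>
  have strip: "norm (G w) \<le> M" if "c \<le> Re w" "- pi / 2 \<le> Im w" "Im w \<le> pi / 2" for w
  proof (cases "Im w \<le> th")
    case True
    show ?thesis
      by (rule phragmen_lindelof_half_strip[OF Ghol, of "- pi / 2" th M c A B])
         (use th that True M0 Ggr' Mc Mi Mray in auto)
  next
    case False
    show ?thesis
      by (rule phragmen_lindelof_half_strip[OF Ghol, of th "pi / 2" M c A B])
         (use th that False M0 Ggr' Mc Mi Mray in auto)
  qed
  have half: "norm (D k) \<le> M * norm k ^ N" if "exp c \<le> norm k" "0 \<le> Re k" for k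
  proof -
    have k: "k \<noteq> 0" using that(1) by auto
    have re: "Re (Ln k) = ln (norm k)" using k by simp
    have "\<bar>Im (Ln k)\<bar> \<le> pi / 2" using Re_Ln_pos_le[OF k] that(2) by simp
    moreover have "c \<le> Re (Ln k)" using that(1) re by (metis exp_gt_zero ln_exp ln_le_cancel_iff order_less_le_trans)
    ultimately have "norm (G (Ln k)) \<le> M" by (intro strip) auto
    then have "norm (D k) * exp (- real N * ln (norm k)) \<le> M"
      using k by (simp add: nG)
    then show ?thesis
      using k by (simp add: exp_minus exp_of_nat_mult field_simps)
  qed
  have poly: "norm (D k) \<le> M * norm k ^ N" if "exp c \<le> norm k" for k
    using half[of k] half[of "- k"] even[of k] that by (cases "0 \<le> Re k") auto
  define a where "a j = (deriv ^^ j) D 0 / fact j" for j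
  have D_eq: "D z = (\<Sum>j\<le>N. a j * z ^ j)" for z
    unfolding a_def by (rule Liouville_polynomial[OF hol poly])
  have lim': "filterlim (\<lambda>t. \<i> * complex_of_real t) at_infinity at_top"
    by (intro tendsto_mult_filterlim_at_infinity[OF tendsto_const] filterlim_compose[OF filterlim_of_real_at_infinity])
       (auto intro: filterlim_ident)
  \<comment> \<open>A nonconstant polynomial has modulus at least \<open>1\<close> near infinity,
    contrary to \<open>lim\<close>.\<close>
  have "a j = 0" if "j \<noteq> 0" "j \<le> N" for j
  proof (rule ccontr)
    assume "a j \<noteq> 0"
    then have "\<forall>\<^sub>F z in at_infinity. norm (\<Sum>i\<le>N. a i * z ^ i) \<ge> 1"
      using that by (intro polyfun_extremal) auto
    then have "\<forall>\<^sub>F t in at_top. norm (D (\<i> * of_real t)) \<ge> 1"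
      using lim' by (auto simp: filterlim_iff D_eq[symmetric])
    moreover have "\<forall>\<^sub>F t in at_top. norm (D (\<i> * of_real t)) < 1"
      using tendsto_norm_zero[OF lim] by (rule order_tendstoD) simp
    ultimately have "\<forall>\<^sub>F t::real in at_top. False" by eventually_elim simp
    then show False by simp
  qed
  then have "(\<Sum>j\<le>N. a j * z ^ j) = (\<Sum>j\<le>N. if j = 0 then a 0 else 0)" for z
    by (intro sum.cong) auto
  then have const: "D z = a 0" for z
    by (simp add: D_eq)
  then have "((\<lambda>t::real. a 0) \<longlongrightarrow> 0) at_top" using lim by simp
  then show ?thesis using const by (simp add: tendsto_const_iff)
qed

section \<open>Fundamental solutions of a Schroedinger equation\<close>

lemma has_vector_derivative_series:
  fixes f :: "nat \<Rightarrow> real \<Rightarrow> 'a::banach"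
  assumes "convex S" and f: "\<And>n x. x \<in> S \<Longrightarrow> (f n has_vector_derivative f' n x) (at x within S)"
    and a: "\<And>n x. x \<in> S \<Longrightarrow> norm (f' n x) \<le> a n" "summable a"
    and x0: "x0 \<in> S" "summable (\<lambda>n. f n x0)" and x: "x \<in> S"
  shows "((\<lambda>x. \<Sum>n. f n x) has_vector_derivative (\<Sum>n. f' n x)) (at x within S)"
proof -
  have ul: "uniform_limit S (\<lambda>n x. \<Sum>i<n. f' i x) (\<lambda>x. \<Sum>i. f' i x) sequentially"
    using a by (rule Weierstrass_m_test)
  have "\<exists>g. \<forall>x\<in>S. (\<lambda>n. f n x) sums (g x) \<and> (g has_derivative (\<lambda>h. h *\<^sub>R (\<Sum>i. f' i x))) (at x within S)"
  proof (rule has_derivative_series[OF \<open>convex S\<close> _ _ x0(1)])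
    show "\<And>n x. x \<in> S \<Longrightarrow> (f n has_derivative (\<lambda>h. h *\<^sub>R f' n x)) (at x within S)"
      using f by (simp add: has_vector_derivative_def)
    show "(\<lambda>n. f n x0) sums (\<Sum>n. f n x0)" using x0 by (simp add: summable_sums)
    fix e :: real assume "0 < e"
    then have "\<forall>\<^sub>F n in sequentially. \<forall>x\<in>S. dist (\<Sum>i<n. f' i x) (\<Sum>i. f' i x) < e"
      using ul by (simp add: uniform_limit_iff)
    then show "\<forall>\<^sub>F n in sequentially. \<forall>x\<in>S. \<forall>h. norm ((\<Sum>i<n. h *\<^sub>R f' i x) - h *\<^sub>R (\<Sum>i. f' i x)) \<le> e * norm h"
    proof eventually_elim
      case (elim n)
      show ?case
      proof (intro ballI allI)
        fix x h assume "x \<in> S"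
        then have "norm ((\<Sum>i<n. f' i x) - (\<Sum>i. f' i x)) \<le> e"
          using elim by (auto simp: dist_norm less_imp_le)
        then have "\<bar>h\<bar> * norm ((\<Sum>i<n. f' i x) - (\<Sum>i. f' i x)) \<le> \<bar>h\<bar> * e"
          by (intro mult_left_mono) auto
        then show "norm ((\<Sum>i<n. h *\<^sub>R f' i x) - h *\<^sub>R (\<Sum>i. f' i x)) \<le> e * norm h"
          by (simp add: mult.commute flip: scaleR_right.sum scaleR_diff_right)
      qed
    qed
  qed
  then obtain g where g: "\<And>x. x \<in> S \<Longrightarrow> (\<lambda>n. f n x) sums (g x)"
    "\<And>x. x \<in> S \<Longrightarrow> (g has_vector_derivative (\<Sum>i. f' i x)) (at x within S)"
    by (auto simp: has_vector_derivative_def)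
  show ?thesis
    by (rule has_vector_derivative_transform[OF x _ g(2)[OF x]]) (use g(1) in \<open>simp add: sums_iff\<close>)
qed

text \<open>The derivative \<open>y'\<close> is an argument, so that the equation is a first order
  system whose derivatives are relations within the closed interval. \<open>f\<close> is the
  source.\<close>

definition ode_sol ::
    "real \<Rightarrow> (real \<Rightarrow> complex) \<Rightarrow> (real \<Rightarrow> complex) \<Rightarrow> (real \<Rightarrow> complex) \<Rightarrow> (real \<Rightarrow> complex) \<Rightarrow> bool" where
  "ode_sol l p f y y' \<longleftrightarrow>
     (\<forall>x\<in>{0..l}. (y has_vector_derivative y' x) (at x within {0..l}) \<and>
                 (y' has_vector_derivative (p x * y x + f x)) (at x within {0..l}))"

text \<open>The solution of \<open>y'' = f\<close> with zero Cauchy data at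
  \<open>0\<close>.\<close>

definition iter_int :: "(real \<Rightarrow> complex) \<Rightarrow> real \<Rightarrow> complex" where
  "iter_int f x = integral {0..x} (\<lambda>y. integral {0..y} f)"

lemma
  assumes f: "continuous_on {0..l} f" and x: "x \<in> {0..l}"
  shows integral_deriv: "((\<lambda>y. integral {0..y} f) has_vector_derivative f x) (at x within {0..l})"
    and iter_int_deriv: "(iter_int f has_vector_derivative integral {0..x} f) (at x within {0..l})"
proof -
  show "((\<lambda>y. integral {0..y} f) has_vector_derivative f x) (at x within {0..l})"
    using integral_has_vector_derivative[OF f x] .
  have "continuous_on {0..l} (\<lambda>y. integral {0..y} f)"
    using f by (intro indefinite_integral_continuous_1 integrable_continuous_interval)
  from integral_has_vector_derivative[OF this x]
  show "(iter_int f has_vector_derivative integral {0..x} f) (at x within {0..l})"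
    unfolding iter_int_def[abs_def] .
qed

lemma iter_int_cont: "continuous_on {0..l} f \<Longrightarrow> continuous_on {0..l} (iter_int f)"
  by (rule continuous_on_vector_derivative) (rule iter_int_deriv)

lemma iter_int_cong: "(\<And>z. z \<in> {0..x} \<Longrightarrow> f z = g z) \<Longrightarrow> iter_int f x = iter_int g x"
  unfolding iter_int_def by (intro integral_cong) auto

lemma iter_int_add:
  assumes "continuous_on {0..l} f" "continuous_on {0..l} g" "x \<in> {0..l}"
  shows "iter_int (\<lambda>z. f z + g z) x = iter_int f x + iter_int g x"
proof -
  have i: "h integrable_on {0..y}" if "continuous_on {0..l} h" "y \<in> {0..x}" for h :: "real \<Rightarrow> complex" and y
    using that assms by (intro integrable_continuous_interval) (auto intro: continuous_on_subset)
  have j: "(\<lambda>y. integral {0..y} h) integrable_on {0..x}" if "continuous_on {0..l} h" for h :: "real \<Rightarrow> complex"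
    by (rule integrable_continuous_interval, rule indefinite_integral_continuous_1, rule i[OF that])
       (use assms in auto)
  have "iter_int (\<lambda>z. f z + g z) x = integral {0..x} (\<lambda>y. integral {0..y} f + integral {0..y} g)"
    unfolding iter_int_def using assms by (intro integral_cong integral_add i) auto
  also have "\<dots> = iter_int f x + iter_int g x"
    unfolding iter_int_def using assms by (intro integral_add j) auto
  finally show ?thesis .
qed

lemma iter_int_cmult: "iter_int (\<lambda>z. f z * c) x = iter_int f x * c"
  by (simp add: iter_int_def)

lemma iter_int_sum:
  assumes "finite I" "\<And>i. i \<in> I \<Longrightarrow> continuous_on {0..l} (f i)" "x \<in> {0..l}"
  shows "iter_int (\<lambda>z. \<Sum>i\<in>I. f i z) x = (\<Sum>i\<in>I. iter_int (f i) x)"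
  using assms
proof (induction I)
  case empty
  then show ?case by (simp add: iter_int_def)
next
  case (insert i I)
  have "iter_int (\<lambda>z. f i z + (\<Sum>i\<in>I. f i z)) x = iter_int (f i) x + iter_int (\<lambda>z. \<Sum>i\<in>I. f i z) x"
    using insert by (intro iter_int_add[of l]) (auto intro!: continuous_intros)
  then show ?case using insert by simp
qed

text \<open>Terms of the Picard series for \<open>y'' = (p + lam) * y\<close>: the zeroth one
  carries the Cauchy data \<open>a\<close>, \<open>b\<close>, and each later one has
  \<open>p + lam\<close> times its predecessor as second derivative.\<close>

primrec picard :: "(real \<Rightarrow> complex) \<Rightarrow> complex \<Rightarrow> complex \<Rightarrow> nat \<Rightarrow> complex \<Rightarrow> real \<Rightarrow> complex" where
  "picard p a b 0 = (\<lambda>lam x. a + b * of_real x)"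
| "picard p a b (Suc n) = (\<lambda>lam. iter_int (\<lambda>z. (p z + lam) * picard p a b n lam z))"

lemma picard_cont:
  assumes "continuous_on {0..l} p"
  shows "continuous_on {0..l} (picard p a b n lam)"
proof (induction n)
  case 0
  then show ?case by (auto intro!: continuous_intros)
next
  case (Suc n)
  then show ?case using assms by (auto intro!: iter_int_cont continuous_intros)
qed

text \<open>This makes the partial sums of the series entire in \<open>lam\<close>. Continuity of
  the coefficients is carried along because the next term integrates them.\<close>

lemma picard_polynomial:
  assumes p: "continuous_on {0..l} p"
  shows "\<exists>g. (\<forall>k. continuous_on {0..l} (g k)) \<and>
           (\<forall>lam. \<forall>x\<in>{0..l}. picard p a b n lam x = (\<Sum>k\<le>n. g k x * lam ^ k))"
proof (induction n)
  case 0
  show ?case by (intro exI[of _ "\<lambda>k x. a + b * of_real x"]) (auto intro!: continuous_intros)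
next
  case (Suc n)
  then obtain g where g: "\<And>k. continuous_on {0..l} (g k)"
    "\<And>lam x. x \<in> {0..l} \<Longrightarrow> picard p a b n lam x = (\<Sum>k\<le>n. g k x * lam ^ k)"
    by blast
  \<comment> \<open>The power \<open>lam ^ k\<close> arises from \<open>p\<close> times the old
    coefficient \<open>k\<close> and from \<open>lam\<close> times the old coefficient
    \<open>k - 1\<close>. The cutoff matters: nothing forces \<open>g k\<close> to vanish for
    \<open>k > n\<close>.\<close>
  define h where "h k x = (if k \<le> n then iter_int (\<lambda>z. p z * g k z) x else 0) +
     (case k of 0 \<Rightarrow> 0 | Suc j \<Rightarrow> iter_int (g j) x)" for k x
  have h: "continuous_on {0..l} (h k)" for k
    unfolding h_def using g(1) p
    by (cases "k \<le> n"; cases k) (auto intro!: continuous_intros iter_int_cont)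
  have "picard p a b (Suc n) lam x = (\<Sum>k\<le>Suc n. h k x * lam ^ k)" if x: "x \<in> {0..l}" for lam x
  proof -
    have "picard p a b (Suc n) lam x =
        iter_int (\<lambda>z. \<Sum>k\<le>n. (p z * g k z) * lam ^ k + g k z * lam ^ Suc k) x"
      using x by (auto intro!: iter_int_cong simp: g(2) sum_distrib_left algebra_simps sum.distrib)
    also have "\<dots> = (\<Sum>k\<le>n. iter_int (\<lambda>z. (p z * g k z) * lam ^ k + g k z * lam ^ Suc k) x)"
      using g(1) p x by (intro iter_int_sum[of _ l]) (auto intro!: continuous_intros)
    also have "\<dots> = (\<Sum>k\<le>n. iter_int (\<lambda>z. (p z * g k z) * lam ^ k) x + iter_int (\<lambda>z. g k z * lam ^ Suc k) x)"
      using g(1) p x by (intro sum.cong iter_int_add[of l]) (auto intro!: continuous_intros)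
    also have "\<dots> = (\<Sum>k\<le>n. iter_int (\<lambda>z. p z * g k z) x * lam ^ k) + (\<Sum>k\<le>n. iter_int (g k) x * lam ^ Suc k)"
      unfolding iter_int_cmult by (rule sum.distrib)
    also have "\<dots> = (\<Sum>k\<le>Suc n. h k x * lam ^ k)"
    proof -
      have "(\<Sum>k\<le>Suc n. h k x * lam ^ k) =
          (\<Sum>k\<le>Suc n. (if k \<le> n then iter_int (\<lambda>z. p z * g k z) x else 0) * lam ^ k) +
          (\<Sum>k\<le>Suc n. (case k of 0 \<Rightarrow> 0 | Suc j \<Rightarrow> iter_int (g j) x) * lam ^ k)"
        by (simp only: h_def distrib_right sum.distrib)
      moreover have "(\<Sum>k\<le>Suc n. (if k \<le> n then iter_int (\<lambda>z. p z * g k z) x else 0) * lam ^ k) =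
          (\<Sum>k\<le>n. iter_int (\<lambda>z. p z * g k z) x * lam ^ k)"
        by simp
      moreover have "(\<Sum>k\<le>Suc n. (case k of 0 \<Rightarrow> 0 | Suc j \<Rightarrow> iter_int (g j) x) * lam ^ k) =
          (\<Sum>k\<le>n. iter_int (g k) x * lam ^ Suc k)"
        by (simp only: sum.atMost_Suc_shift) simp
      ultimately show ?thesis by simp
    qed
    finally show ?thesis .
  qed
  with h show ?case by blast
qed

text \<open>Of the two integrations in a Picard step, the inner one is estimated crudely by the
  length \<open>l\<close>; the outer one raises the power of \<open>x\<close> and produces the
  factorial. \<open>A\<close> bounds the zeroth term.\<close>

lemma picard_bounds:
  fixes a b :: complex
  assumes p: "continuous_on {0..l} p" and L: "\<And>x. x \<in> {0..l} \<Longrightarrow> norm (p x + lam) \<le> L"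
    and x: "x \<in> {0..l}"
  defines "A \<equiv> norm a + norm b * l"
  shows "norm (picard p a b n lam x) \<le> A * (L * l * x) ^ n / fact n"
    and "norm (integral {0..x} (\<lambda>z. (p z + lam) * picard p a b n lam z)) \<le> L * l * (A * (L * l * x) ^ n / fact n)"
proof -
  have L0: "0 \<le> L" and l0: "0 \<le> l" using L[OF x] x by (auto intro: order_trans[OF norm_ge_zero])
  have A0: "0 \<le> A" using l0 by (simp add: A_def)
  have step: "norm (integral {0..x} (\<lambda>z. (p z + lam) * picard p a b n lam z)) \<le> L * l * (A * (L * l * x) ^ n / fact n)"
    if IH: "\<And>x. x \<in> {0..l} \<Longrightarrow> norm (picard p a b n lam x) \<le> A * (L * l * x) ^ n / fact n" and x: "x \<in> {0..l}" for n x
  proof -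
    have "norm (integral {0..x} (\<lambda>z. (p z + lam) * picard p a b n lam z)) \<le> (L * (A * (L * l * x) ^ n / fact n)) * (x - 0)"
    proof (rule integral_bound)
      show "continuous_on {0..x} (\<lambda>z. (p z + lam) * picard p a b n lam z)"
        using x by (intro continuous_intros continuous_on_subset[OF p] continuous_on_subset[OF picard_cont[OF p]]) auto
      fix z assume z: "z \<in> {0..x}"
      have "norm (picard p a b n lam z) \<le> A * (L * l * z) ^ n / fact n" using IH z x by auto
      also have "\<dots> \<le> A * (L * l * x) ^ n / fact n"
        using z x A0 L0 l0 by (intro divide_right_mono mult_left_mono power_mono) auto
      finally show "norm ((p z + lam) * picard p a b n lam z) \<le> L * (A * (L * l * x) ^ n / fact n)"
        using L[of z] z x L0 unfolding norm_mult by (intro mult_mono) auto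
    qed (use x in auto)
    also have "\<dots> \<le> (L * (A * (L * l * x) ^ n / fact n)) * l"
      using x L0 A0 l0 by (intro mult_left_mono) auto
    finally show ?thesis by (simp add: mult_ac)
  qed
  have 1: "norm (picard p a b n lam x) \<le> A * (L * l * x) ^ n / fact n" if "x \<in> {0..l}" for n x
    using that
  proof (induction n arbitrary: x)
    case 0
    have "norm (a + b * of_real x) \<le> norm a + norm b * x"
      using 0 by (intro norm_triangle_le) (auto simp: norm_mult)
    also have "\<dots> \<le> A" using 0 by (auto simp: A_def intro!: mult_left_mono)
    finally show ?case by simp
  next
    case (Suc n)
    let ?G = "\<lambda>y. integral {0..y} (\<lambda>z. (p z + lam) * picard p a b n lam z)"
    have Gb: "norm (?G y) \<le> L * l * (A * (L * l * y) ^ n / fact n)" if "y \<in> {0..x}" for y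
      using that Suc by (intro step) auto
    have hi: "((\<lambda>y. L * l * (A * (L * l * y) ^ n / fact n)) has_integral
        (A * (L * l * x) ^ Suc n / fact (Suc n) - A * (L * l * 0) ^ Suc n / fact (Suc n))) {0..x}"
    proof (rule fundamental_theorem_of_calculus)
      show "((\<lambda>y. A * (L * l * y) ^ Suc n / fact (Suc n)) has_vector_derivative
           L * l * (A * (L * l * y) ^ n / fact n)) (at y within {0..x})" for y
        unfolding has_real_derivative_iff_has_vector_derivative[symmetric]
        by (rule derivative_eq_intros refl | simp add: divide_simps del: power_Suc)+
    qed (use Suc in auto)
    have "norm (integral {0..x} ?G) \<le> integral {0..x} (\<lambda>y. L * l * (A * (L * l * y) ^ n / fact n))"
    proof (rule integral_norm_bound_integral)
      have c: "continuous_on {0..x} (\<lambda>z. (p z + lam) * picard p a b n lam z)"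
        using Suc by (intro continuous_intros continuous_on_subset[OF p] continuous_on_subset[OF picard_cont[OF p]]) auto
      show "?G integrable_on {0..x}"
        by (intro integrable_continuous_interval indefinite_integral_continuous_1) (rule c)
      show "(\<lambda>y. L * l * (A * (L * l * y) ^ n / fact n)) integrable_on {0..x}"
        using hi by (rule has_integral_integrable)
    qed (rule Gb)
    also have "\<dots> = A * (L * l * x) ^ Suc n / fact (Suc n)"
      unfolding integral_unique[OF hi] by simp
    finally show ?case by (simp only: picard.simps iter_int_def)
  qed
  show "norm (picard p a b n lam x) \<le> A * (L * l * x) ^ n / fact n" using 1 x .
  show "norm (integral {0..x} (\<lambda>z. (p z + lam) * picard p a b n lam z)) \<le> L * l * (A * (L * l * x) ^ n / fact n)"
    using step[OF 1 x] .
qed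

lemma picard_summable:
  fixes A B C :: real
  shows "summable (\<lambda>n. C * (A * B ^ n / fact n))"
  using summable_mult[OF summable_exp[of B], of "C * A"] by (simp add: field_simps)

text \<open>The factorial majorant is uniform in \<open>x\<close> and in bounded \<open>lam\<close>.
  Hence the series may be differentiated term by term in \<open>x\<close>, and for fixed
  \<open>x\<close> it is a locally uniform limit of polynomials in \<open>lam\<close>.\<close>

lemma ode_existence:
  assumes p: "continuous_on {0..l} p" and l: "0 < l"
  shows "\<exists>Y Y'. (\<forall>lam. ode_sol l (\<lambda>x. p x + lam) (\<lambda>x. 0) (Y lam) (Y' lam)) \<and>
    (\<forall>lam. Y lam 0 = a) \<and> (\<forall>lam. Y' lam 0 = b) \<and>
    (\<forall>x\<in>{0..l}. (\<lambda>lam. Y lam x) holomorphic_on UNIV)"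
proof -
  define F where "F = picard p a b"
  define G where "G n lam x = integral {0..x} (\<lambda>z. (p z + lam) * F n lam z)" for n lam x
  define A where "A = norm a + norm b * l"
  have "bounded (p ` {0..l})"
    using p by (intro compact_imp_bounded compact_continuous_image) auto
  then obtain M where M: "\<And>x. x \<in> {0..l} \<Longrightarrow> norm (p x) \<le> M"
    unfolding bounded_iff by blast
  have M0: "0 \<le> M" using M[of 0] l by (auto intro: order_trans[OF norm_ge_zero])
  have A0: "0 \<le> A" using l by (simp add: A_def)
  have Fb: "norm (F n lam x) \<le> A * (L * l * l) ^ n / fact n"
    and Gb: "norm (G n lam x) \<le> L * l * (A * (L * l * l) ^ n / fact n)"
    if "x \<in> {0..l}" "M + norm lam \<le> L" for n lam x L
  proof -
    have L: "norm (p z + lam) \<le> L" if "z \<in> {0..l}" for z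
      using M[OF that] \<open>M + norm lam \<le> L\<close> norm_triangle_ineq[of "p z" lam] by linarith
    have L0: "0 \<le> L" using that(2) M0 norm_ge_zero[of lam] by linarith
    have le: "A * (L * l * x) ^ n / fact n \<le> A * (L * l * l) ^ n / fact n"
      using that(1) A0 L0 l by (intro divide_right_mono mult_left_mono power_mono) auto
    show "norm (F n lam x) \<le> A * (L * l * l) ^ n / fact n"
      using picard_bounds(1)[OF p L that(1), of a b n] le unfolding F_def A_def by linarith
    have "L * l * (A * (L * l * x) ^ n / fact n) \<le> L * l * (A * (L * l * l) ^ n / fact n)"
      using le L0 l by (intro mult_left_mono) auto
    then show "norm (G n lam x) \<le> L * l * (A * (L * l * l) ^ n / fact n)"
      using picard_bounds(2)[OF p L that(1), of a b n] unfolding F_def G_def A_def by linarith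
  qed
  have Fsum: "summable (\<lambda>n. F n lam x)" if "x \<in> {0..l}" for lam x
    using Fb[OF that order_refl] by (intro summable_comparison_test'[OF picard_summable[of 1 A]]) auto
  have Gsum: "summable (\<lambda>n. G n lam x)" if "x \<in> {0..l}" for lam x
    using Gb[OF that order_refl] by (intro summable_comparison_test'[OF picard_summable]) auto
  have cont: "continuous_on {0..l} (\<lambda>z. (p z + lam) * F n lam z)" for n lam
    using p picard_cont[OF p] by (auto simp: F_def intro!: continuous_intros)
  define Y where "Y lam x = (\<Sum>n. F n lam x)" for lam x
  define Y' where "Y' lam x = b + (\<Sum>n. G n lam x)" for lam x
  have sol: "ode_sol l (\<lambda>x. p x + lam) (\<lambda>x. 0) (Y lam) (Y' lam)" for lam
    unfolding ode_sol_def
  proof (intro ballI conjI)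
    fix x assume x: "x \<in> {0..l}"
    \<comment> \<open>The derivatives of the terms \<open>F n\<close>: slope \<open>b\<close> for
      the zeroth one, then \<open>G\<close> shifted by one index.\<close>
    define H where "H n x = (case n of 0 \<Rightarrow> b | Suc n \<Rightarrow> G n lam x)" for n x
    define L where "L = M + norm lam"
    have x0: "0 \<in> {0..l}" using l by simp
    have "((\<lambda>x. \<Sum>n. F n lam x) has_vector_derivative (\<Sum>n. H n x)) (at x within {0..l})"
    proof (rule has_vector_derivative_series[where a = "\<lambda>n. case n of 0 \<Rightarrow> norm b | Suc n \<Rightarrow> L * l * (A * (L * l * l) ^ n / fact n)"])
      fix n x assume x: "x \<in> {0..l}"
      show "(F n lam has_vector_derivative H n x) (at x within {0..l})"
      proof (cases n)
        case 0
        then show ?thesis unfolding F_def H_def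
          by (auto intro!: derivative_eq_intros simp: has_vector_derivative_def fun_eq_iff scaleR_conv_of_real)
      next
        case (Suc m)
        then show ?thesis using iter_int_deriv[OF cont x, of lam m] by (simp add: F_def H_def G_def)
      qed
      show "norm (H n x) \<le> (case n of 0 \<Rightarrow> norm b | Suc n \<Rightarrow> L * l * (A * (L * l * l) ^ n / fact n))"
        using Gb[OF x, of lam L] by (auto simp: H_def L_def split: nat.split)
    next
      show "summable (\<lambda>n. case n of 0 \<Rightarrow> norm b | Suc n \<Rightarrow> L * l * (A * (L * l * l) ^ n / fact n))"
        by (subst summable_Suc_iff[symmetric]) (simp only: nat.case picard_summable)
    qed (use Fsum x x0 in auto)
    moreover have "(\<Sum>n. H n x) = Y' lam x"
    proof -
      have "summable (\<lambda>n. H n x)"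
        by (subst summable_Suc_iff[symmetric]) (simp add: H_def Gsum[OF x])
      then show ?thesis
        using suminf_split_head[of "\<lambda>n. H n x"] by (simp add: H_def Y'_def)
    qed
    ultimately show "(Y lam has_vector_derivative Y' lam x) (at x within {0..l})"
      by (simp add: Y_def[abs_def])
    have "((\<lambda>x. \<Sum>n. G n lam x) has_vector_derivative (\<Sum>n. (p x + lam) * F n lam x)) (at x within {0..l})"
    proof (rule has_vector_derivative_series[where a = "\<lambda>n. L * (A * (L * l * l) ^ n / fact n)"])
      fix n x assume x: "x \<in> {0..l}"
      show "(G n lam has_vector_derivative (p x + lam) * F n lam x) (at x within {0..l})"
        unfolding G_def by (rule integral_deriv[OF cont x])
      have "norm (p x + lam) \<le> L"
        using M[OF x] norm_triangle_ineq[of "p x" lam] by (simp add: L_def)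
      then show "norm ((p x + lam) * F n lam x) \<le> L * (A * (L * l * l) ^ n / fact n)"
        unfolding norm_mult using Fb[OF x, of lam L] M0
        by (intro mult_mono) (auto simp: L_def)
    next
      show "summable (\<lambda>n. L * (A * (L * l * l) ^ n / fact n))"
        by (rule picard_summable)
    qed (use Gsum x x0 in auto)
    then have "((\<lambda>x. b + (\<Sum>n. G n lam x)) has_vector_derivative 0 + (p x + lam) * (\<Sum>n. F n lam x)) (at x within {0..l})"
      by (intro has_vector_derivative_add has_vector_derivative_const) (simp add: suminf_mult Fsum[OF x])
    then show "(Y' lam has_vector_derivative (p x + lam) * Y lam x + 0) (at x within {0..l})"
      by (simp add: Y_def Y'_def[abs_def])
  qed
  moreover have "Y lam 0 = a" for lam
  proof -
    have "F n lam 0 = (if n = 0 then a else 0)" for n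
      by (cases n) (auto simp: F_def iter_int_def)
    then show ?thesis using suminf_finite[of "{0}" "\<lambda>n. F n lam 0"] by (simp add: Y_def)
  qed
  moreover have "Y' lam 0 = b" for lam by (simp add: Y'_def G_def)
  moreover have "(\<lambda>lam. Y lam x) holomorphic_on UNIV" if x: "x \<in> {0..l}" for x
  proof (rule holomorphic_uniform_sequence[OF open_UNIV, where f = "\<lambda>n lam. \<Sum>i<n. F i lam x"])
    have "(\<lambda>lam. F i lam x) holomorphic_on UNIV" for i
    proof -
      obtain g where "\<And>lam. F i lam x = (\<Sum>k\<le>i. g k x * lam ^ k)"
        using picard_polynomial[OF p, of a b i] x unfolding F_def by blast
      then show ?thesis by (auto intro!: holomorphic_intros)
    qed
    then show "(\<lambda>lam. \<Sum>i<n. F i lam x) holomorphic_on UNIV" for n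
      by (intro holomorphic_intros)
    fix z :: complex
    \<comment> \<open>Bounds \<open>M + norm lam\<close> for all \<open>lam\<close> in
      \<open>cball z 1\<close>.\<close>
    define L where "L = M + norm z + 1"
    have "uniform_limit (cball z 1) (\<lambda>n lam. \<Sum>i<n. F i lam x) (\<lambda>lam. \<Sum>i. F i lam x) sequentially"
    proof (rule Weierstrass_m_test[where M = "\<lambda>n. 1 * (A * (L * l * l) ^ n / fact n)"])
      fix n lam assume "lam \<in> cball z 1"
      then have "norm lam \<le> norm z + 1"
        using norm_triangle_ineq2[of lam z] by (simp add: dist_norm norm_minus_commute)
      then show "norm (F n lam x) \<le> 1 * (A * (L * l * l) ^ n / fact n)"
        using Fb[OF x, of lam L] by (simp add: L_def)
    qed (rule picard_summable)
    then show "\<exists>d>0. cball z d \<subseteq> UNIV \<and>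
        uniform_limit (cball z d) (\<lambda>n lam. \<Sum>i<n. F i lam x) (\<lambda>lam. Y lam x) sequentially"
      by (intro exI[of _ 1]) (simp add: Y_def)
  qed
  ultimately show ?thesis by blast
qed

section \<open>Growth and decay of solutions\<close>

text \<open>The derivative is taken within a larger set \<open>S\<close> because solutions are
  differentiable within \<open>{0..l}\<close> while the estimates run over subintervals.\<close>

lemma vector_mvt_bound:
  fixes g :: "real \<Rightarrow> 'a::real_normed_vector"
  assumes g: "\<And>t. t \<in> {a..b} \<Longrightarrow> (g has_vector_derivative g' t) (at t within S)"
    and S: "{a..b} \<subseteq> S" and "a \<le> b" and C: "\<And>t. t \<in> {a..b} \<Longrightarrow> norm (g' t) \<le> C"
  shows "norm (g b - g a) \<le> C * (b - a)"
proof -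
  have "norm (g b - g a) \<le> C * norm (b - a)"
  proof (rule differentiable_bound[of "{a..b}" g "\<lambda>t h. h *\<^sub>R g' t"])
    fix t assume t: "t \<in> {a..b}"
    have "(g has_vector_derivative g' t) (at t within {a..b})"
      using has_vector_derivative_within_subset[OF g[OF t] S] .
    then show "(g has_derivative (\<lambda>h. h *\<^sub>R g' t)) (at t within {a..b})"
      by (simp add: has_vector_derivative_def)
    show "onorm (\<lambda>h. h *\<^sub>R g' t) \<le> C"
      using onorm_scaleR_left[OF bounded_linear_ident, of "g' t"] C[OF t] onorm_id[where 'a=real] by simp
  qed (use \<open>a \<le> b\<close> in auto)
  then show ?thesis using \<open>a \<le> b\<close> by simp
qed

lemma ode_sol_cont:
  assumes "ode_sol l p f y y'"
  shows "continuous_on {0..l} y" "continuous_on {0..l} y'"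
  using assms unfolding ode_sol_def
  by (auto intro: continuous_on_vector_derivative)

lemma exp_has_vector_derivative:
  "((\<lambda>x. exp (c * complex_of_real x)) has_vector_derivative c * exp (c * of_real x)) (at x within S)"
proof -
  have "((\<lambda>z. exp (c * z)) has_field_derivative c * exp (c * of_real x)) (at (of_real x))"
    by (auto intro!: derivative_eq_intros)
  then show ?thesis
    by (rule has_vector_derivative_real_field)
qed

text \<open>Factorising \<open>d\<^sup>2/dx\<^sup>2 - k\<^sup>2\<close> as \<open>(d/dx - k) (d/dx + k)\<close> replaces Green's functions by two first order equations.\<close>

lemma ode_sol_factor:
  assumes "ode_sol l (\<lambda>x. p x + k\<^sup>2) f y y'" "x \<in> {0..l}"
  shows "((\<lambda>x. exp (- k * of_real x) * (y' x + k * y x)) has_vector_derivative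
      exp (- k * of_real x) * (p x * y x + f x)) (at x within {0..l})"
proof -
  have y: "(y has_vector_derivative y' x) (at x within {0..l})"
    "(y' has_vector_derivative ((p x + k\<^sup>2) * y x + f x)) (at x within {0..l})"
    using assms by (auto simp: ode_sol_def)
  have "((\<lambda>x. exp (- k * of_real x) * (y' x + k * y x)) has_vector_derivative
      exp (- k * of_real x) * ((p x + k\<^sup>2) * y x + f x + k * y' x) +
      (- k * exp (- k * of_real x)) * (y' x + k * y x)) (at x within {0..l})"
    by (intro has_vector_derivative_mult exp_has_vector_derivative has_vector_derivative_add
        has_vector_derivative_mult_right y)
  then show ?thesis by (simp add: algebra_simps power2_eq_square)
qed

lemma sup_attained:
  fixes h :: "real \<Rightarrow> real"
  assumes "continuous_on {0..l} h" "0 < l"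
  obtains x0 where "x0 \<in> {0..l}" "\<And>x. x \<in> {0..l} \<Longrightarrow> h x \<le> h x0"
  using continuous_attains_sup[of "{0..l}" h] assms by auto

text \<open>The factorised equation is integrated from \<open>0\<close>. The bound \<open>N\<close>
  is provisional and is removed later by absorption; \<open>\<bar>Re k\<bar>\<close> appears because
  the estimate is applied to \<open>k\<close> and to \<open>- k\<close>.\<close>

lemma ode_sol_growth_step:
  assumes sol: "ode_sol l (\<lambda>x. p x + k\<^sup>2) (\<lambda>_. 0) y y'"
    and M: "\<And>x. x \<in> {0..l} \<Longrightarrow> norm (p x) \<le> M"
    and N: "\<And>x. x \<in> {0..l} \<Longrightarrow> norm (y x) \<le> N * exp (\<bar>Re k\<bar> * x)"
    and x: "x \<in> {0..l}"
  shows "norm (y' x + k * y x - exp (k * of_real x) * (y' 0 + k * y 0)) \<le> l * M * N * exp (\<bar>Re k\<bar> * x)"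
proof -
  let ?r = "\<bar>Re k\<bar>"
  define z where "z x = exp (- k * of_real x) * (y' x + k * y x)" for x
  have M0: "0 \<le> M" using M[OF x] by (rule order_trans[OF norm_ge_zero])
  have "0 \<le> N * exp (?r * x)" using N[OF x] by (rule order_trans[OF norm_ge_zero])
  then have N0: "0 \<le> N" by (simp add: zero_le_mult_iff)
  have "norm (z x - z 0) \<le> (exp ((?r - Re k) * x) * (M * N)) * (x - 0)"
  proof (rule vector_mvt_bound)
    fix t assume t: "t \<in> {0..x}"
    show "(z has_vector_derivative exp (- k * of_real t) * (p t * y t)) (at t within {0..l})"
      unfolding z_def using ode_sol_factor[OF sol, of t] t x by auto
    have "norm (exp (- k * of_real t) * (p t * y t)) \<le> exp (- Re k * t) * (M * (N * exp (?r * t)))"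
      using M[of t] N[of t] t x M0 unfolding norm_mult by (intro mult_mono mult_nonneg_nonneg) auto
    also have "\<dots> = exp ((?r - Re k) * t) * (M * N)"
      by (simp add: algebra_simps flip: exp_add)
    also have "\<dots> \<le> exp ((?r - Re k) * x) * (M * N)"
      using t M0 N0 by (intro mult_right_mono) (auto intro: mult_left_mono)
    finally show "norm (exp (- k * of_real t) * (p t * y t)) \<le> exp ((?r - Re k) * x) * (M * N)" .
  qed (use x in auto)
  also have "\<dots> \<le> (exp ((?r - Re k) * x) * (M * N)) * l"
    using x M0 N0 by (intro mult_left_mono) auto
  finally have "exp (Re k * x) * norm (z x - z 0) \<le> exp (Re k * x) * ((exp ((?r - Re k) * x) * (M * N)) * l)"
    by (intro mult_left_mono) auto
  also have "\<dots> = l * M * N * exp (?r * x)"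
    by (simp add: algebra_simps flip: exp_add)
  also have "exp (Re k * x) * norm (z x - z 0) = norm (exp (k * of_real x) * (z x - z 0))"
    by (simp add: norm_mult)
  also have "exp (k * of_real x) * (z x - z 0) = y' x + k * y x - exp (k * of_real x) * (y' 0 + k * y 0)"
    by (simp add: z_def algebra_simps exp_minus_inverse flip: exp_add mult.assoc)
  finally show ?thesis .
qed

text \<open>Writing \<open>2 * k * y\<close> as the difference of \<open>y' + k * y\<close> and
  \<open>y' - k * y\<close> gains a factor \<open>norm k\<close>. With \<open>N\<close> the best
  constant, the contribution \<open>l * M * N\<close> of the potential is at most half of
  \<open>norm k * N\<close> and is absorbed.\<close>

lemma ode_sol_growth:
  assumes sol: "ode_sol l (\<lambda>x. p x + k\<^sup>2) (\<lambda>_. 0) y y'"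
    and M: "\<And>x. x \<in> {0..l} \<Longrightarrow> norm (p x) \<le> M"
    and l: "0 < l" and k: "0 < norm k" "2 * l * M \<le> norm k"
    and x: "x \<in> {0..l}"
  shows "norm (y x) \<le> 2 * (norm (y 0) + norm (y' 0) / norm k) * exp (\<bar>Re k\<bar> * x)"
proof -
  let ?r = "\<bar>Re k\<bar>"
  have "continuous_on {0..l} (\<lambda>x. norm (y x) * exp (- (?r * x)))"
    using ode_sol_cont[OF sol] by (intro continuous_intros)
  then obtain x0 where x0: "x0 \<in> {0..l}"
    "\<And>x. x \<in> {0..l} \<Longrightarrow> norm (y x) * exp (- (?r * x)) \<le> norm (y x0) * exp (- (?r * x0))"
    using sup_attained l by blast
  define N where "N = norm (y x0) * exp (- (?r * x0))"
  have N: "norm (y x) \<le> N * exp (?r * x)" if "x \<in> {0..l}" for x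
    using x0(2)[OF that] by (simp add: N_def exp_minus field_simps)
  have sol': "ode_sol l (\<lambda>x. p x + (- k)\<^sup>2) (\<lambda>_. 0) y y'" using sol by simp
  define a where "a = norm (y' 0) + norm k * norm (y 0)"
  have bnd: "norm (y' x + s * y x) \<le> (a + l * M * N) * exp (?r * x)"
    if s: "s = k \<or> s = - k" and x: "x \<in> {0..l}" for s x
  proof -
    have "norm (y' x + s * y x - exp (s * of_real x) * (y' 0 + s * y 0)) \<le> l * M * N * exp (\<bar>Re s\<bar> * x)"
      using s sol sol' M N x by (intro ode_sol_growth_step[where p = p]) auto
    then have 1: "norm (y' x + s * y x - exp (s * of_real x) * (y' 0 + s * y 0)) \<le> l * M * N * exp (?r * x)"
      using s by auto
    have "norm (y' 0 + s * y 0) \<le> a"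
      using s norm_triangle_ineq[of "y' 0" "s * y 0"] by (auto simp: a_def norm_mult)
    moreover have "exp (Re s * x) \<le> exp (?r * x)"
      using s x by (auto intro!: mult_right_mono)
    ultimately have "norm (exp (s * of_real x) * (y' 0 + s * y 0)) \<le> exp (?r * x) * a"
      unfolding norm_mult by (intro mult_mono) auto
    then show ?thesis
      using 1 norm_triangle_ineq2[of "y' x + s * y x" "exp (s * of_real x) * (y' 0 + s * y 0)"]
      by (simp add: algebra_simps)
  qed
  have main: "norm k * norm (y x) \<le> (a + l * M * N) * exp (?r * x)" if x: "x \<in> {0..l}" for x
  proof -
    have "2 * k * y x = (y' x + k * y x) - (y' x + (- k) * y x)" by (simp add: algebra_simps)
    then have "norm (2 * k * y x) \<le> norm (y' x + k * y x) + norm (y' x + (- k) * y x)"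
      by (metis norm_triangle_ineq4)
    then show ?thesis using bnd[of k x] bnd[of "- k" x] x by (simp add: norm_mult)
  qed
  have "norm k * N = norm k * norm (y x0) * exp (- (?r * x0))"
    by (simp add: N_def)
  also have "\<dots> \<le> (a + l * M * N) * exp (?r * x0) * exp (- (?r * x0))"
    using main[OF x0(1)] by (intro mult_right_mono) auto
  also have "\<dots> = a + l * M * N" by (simp add: exp_minus)
  finally have "2 * (norm k * N) \<le> 2 * a + (2 * l * M) * N" by simp
  also have "\<dots> \<le> 2 * a + norm k * N"
    using k by (intro add_left_mono mult_right_mono) (auto simp: N_def)
  finally have "N \<le> 2 * (a / norm k)" using k by (simp add: field_simps)
  also have "a / norm k = norm (y 0) + norm (y' 0) / norm k"
    using k by (simp add: a_def add_divide_distrib)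
  finally have "N * exp (?r * x) \<le> 2 * (norm (y 0) + norm (y' 0) / norm k) * exp (?r * x)"
    by (intro mult_right_mono) auto
  then show ?thesis using N[OF x] by linarith
qed

text \<open>\<open>y' - k * y\<close> is integrated forward from \<open>0\<close> and
  \<open>y' + k * y\<close> backward from \<open>l\<close>, each in the direction in which it is
  damped, starting from the crude bound \<open>B\<close>. As in the growth estimate, the best
  constant for a weighted norm is then absorbed.\<close>

lemma ode_sol_decay:
  assumes sol: "ode_sol l (\<lambda>x. p x + k\<^sup>2) f y y'"
    and M: "\<And>x. x \<in> {0..l} \<Longrightarrow> norm (p x) \<le> M"
    and f: "\<And>x. x \<in> {0..l} \<Longrightarrow> norm (f x) \<le> G * exp (- (Re k * l))"
    and B: "\<And>x. x \<in> {0..l} \<Longrightarrow> norm (y x) \<le> B" "\<And>x. x \<in> {0..l} \<Longrightarrow> norm (y' x) \<le> B"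
    and l: "0 < l" and k: "0 < Re k" "1 \<le> norm k" "2 * l * M \<le> norm k"
    and x: "x \<in> {0..l / 2}"
  shows "norm (y x) \<le> 2 * (4 * B + 2 * l * G) * exp (- (Re k * x))"
proof -
  let ?r = "Re k"
  \<comment> \<open>The damped influence of the two ends. On the first half of the interval the
    second summand is at most the first, which gives the final factor \<open>2\<close>.\<close>
  define w where "w x = exp (- (?r * x)) + exp (- (?r * (l - x)))" for x
  have w0: "0 < w x" for x by (simp add: w_def add_pos_pos)
  have zl: "0 \<in> {0..l}" using l by simp
  have B0: "0 \<le> B" using B(1)[OF zl] by (rule order_trans[OF norm_ge_zero])
  have M0: "0 \<le> M" using M[OF zl] by (rule order_trans[OF norm_ge_zero])
  have "0 \<le> G * exp (- (Re k * l))" using f[OF zl] by (rule order_trans[OF norm_ge_zero])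
  then have G0: "0 \<le> G" by (simp add: zero_le_mult_iff)
  have "continuous_on {0..l} (\<lambda>x. norm (y x) / w x)"
    using ode_sol_cont[OF sol] w0 unfolding w_def
    by (intro continuous_intros) (auto simp: add_pos_pos less_imp_neq[symmetric] add_eq_0_iff_both_eq_0)
  then obtain x0 where x0: "x0 \<in> {0..l}"
    "\<And>x. x \<in> {0..l} \<Longrightarrow> norm (y x) / w x \<le> norm (y x0) / w x0"
    using sup_attained l by blast
  define N where "N = norm (y x0) / w x0"
  have N0: "0 \<le> N" using w0[of x0] by (simp add: N_def)
  have N: "norm (y x) \<le> N * w x" if "x \<in> {0..l}" for x
    using x0(2)[OF that] w0[of x] by (simp add: N_def pos_divide_le_eq)
  have src: "norm (p x * y x + f x) \<le> (M * N + G) * w x" if x: "x \<in> {0..l}" for x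
  proof -
    have "norm (p x * y x) \<le> M * (N * w x)"
      unfolding norm_mult using M[OF x] N[OF x] M0 by (intro mult_mono) auto
    moreover have "exp (- (?r * l)) \<le> w x"
      using x k by (auto simp: w_def intro!: add_increasing2 mult_left_mono)
    then have "norm (f x) \<le> G * w x"
      using f[OF x] G0 by (meson mult_left_mono order_trans)
    ultimately show ?thesis
      using norm_triangle_ineq[of "p x * y x" "f x"] by (simp add: algebra_simps)
  qed
  have kB: "norm (y' x + s * y x) \<le> 2 * norm k * B" if "s = k \<or> s = - k" "x \<in> {0..l}" for s x
  proof -
    have "norm (y' x + s * y x) \<le> norm (y' x) + norm k * norm (y x)"
      using that norm_triangle_ineq[of "y' x" "s * y x"] by (auto simp: norm_mult)
    also have "\<dots> \<le> 1 * B + norm k * B"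
      using B[OF that(2)] by (intro add_mono mult_left_mono) auto
    also have "\<dots> \<le> norm k * B + norm k * B"
      using k B0 by (intro add_right_mono mult_right_mono) auto
    finally show ?thesis by (simp add: mult_ac)
  qed
  have minus: "norm (y' x - k * y x) \<le> (2 * norm k * B + l * (M * N + G)) * w x" if x: "x \<in> {0..l}" for x
  proof -
    define z where "z x = exp (- (- k) * of_real x) * (y' x + (- k) * y x)" for x
    have sol': "ode_sol l (\<lambda>x. p x + (- k)\<^sup>2) f y y'" using sol by simp
    have "norm (z x - z 0) \<le> (exp (?r * x) * w x * (M * N + G)) * (x - 0)"
    proof (rule vector_mvt_bound)
      fix t assume t: "t \<in> {0..x}"
      show "(z has_vector_derivative exp (- (- k) * of_real t) * (p t * y t + f t)) (at t within {0..l})"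
        unfolding z_def using ode_sol_factor[OF sol', of t] t x by auto
      have "norm (exp (- (- k) * of_real t) * (p t * y t + f t)) \<le> exp (?r * t) * ((M * N + G) * w t)"
        using src[of t] t x unfolding norm_mult by (intro mult_mono) auto
      also have "\<dots> = (exp (?r * t) * w t) * (M * N + G)" by simp
      also have "\<dots> \<le> (exp (?r * x) * w x) * (M * N + G)"
      proof (rule mult_right_mono)
        \<comment> \<open>This form shows monotonicity in \<open>t\<close>, so the integrand is
          largest at \<open>x\<close>. In the backward estimate the corresponding expression
          decreases, and \<open>x\<close> is again the worst point.\<close>
        have eq: "exp (?r * t) * w t = 1 + exp (?r * (2 * t - l))" for t
          by (simp add: w_def algebra_simps flip: exp_add)
        show "exp (?r * t) * w t \<le> exp (?r * x) * w x"
          unfolding eq using t k by (auto intro: mult_left_mono)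
      qed (use M0 N0 G0 in auto)
      finally show "norm (exp (- (- k) * of_real t) * (p t * y t + f t)) \<le> exp (?r * x) * w x * (M * N + G)" .
    qed (use x in auto)
    also have "\<dots> \<le> (exp (?r * x) * w x * (M * N + G)) * l"
      using x M0 N0 G0 w0[of x] by (intro mult_left_mono mult_nonneg_nonneg) auto
    finally have "norm (z x) \<le> norm (z 0) + exp (?r * x) * w x * (M * N + G) * l"
      using norm_triangle_ineq2[of "z x" "z 0"] by linarith
    also have "\<dots> \<le> 2 * norm k * B + exp (?r * x) * w x * (M * N + G) * l"
      using kB[of "- k" 0] l by (simp add: z_def)
    also have "\<dots> \<le> exp (?r * x) * w x * (2 * norm k * B) + exp (?r * x) * w x * (M * N + G) * l"
    proof (rule add_right_mono)
      have "1 \<le> exp (?r * x) * w x" by (simp add: w_def algebra_simps flip: exp_add)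
      then show "2 * norm k * B \<le> exp (?r * x) * w x * (2 * norm k * B)"
        using B0 mult_right_mono[of 1 "exp (?r * x) * w x" "2 * norm k * B"] by simp
    qed
    also have "norm (z x) = exp (?r * x) * norm (y' x - k * y x)"
      by (simp add: z_def norm_mult)
    finally have "exp (?r * x) * norm (y' x - k * y x) \<le> exp (?r * x) * ((2 * norm k * B + l * (M * N + G)) * w x)"
      by (simp add: algebra_simps)
    then show ?thesis by simp
  qed
  have plus: "norm (y' x + k * y x) \<le> (2 * norm k * B + l * (M * N + G)) * w x" if x: "x \<in> {0..l}" for x
  proof -
    define z where "z x = exp (- k * of_real x) * (y' x + k * y x)" for x
    have "norm (z l - z x) \<le> (exp (- (?r * x)) * w x * (M * N + G)) * (l - x)"
    proof (rule vector_mvt_bound)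
      fix t assume t: "t \<in> {x..l}"
      show "(z has_vector_derivative exp (- k * of_real t) * (p t * y t + f t)) (at t within {0..l})"
        unfolding z_def using ode_sol_factor[OF sol, of t] t x by auto
      have "norm (exp (- k * of_real t) * (p t * y t + f t)) \<le> exp (- (?r * t)) * ((M * N + G) * w t)"
        using src[of t] t x unfolding norm_mult by (intro mult_mono) auto
      also have "\<dots> = (exp (- (?r * t)) * w t) * (M * N + G)" by simp
      also have "\<dots> \<le> (exp (- (?r * x)) * w x) * (M * N + G)"
      proof (rule mult_right_mono)
        have eq: "exp (- (?r * t)) * w t = exp (- (2 * ?r * t)) + exp (- (?r * l))" for t
          by (simp add: w_def algebra_simps flip: exp_add)
        show "exp (- (?r * t)) * w t \<le> exp (- (?r * x)) * w x"
          unfolding eq using t k by (auto intro: mult_left_mono)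
      qed (use M0 N0 G0 in auto)
      finally show "norm (exp (- k * of_real t) * (p t * y t + f t)) \<le> exp (- (?r * x)) * w x * (M * N + G)" .
    qed (use x in auto)
    also have "\<dots> \<le> (exp (- (?r * x)) * w x * (M * N + G)) * l"
      using x M0 N0 G0 w0[of x] by (intro mult_left_mono mult_nonneg_nonneg) auto
    finally have "norm (z x) \<le> norm (z l) + exp (- (?r * x)) * w x * (M * N + G) * l"
      using norm_triangle_ineq3[of "z l" "z x"] by linarith
    also have "norm (z l) \<le> exp (- (?r * l)) * (2 * norm k * B)"
      using kB[of k l] l by (auto simp: z_def norm_mult)
    also have "exp (- (?r * l)) * (2 * norm k * B) \<le> exp (- (?r * x)) * w x * (2 * norm k * B)"
    proof (rule mult_right_mono)
      show "exp (- (?r * l)) \<le> exp (- (?r * x)) * w x" by (simp add: w_def algebra_simps flip: exp_add)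
    qed (use B0 in auto)
    also have "norm (z x) = exp (- (?r * x)) * norm (y' x + k * y x)"
      by (simp add: z_def norm_mult)
    finally have "exp (- (?r * x)) * norm (y' x + k * y x) \<le> exp (- (?r * x)) * ((2 * norm k * B + l * (M * N + G)) * w x)"
      by (simp add: algebra_simps)
    then show ?thesis by simp
  qed
  have main: "norm k * norm (y x) \<le> (2 * norm k * B + l * (M * N + G)) * w x" if x: "x \<in> {0..l}" for x
  proof -
    have "2 * k * y x = (y' x + k * y x) - (y' x - k * y x)" by (simp add: algebra_simps)
    then have "norm (2 * k * y x) \<le> norm (y' x + k * y x) + norm (y' x - k * y x)"
      by (metis norm_triangle_ineq4)
    then show ?thesis using plus[OF x] minus[OF x] by (simp add: norm_mult)
  qed
  have "norm k * N \<le> 2 * norm k * B + l * (M * N + G)"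
    using main[OF x0(1)] w0[of x0] by (simp add: N_def pos_divide_le_eq)
  then have "2 * (norm k * N) \<le> 4 * norm k * B + (2 * l * M) * N + 2 * l * G" by (simp add: algebra_simps)
  also have "\<dots> \<le> 4 * norm k * B + norm k * N + norm k * (2 * l * G)"
    using k B0 N0 G0 l mult_right_mono[of 1 "norm k" "2 * l * G"] by (intro add_mono mult_right_mono) auto
  finally have "norm k * N \<le> norm k * (4 * B + 2 * l * G)" by (simp add: algebra_simps)
  then have Nb: "N \<le> 4 * B + 2 * l * G" using k by (subst (asm) mult_le_cancel_left_pos) auto
  have "w x \<le> 2 * exp (- (?r * x))"
    using x k by (auto simp: w_def intro!: mult_left_mono)
  then have "N * w x \<le> (4 * B + 2 * l * G) * (2 * exp (- (?r * x)))"
    using Nb w0[of x] B0 l G0 by (intro mult_mono) auto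
  then have "norm (y x) \<le> (4 * B + 2 * l * G) * (2 * exp (- (?r * x)))"
    using N[of x] x l by auto
  then show ?thesis by (simp only: mult_ac)
qed

text \<open>For large real \<open>k\<close> the solution is close to
  \<open>cosh (k * x) + y' 0 * sinh (k * x) / k\<close>. Positivity will exclude the sign in
  \<open>C = - E\<close> and permit division by the solution.\<close>

lemma ode_sol_cosh_like_pos:
  assumes sol: "ode_sol l (\<lambda>x. p x + (of_real k)\<^sup>2) (\<lambda>_. 0) y y'"
    and y0: "y 0 = 1"
    and M: "\<And>x. x \<in> {0..l} \<Longrightarrow> norm (p x) \<le> M"
    and l: "0 < l" and k: "1 \<le> k" "2 * l * M \<le> k"
      "2 * norm (y' 0) + 4 * l * M * (1 + norm (y' 0)) < k"
    and x: "x \<in> {0..l}"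
  shows "0 < Re (y x)"
proof -
  let ?k = "complex_of_real k"
  let ?e = "norm (y' 0)"
  define N where "N = 2 * (1 + ?e)"
  have N: "norm (y x) \<le> N * exp (\<bar>Re ?k\<bar> * x)" if "x \<in> {0..l}" for x
  proof -
    have "norm (y x) \<le> 2 * (norm (y 0) + norm (y' 0) / norm ?k) * exp (\<bar>Re ?k\<bar> * x)"
      using k by (intro ode_sol_growth[OF sol M l _ _ that]) auto
    also have "\<dots> \<le> N * exp (\<bar>Re ?k\<bar> * x)"
      using k y0 by (intro mult_right_mono) (auto simp: N_def field_simps mult_le_cancel_right1)
    finally show ?thesis .
  qed
  have N': "norm (y x) \<le> N * exp (\<bar>Re (- ?k)\<bar> * x)" if "x \<in> {0..l}" for x
    using N[OF that] by simp
  define e1 where "e1 = y' x + ?k * y x - exp (?k * of_real x) * (y' 0 + ?k * y 0)"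
  define e2 where "e2 = y' x + (- ?k) * y x - exp ((- ?k) * of_real x) * (y' 0 + (- ?k) * y 0)"
  have sol': "ode_sol l (\<lambda>x. p x + (- ?k)\<^sup>2) (\<lambda>_. 0) y y'" using sol by simp
  have e: "norm e1 \<le> l * M * N * exp (k * x)" "norm e2 \<le> l * M * N * exp (k * x)"
    using ode_sol_growth_step[OF sol M N x] ode_sol_growth_step[OF sol' M N' x] k
    by (auto simp: e1_def e2_def)
  have "2 * ?k * y x = e1 - e2 + ?k * (exp (?k * of_real x) + exp (- ?k * of_real x)) +
      y' 0 * (exp (?k * of_real x) - exp (- ?k * of_real x))"
    by (simp add: e1_def e2_def y0 algebra_simps)
  moreover have "2 * k * Re (y x) = Re (2 * ?k * y x)"
    by simp
  ultimately have "2 * k * Re (y x) = Re (e1 - e2 + ?k * (exp (?k * of_real x) + exp (- ?k * of_real x)) +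
      y' 0 * (exp (?k * of_real x) - exp (- ?k * of_real x)))"
    by simp
  also have "\<dots> = Re e1 - Re e2 + k * (exp (k * x) + exp (- (k * x))) + Re (y' 0) * (exp (k * x) - exp (- (k * x)))"
    by (simp add: exp_of_real flip: of_real_mult of_real_minus)
  also have "\<dots> > 0"
  proof -
    have le1: "exp (- (k * x)) \<le> exp (k * x)" using k x by auto
    have "\<bar>Re (y' 0) * (exp (k * x) - exp (- (k * x)))\<bar> \<le> ?e * exp (k * x)"
      unfolding abs_mult using abs_Re_le_cmod[of "y' 0"] le1 by (intro mult_mono) auto
    moreover have "\<bar>Re e1\<bar> \<le> l * M * N * exp (k * x)" "\<bar>Re e2\<bar> \<le> l * M * N * exp (k * x)"
      using e abs_Re_le_cmod[of e1] abs_Re_le_cmod[of e2] by linarith+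
    moreover have "(2 * (l * M * N) + ?e) * exp (k * x) < k * exp (k * x)"
      using k by (intro mult_strict_right_mono) (auto simp: N_def algebra_simps intro: le_less_trans[rotated])
    moreover have "0 \<le> k * exp (- (k * x))" using k by auto
    ultimately show ?thesis by (simp add: algebra_simps)
  qed
  finally show ?thesis using k by (simp add: zero_less_mult_iff)
qed

text \<open>With \<open>f = 0\<close> the Wronskian is constant; an exponentially small
  \<open>f\<close> lets it drift only slightly. Both cases are used.\<close>

lemma ode_sol_wronskian:
  assumes "ode_sol l p f y y'" "ode_sol l p (\<lambda>_. 0) v v'" "x \<in> {0..l}"
  shows "((\<lambda>x. y' x * v x - y x * v' x) has_vector_derivative f x * v x) (at x within {0..l})"
proof -
  have "((\<lambda>x. y' x * v x - y x * v' x) has_vector_derivative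
      (y' x * v' x + (p x * y x + f x) * v x) - (y x * (p x * v x + 0) + y' x * v' x)) (at x within {0..l})"
    using assms unfolding ode_sol_def
    by (intro has_vector_derivative_diff has_vector_derivative_mult) auto
  then show ?thesis by (simp add: algebra_simps)
qed

section \<open>A local Borg-Marchenko theorem\<close>

lemma ode_sol_determines_potential:
  assumes p: "ode_sol l p (\<lambda>_. 0) y y'" and q: "ode_sol l q (\<lambda>_. 0) v v'"
    and a: "0 < a" "a \<le> l" and eq: "\<And>x. x \<in> {0..a} \<Longrightarrow> y x = v x"
    and nz: "\<And>x. x \<in> {0..a} \<Longrightarrow> y x \<noteq> 0" and x: "x \<in> {0..a}"
  shows "p x = q x"
proof -
  have sub: "{0..a} \<subseteq> {0..l}" using a by auto
  have unique: "h' = j'"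
    if "(h has_vector_derivative h') (at x within {0..l})" "(j has_vector_derivative j') (at x within {0..l})"
      "\<And>x. x \<in> {0..a} \<Longrightarrow> h x = j x" "x \<in> {0..a}" for h j :: "real \<Rightarrow> complex" and h' j' x
  proof -
    have "(h has_vector_derivative h') (at x within {0..a})" "(j has_vector_derivative j') (at x within {0..a})"
      using that(1,2) sub by (auto intro: has_vector_derivative_within_subset)
    moreover from this(2) have "(h has_vector_derivative j') (at x within {0..a})"
      by (rule has_vector_derivative_transform[rotated 2]) (use that in auto)
    ultimately show ?thesis
      using vector_derivative_unique_within_closed_interval[of 0 a x] a that(4) by auto
  qed
  have "y' x = v' x" if "x \<in> {0..a}" for x
  proof (rule unique[OF _ _ eq that])
    show "(y has_vector_derivative y' x) (at x within {0..l})" "(v has_vector_derivative v' x) (at x within {0..l})"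
      using p q that sub by (auto simp: ode_sol_def)
  qed
  note eq' = this
  have "p x * y x + 0 = q x * v x + 0"
  proof (rule unique[OF _ _ eq' x])
    show "(y' has_vector_derivative (p x * y x + 0)) (at x within {0..l})"
      "(v' has_vector_derivative (q x * v x + 0)) (at x within {0..l})"
      using p q x sub unfolding ode_sol_def by blast+
  qed
  then show ?thesis using eq[OF x] nz[OF x] by simp
qed

text \<open>\<open>V\<close> and \<open>W\<close> take the role of Weyl solutions, but are known
  only on one ray \<open>k = of_real t * k0\<close> and only up to sources. Of the \<open>5\<close>
  in \<open>src\<close>, one factor \<open>exp (Re k * l)\<close> is spent when a source is
  multiplied by a fundamental solution, and a product of two fundamental solutions at
  \<open>x\<close> costs \<open>exp (2 * Re k * x)\<close>; the rest is slack.\<close>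

lemma local_borg_marchenko:
  fixes p q :: "real \<Rightarrow> complex"
  assumes l: "0 < l" and p: "continuous_on {0..l} p" and q: "continuous_on {0..l} q"
    and k0: "0 < Re k0" and G0: "0 \<le> G"
    and V: "\<And>t. R \<le> t \<Longrightarrow> ode_sol l (\<lambda>x. p x + (of_real t * k0)\<^sup>2) (f t) (V t) (V' t)"
    and W: "\<And>t. R \<le> t \<Longrightarrow> ode_sol l (\<lambda>x. q x + (of_real t * k0)\<^sup>2) (g t) (W t) (W' t)"
    and init: "\<And>t. R \<le> t \<Longrightarrow> V t 0 = W t 0" "\<And>t. R \<le> t \<Longrightarrow> V' t 0 = W' t 0"
    and bnd: "\<And>t x. R \<le> t \<Longrightarrow> x \<in> {0..l} \<Longrightarrow>
        norm (V t x) \<le> B \<and> norm (V' t x) \<le> B \<and> norm (W t x) \<le> B \<and> norm (W' t x) \<le> B"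
    and src: "\<And>t x. R \<le> t \<Longrightarrow> x \<in> {0..l} \<Longrightarrow>
        norm (f t x) \<le> G * exp (- (5 * (t * Re k0) * l)) \<and> norm (g t x) \<le> G * exp (- (5 * (t * Re k0) * l))"
    and low: "\<And>t. R \<le> t \<Longrightarrow> 1 \<le> norm (V' t 0 - eta * V t 0) * (K * t ^ N)"
    and x: "x \<in> {0..l / 2}"
  shows "p x = q x"
proof -
  have "bounded (p ` {0..l} \<union> q ` {0..l})"
    using p q by (intro bounded_Un[THEN iffD2] conjI compact_imp_bounded compact_continuous_image) auto
  then obtain M where M: "\<And>x. x \<in> {0..l} \<Longrightarrow> norm (p x) \<le> M" "\<And>x. x \<in> {0..l} \<Longrightarrow> norm (q x) \<le> M"
    unfolding bounded_iff by blast
  \<comment> \<open>\<open>C\<close>, \<open>S\<close> belong to \<open>p\<close> and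
    \<open>E\<close>, \<open>Z\<close> to \<open>q\<close>. The slope \<open>eta\<close> of
    \<open>C\<close> and \<open>E\<close> makes their Wronskians with \<open>V\<close> and
    \<open>W\<close> start at \<open>V' t 0 - eta * V t 0\<close>, the quantity bounded below by
    \<open>low\<close>.\<close>
  obtain C C' where "(\<forall>lam. ode_sol l (\<lambda>x. p x + lam) (\<lambda>x. 0) (C lam) (C' lam)) \<and>
      (\<forall>lam. C lam 0 = 1) \<and> (\<forall>lam. C' lam 0 = eta) \<and>
      (\<forall>x\<in>{0..l}. (\<lambda>lam. C lam x) holomorphic_on UNIV)"
    using ode_existence[OF p l, of 1 eta] by (elim exE)
  note C = this[THEN conjunct1, rule_format] this[THEN conjunct2, THEN conjunct1, rule_format]
    this[THEN conjunct2, THEN conjunct2, THEN conjunct1, rule_format]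
    this[THEN conjunct2, THEN conjunct2, THEN conjunct2, rule_format]
  obtain S S' where "(\<forall>lam. ode_sol l (\<lambda>x. p x + lam) (\<lambda>x. 0) (S lam) (S' lam)) \<and>
      (\<forall>lam. S lam 0 = 0) \<and> (\<forall>lam. S' lam 0 = 1) \<and>
      (\<forall>x\<in>{0..l}. (\<lambda>lam. S lam x) holomorphic_on UNIV)"
    using ode_existence[OF p l, of 0 1] by (elim exE)
  note S = this[THEN conjunct1, rule_format] this[THEN conjunct2, THEN conjunct1, rule_format]
    this[THEN conjunct2, THEN conjunct2, THEN conjunct1, rule_format]
    this[THEN conjunct2, THEN conjunct2, THEN conjunct2, rule_format]
  obtain E E' where "(\<forall>lam. ode_sol l (\<lambda>x. q x + lam) (\<lambda>x. 0) (E lam) (E' lam)) \<and>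
      (\<forall>lam. E lam 0 = 1) \<and> (\<forall>lam. E' lam 0 = eta) \<and>
      (\<forall>x\<in>{0..l}. (\<lambda>lam. E lam x) holomorphic_on UNIV)"
    using ode_existence[OF q l, of 1 eta] by (elim exE)
  note E = this[THEN conjunct1, rule_format] this[THEN conjunct2, THEN conjunct1, rule_format]
    this[THEN conjunct2, THEN conjunct2, THEN conjunct1, rule_format]
    this[THEN conjunct2, THEN conjunct2, THEN conjunct2, rule_format]
  obtain Z Z' where "(\<forall>lam. ode_sol l (\<lambda>x. q x + lam) (\<lambda>x. 0) (Z lam) (Z' lam)) \<and>
      (\<forall>lam. Z lam 0 = 0) \<and> (\<forall>lam. Z' lam 0 = 1) \<and>
      (\<forall>x\<in>{0..l}. (\<lambda>lam. Z lam x) holomorphic_on UNIV)"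
    using ode_existence[OF q l, of 0 1] by (elim exE)
  note Z = this[THEN conjunct1, rule_format] this[THEN conjunct2, THEN conjunct1, rule_format]
    this[THEN conjunct2, THEN conjunct2, THEN conjunct1, rule_format]
    this[THEN conjunct2, THEN conjunct2, THEN conjunct2, rule_format]
  \<comment> \<open>The growth bound \<open>2 * (norm (y 0) + norm (y' 0) / norm k)\<close> for the
    data \<open>1\<close>, \<open>eta\<close> and \<open>1 \<le> norm k\<close>.\<close>
  define K1 where "K1 = 2 * (1 + norm eta)"
  define R1 where "R1 = max 1 (2 * l * M)"
  have R1: "1 \<le> R1" "2 * l * M \<le> R1" by (auto simp: R1_def)
  have K1: "2 \<le> K1" by (simp add: K1_def)
  have Cg: "norm (C (k\<^sup>2) x) \<le> K1 * exp (\<bar>Re k\<bar> * x)" "norm (E (k\<^sup>2) x) \<le> K1 * exp (\<bar>Re k\<bar> * x)"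
    "norm (S (k\<^sup>2) x) \<le> 2 / norm k * exp (\<bar>Re k\<bar> * x)" "norm (Z (k\<^sup>2) x) \<le> 2 / norm k * exp (\<bar>Re k\<bar> * x)"
    if k: "R1 \<le> norm k" and x: "x \<in> {0..l}" for k x
  proof -
    have k1: "0 < norm k" "2 * l * M \<le> norm k" "1 \<le> norm k" using R1 k by linarith+
    have e: "2 * (1 + norm eta / norm k) * exp (\<bar>Re k\<bar> * x) \<le> K1 * exp (\<bar>Re k\<bar> * x)"
      using k1 by (intro mult_right_mono) (auto simp: K1_def field_simps mult_le_cancel_left1)
    show "norm (C (k\<^sup>2) x) \<le> K1 * exp (\<bar>Re k\<bar> * x)"
      by (rule order_trans[OF ode_sol_growth[OF C(1) M(1) l k1(1,2) x, unfolded C(2,3) norm_one] e])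
    show "norm (E (k\<^sup>2) x) \<le> K1 * exp (\<bar>Re k\<bar> * x)"
      by (rule order_trans[OF ode_sol_growth[OF E(1) M(2) l k1(1,2) x, unfolded E(2,3) norm_one] e])
    show "norm (S (k\<^sup>2) x) \<le> 2 / norm k * exp (\<bar>Re k\<bar> * x)"
      using ode_sol_growth[OF S(1) M(1) l k1(1,2) x] by (simp add: S)
    show "norm (Z (k\<^sup>2) x) \<le> 2 / norm k * exp (\<bar>Re k\<bar> * x)"
      using ode_sol_growth[OF Z(1) M(2) l k1(1,2) x] by (simp add: Z)
  qed
  have wr: "C lam x * S' lam x - S lam x * C' lam x = 1" "E lam x * Z' lam x - Z lam x * E' lam x = 1"
    if x: "x \<in> {0..l}" for lam x
  proof -
    have *: "y' x * v x - y x * v' x = y' 0 * v 0 - y 0 * v' 0"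
      if "ode_sol l p (\<lambda>_. 0) y y'" "ode_sol l p (\<lambda>_. 0) v v'" for p y y' v v'
    proof -
      have "norm ((y' x * v x - y x * v' x) - (y' 0 * v 0 - y 0 * v' 0)) \<le> 0 * (x - 0)"
      proof (rule vector_mvt_bound)
        fix t assume "t \<in> {0..x}"
        then show "((\<lambda>x. y' x * v x - y x * v' x) has_vector_derivative 0 * v t) (at t within {0..l})"
          using x by (intro ode_sol_wronskian[OF that]) auto
      qed (use x in auto)
      then show ?thesis by simp
    qed
    show "C lam x * S' lam x - S lam x * C' lam x = 1"
      using *[OF S(1) C(1), of lam] by (simp add: S C algebra_simps)
    show "E lam x * Z' lam x - Z lam x * E' lam x = 1"
      using *[OF Z(1) E(1), of lam] by (simp add: Z E algebra_simps)
  qed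
  define D where "D x k = C (k\<^sup>2) x * Z (k\<^sup>2) x - S (k\<^sup>2) x * E (k\<^sup>2) x" for x k
  \<comment> \<open>\<open>S\<close> and \<open>Z\<close> vanish at \<open>0\<close>; this yields
    the factor \<open>1 / norm k\<close>, hence the decay of \<open>D\<close> on the imaginary
    axis.\<close>
  have Db: "norm (D x k) \<le> 4 * K1 / norm k * exp (2 * l * \<bar>Re k\<bar>)"
    if k: "R1 \<le> norm k" and x: "x \<in> {0..l}" for k x
  proof -
    let ?e = "exp (\<bar>Re k\<bar> * x)"
    have "norm (D x k) \<le> norm (C (k\<^sup>2) x) * norm (Z (k\<^sup>2) x) + norm (S (k\<^sup>2) x) * norm (E (k\<^sup>2) x)"
      unfolding D_def norm_mult[symmetric] by (rule norm_triangle_ineq4)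
    also have "\<dots> \<le> (K1 * ?e) * (2 / norm k * ?e) + (2 / norm k * ?e) * (K1 * ?e)"
      using Cg[OF that] K1 by (intro add_mono mult_mono) auto
    also have "\<dots> = 4 * K1 / norm k * exp (2 * x * \<bar>Re k\<bar>)"
      by (simp add: algebra_simps flip: exp_add)
    also have "\<dots> \<le> 4 * K1 / norm k * exp (2 * l * \<bar>Re k\<bar>)"
      using x K1 by (intro mult_left_mono) (auto intro: mult_right_mono)
    finally show ?thesis .
  qed
  define R2 where "R2 = max R (max R1 (R1 / norm k0))"
  have k0n: "0 < norm k0" using k0 by auto
  define K2 where "K2 = 2 * (4 * B + 2 * l * G)"
  define K3 where "K3 = 2 * K1 * K2 + 4 * K1 ^ 3 * l * G"
  have B0: "0 \<le> B" using order_trans[OF norm_ge_zero conjunct1[OF bnd[of R 0]]] l by auto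
  have K2: "0 \<le> K2" using B0 l G0 by (simp add: K2_def)
  have K3: "0 \<le> K3" using K1 K2 l G0 by (simp add: K3_def)
  have ray: "norm (D x (of_real t * k0)) \<le> K3 * K * t ^ N"
    if t: "R2 \<le> t" and xx: "x \<in> {0..l / 2}" for t x
  proof -
    define k where "k = of_real t * k0"
    have tR: "R \<le> t" "1 \<le> t" using t R1 by (auto simp: R2_def)
    have "R1 / norm k0 \<le> t" using t by (simp add: R2_def)
    then have kR: "R1 \<le> norm k" using k0n tR by (simp add: k_def norm_mult pos_divide_le_eq)
    have rk: "Re k = t * Re k0" "0 < Re k" using tR k0 by (auto simp: k_def)
    have x: "x \<in> {0..l}" using xx l by auto
    let ?e = "exp (- (5 * Re k * l))"
    have src': "norm (f t y) \<le> G * ?e" "norm (g t y) \<le> G * ?e" if "y \<in> {0..l}" for y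
      using src[OF tR(1) that] rk by (simp_all add: mult_ac)
    have "?e \<le> exp (- (Re k * l))" using rk l by simp
    then have Ge: "G * ?e \<le> G * exp (- (Re k * l))" using G0 by (intro mult_left_mono)
    have src2: "norm (f t y) \<le> G * exp (- (Re k * l))" "norm (g t y) \<le> G * exp (- (Re k * l))"
      if "y \<in> {0..l}" for y
      using src'[OF that] Ge by linarith+
    note kk = kR R1
    have Vs: "ode_sol l (\<lambda>x. p x + k\<^sup>2) (f t) (V t) (V' t)" and Ws: "ode_sol l (\<lambda>x. q x + k\<^sup>2) (g t) (W t) (W' t)"
      using V[OF tR(1)] W[OF tR(1)] by (simp_all add: k_def)
    have Vd: "norm (V t x) \<le> K2 * exp (- (Re k * x))"
      unfolding K2_def
      by (rule ode_sol_decay[OF Vs M(1) src2(1) _ _ l rk(2) _ _ xx]) (use bnd[OF tR(1)] kk in auto)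
    have Wd: "norm (W t x) \<le> K2 * exp (- (Re k * x))"
      unfolding K2_def
      by (rule ode_sol_decay[OF Ws M(2) src2(2) _ _ l rk(2) _ _ xx]) (use bnd[OF tR(1)] kk in auto)
    define b where "b = V' t 0 - eta * V t 0"
    define a where "a = V t 0"
    \<comment> \<open>The drift of a Wronskian on \<open>{0..x}\<close>: length \<open>l\<close>,
      source \<open>G * exp (- (5 * Re k * l))\<close>, fundamental solution at most
      \<open>K1 * exp (Re k * l)\<close>.\<close>
    define ep where "ep = l * G * K1 * exp (- (4 * Re k * l))"
    have ep0: "0 \<le> ep" using l G0 K1 by (simp add: ep_def)
    have wb: "norm ((y' x * v x - y x * v' x) - (y' 0 * v 0 - y 0 * v' 0)) \<le> ep"
      if "ode_sol l p h y y'" "ode_sol l p (\<lambda>_. 0) v v'"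
        and h: "\<And>z. z \<in> {0..l} \<Longrightarrow> norm (h z) \<le> G * ?e"
        and v: "\<And>z. z \<in> {0..l} \<Longrightarrow> norm (v z) \<le> K1 * exp (Re k * z)" for p h y y' v v'
    proof -
      have "norm ((y' x * v x - y x * v' x) - (y' 0 * v 0 - y 0 * v' 0)) \<le> (G * K1 * exp (- (4 * Re k * l))) * (x - 0)"
      proof (rule vector_mvt_bound)
        fix z assume z: "z \<in> {0..x}"
        then have z': "z \<in> {0..l}" using x by auto
        show "((\<lambda>x. y' x * v x - y x * v' x) has_vector_derivative h z * v z) (at z within {0..l})"
          using z' by (intro ode_sol_wronskian[OF that(1,2)])
        have "norm (v z) \<le> K1 * exp (Re k * l)"
          using v[OF z'] z' rk K1 by (elim order_trans) (auto intro: mult_left_mono)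
        then have "norm (h z * v z) \<le> (G * ?e) * (K1 * exp (Re k * l))"
          using h[OF z'] G0 unfolding norm_mult by (intro mult_mono) auto
        then show "norm (h z * v z) \<le> G * K1 * exp (- (4 * Re k * l))"
          by (simp add: algebra_simps flip: exp_add)
      qed (use x in auto)
      also have "\<dots> \<le> (G * K1 * exp (- (4 * Re k * l))) * l"
        using x G0 K1 by (intro mult_left_mono) auto
      finally show ?thesis by (simp add: ep_def mult_ac)
    qed
    have aRe: "\<bar>Re k\<bar> = Re k" using rk by simp
    have cg: "norm (C (k\<^sup>2) z) \<le> K1 * exp (Re k * z)" "norm (E (k\<^sup>2) z) \<le> K1 * exp (Re k * z)"
      "norm (S (k\<^sup>2) z) \<le> K1 * exp (Re k * z)" "norm (Z (k\<^sup>2) z) \<le> K1 * exp (Re k * z)" if "z \<in> {0..l}" for z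
    proof -
      have "2 / norm k \<le> 2 / 1"
        using kR R1(1) by (intro divide_left_mono) auto
      then have "2 / norm k \<le> K1"
        using K1 by simp
      then have "2 / norm k * exp (Re k * z) \<le> K1 * exp (Re k * z)" by (intro mult_right_mono) auto
      then show "norm (C (k\<^sup>2) z) \<le> K1 * exp (Re k * z)" "norm (E (k\<^sup>2) z) \<le> K1 * exp (Re k * z)"
        "norm (S (k\<^sup>2) z) \<le> K1 * exp (Re k * z)" "norm (Z (k\<^sup>2) z) \<le> K1 * exp (Re k * z)"
        using Cg[OF kR that] unfolding aRe by linarith+
    qed
    define c s e z where "c = C (k\<^sup>2) x" and "s = S (k\<^sup>2) x" and "e = E (k\<^sup>2) x" and "z = Z (k\<^sup>2) x"
    define c' s' e' z' where "c' = C' (k\<^sup>2) x" and "s' = S' (k\<^sup>2) x" and "e' = E' (k\<^sup>2) x" and "z' = Z' (k\<^sup>2) x"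
    \<comment> \<open>Up to sign, the coefficients of \<open>V\<close> and \<open>W\<close> in the
      fundamental systems. At \<open>0\<close> they equal \<open>b\<close>, \<open>- a\<close>,
      \<open>b\<close>, \<open>- a\<close>, so at \<open>x\<close> they differ from these by at most
      \<open>ep\<close>.\<close>
    define v1 v2 w1 w2 where "v1 = V' t x * c - V t x * c'" and "v2 = V' t x * s - V t x * s'"
      and "w1 = W' t x * e - W t x * e'" and "w2 = W' t x * z - W t x * z'"
    have er: "norm (v1 - b) \<le> ep" "norm (v2 + a) \<le> ep" "norm (w1 - b) \<le> ep" "norm (w2 + a) \<le> ep"
      using wb[OF Vs C(1) src'(1) cg(1)] wb[OF Vs S(1) src'(1) cg(3)]
        wb[OF Ws E(1) src'(2) cg(2)] wb[OF Ws Z(1) src'(2) cg(4)] init[OF tR(1)]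
      unfolding v1_def v2_def w1_def w2_def a_def b_def c_def s_def e_def z_def c'_def s'_def e'_def z'_def
      by (simp_all add: C(2,3) S(2,3) E(2,3) Z(2,3) mult.commute)
    have ws: "c * s' - s * c' = 1" "e * z' - z * e' = 1"
      using wr[OF x] by (simp_all add: c_def s_def e_def z_def c'_def s'_def e'_def z'_def)
    have "s * v1 - c * v2 = V t x * (c * s' - s * c')" "z * w1 - e * w2 = W t x * (e * z' - z * e')"
      by (simp_all add: v1_def v2_def w1_def w2_def algebra_simps)
    then have Veq: "V t x = s * v1 - c * v2" "W t x = z * w1 - e * w2"
      using ws by simp_all
    \<comment> \<open>To leading order \<open>V = a * c + b * s\<close> and
      \<open>W = a * e + b * z\<close>, so \<open>a\<close> cancels in \<open>c * W - V * e\<close>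
      and \<open>b * D\<close> remains. There the growth of \<open>c\<close>, \<open>e\<close> is
      compensated by the decay of \<open>W\<close>, \<open>V\<close>; the second line collects the
      drift errors.\<close>
    have key: "b * D x k = (c * W t x - V t x * e) -
        (c * z * (w1 - b) - e * s * (v1 - b) - c * e * ((w2 + a) - (v2 + a)))"
      unfolding Veq D_def c_def[symmetric] s_def[symmetric] e_def[symmetric] z_def[symmetric]
      by (simp add: algebra_simps)
    let ?X = "exp (Re k * x)"
    have n: "norm c \<le> K1 * ?X" "norm e \<le> K1 * ?X" "norm s \<le> K1 * ?X" "norm z \<le> K1 * ?X"
      using cg[OF x] by (simp_all add: c_def s_def e_def z_def)
    have prod: "norm (u * v) \<le> K1 * K2" if "norm u \<le> K1 * ?X" "norm v \<le> K2 * exp (- (Re k * x))" for u v :: complex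
    proof -
      have "norm (u * v) \<le> (K1 * ?X) * (K2 * exp (- (Re k * x)))"
        unfolding norm_mult using that K1 by (intro mult_mono) auto
      also have "\<dots> = K1 * K2" by (simp add: exp_minus)
      finally show ?thesis .
    qed
    define mu where "mu = K1 ^ 3 * l * G"
    have prod3: "norm (u * v * h) \<le> mu" if "norm u \<le> K1 * ?X" "norm v \<le> K1 * ?X" "norm h \<le> ep" for u v h :: complex
    proof -
      have "norm (u * v * h) \<le> (K1 * ?X) * (K1 * ?X) * ep"
        unfolding norm_mult using that K1 by (intro mult_mono mult_nonneg_nonneg) auto
      also have "\<dots> = mu * exp (2 * Re k * (x - 2 * l))"
        by (simp add: ep_def mu_def power3_eq_cube algebra_simps flip: exp_add)
      also have "\<dots> \<le> mu * 1"
        using x l rk K1 G0 by (intro mult_left_mono) (auto simp: mu_def mult_nonneg_nonpos)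
      finally show ?thesis by simp
    qed
    have "norm (b * D x k) \<le> K1 * K2 + K1 * K2 + (mu + mu + (mu + mu))"
    proof -
      have "c * e * ((w2 + a) - (v2 + a)) = c * e * (w2 + a) - c * e * (v2 + a)" by (simp add: algebra_simps)
      moreover have "norm (c * W t x) \<le> K1 * K2" "norm (e * V t x) \<le> K1 * K2"
        by (rule prod; use n Vd Wd in simp)+
      moreover have "norm (c * z * (w1 - b)) \<le> mu" "norm (e * s * (v1 - b)) \<le> mu"
        "norm (c * e * (w2 + a)) \<le> mu" "norm (c * e * (v2 + a)) \<le> mu"
        by (rule prod3; use n er in simp)+
      ultimately show ?thesis
        unfolding key mult.commute[of "V t x" e]
        by (smt (verit) norm_triangle_ineq4)
    qed
    also have "\<dots> = K3" by (simp add: K3_def mu_def)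
    finally have bD: "norm b * norm (D x k) \<le> K3" by (simp add: norm_mult)
    have lw: "1 \<le> norm b * (K * t ^ N)" using low[OF tR(1)] by (simp add: b_def)
    then have "0 < norm b * (K * t ^ N)" by linarith
    \<comment> \<open>The sign of \<open>K\<close> is not given, but \<open>lw\<close> forces it
      here.\<close>
    then have Kt: "0 \<le> K * t ^ N" using mult_nonneg_nonpos[of "norm b" "K * t ^ N"] by (force simp: not_le)
    have "norm (D x k) * 1 \<le> norm (D x k) * (norm b * (K * t ^ N))"
      using lw by (intro mult_left_mono) auto
    also have "\<dots> = (norm b * norm (D x k)) * (K * t ^ N)" by simp
    also have "\<dots> \<le> K3 * (K * t ^ N)" using bD Kt by (intro mult_right_mono)
    finally show ?thesis by (simp add: k_def)
  qed
  have D0: "D x k = 0" if xx: "x \<in> {0..l / 2}" for x k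
  proof (rule entire_even_eq_0[where D = "D x", OF _ _ _ _ k0])
    have x: "x \<in> {0..l}" using xx l by auto
    have *: "(\<lambda>k. Y (k\<^sup>2)) holomorphic_on UNIV" if "Y holomorphic_on UNIV" for Y :: "complex \<Rightarrow> complex"
    proof -
      have "(\<lambda>k::complex. k\<^sup>2) holomorphic_on UNIV" by (intro holomorphic_intros)
      from holomorphic_on_compose_gen[OF this that] show ?thesis by (simp add: o_def)
    qed
    show "D x holomorphic_on UNIV"
      unfolding D_def[abs_def]
      by (intro holomorphic_intros *[OF C(4)[OF x]] *[OF S(4)[OF x]] *[OF E(4)[OF x]] *[OF Z(4)[OF x]])
    show "D x (- k) = D x k" for k by (simp add: D_def)
    show "norm (D x k) \<le> 4 * K1 * exp (2 * l * \<bar>Re k\<bar>)" if "R2 \<le> norm k" for k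
    proof -
      have k: "R1 \<le> norm k" using that by (simp add: R2_def)
      have "4 * K1 / norm k \<le> 4 * K1 / 1"
        using k R1(1) K1 by (intro divide_left_mono) auto
      then have "4 * K1 / norm k \<le> 4 * K1" by simp
      then have "4 * K1 / norm k * exp (2 * l * \<bar>Re k\<bar>) \<le> 4 * K1 * exp (2 * l * \<bar>Re k\<bar>)"
        by (intro mult_right_mono) auto
      then show ?thesis using Db[OF k x] by linarith
    qed
    show "0 \<le> 2 * l" using l by simp
    show "norm (D x (of_real t * k0)) \<le> K3 * K * t ^ N" if "R2 \<le> t" for t
      using ray[OF that xx] .
    show "((\<lambda>t. D x (\<i> * of_real t)) \<longlongrightarrow> 0) at_top"
    proof (rule Lim_null_comparison)
      show "\<forall>\<^sub>F t in at_top. norm (D x (\<i> * of_real t)) \<le> 4 * K1 / t"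
        using eventually_ge_at_top[of R1]
      proof eventually_elim
        case (elim t)
        then show ?case using Db[of "\<i> * of_real t" x] x R1 by (simp add: norm_mult)
      qed
      show "((\<lambda>t. 4 * K1 / t) \<longlongrightarrow> 0) at_top"
        by (intro tendsto_divide_0[OF tendsto_const] filterlim_at_top_imp_at_infinity filterlim_ident)
    qed
  qed
  \<comment> \<open>A single large real \<open>k\<close> suffices from here on: both
    \<open>C\<close> and \<open>E\<close> then have positive real part.\<close>
  define k where "k = max R1 (2 * norm eta + 4 * l * M * (1 + norm eta) + 1)"
  have k: "1 \<le> k" "2 * l * M \<le> k" "2 * norm eta + 4 * l * M * (1 + norm eta) < k"
    using R1 by (auto simp: k_def)
  define lam where "lam = (complex_of_real k)\<^sup>2"
  have pos: "0 < Re (C lam x)" "0 < Re (E lam x)" if "x \<in> {0..l}" for x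
    unfolding lam_def
    using ode_sol_cosh_like_pos[OF C(1) C(2) M(1) l k(1,2) _ that]
      ode_sol_cosh_like_pos[OF E(1) E(2) M(2) l k(1,2) _ that] k(3) by (auto simp: C E)
  have CE: "C lam x = E lam x" if xx: "x \<in> {0..l / 2}" for x
  proof -
    have x: "x \<in> {0..l}" using xx l by auto
    define c s e z where "c = C lam x" and "s = S lam x" and "e = E lam x" and "z = Z lam x"
    define c' s' e' z' where "c' = C' lam x" and "s' = S' lam x" and "e' = E' lam x" and "z' = Z' lam x"
    have z0: "c * z = s * e"
      using D0[OF xx, of "of_real k"] by (simp add: D_def c_def s_def e_def z_def lam_def)
    have "((\<lambda>x. C lam x * Z lam x - S lam x * E lam x) has_vector_derivative
        (c * z' + c' * z) - (s * e' + s' * e)) (at x within {0..l})"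
      using C(1)[of lam] S(1)[of lam] E(1)[of lam] Z(1)[of lam] x
      unfolding c_def s_def e_def z_def c'_def s'_def e'_def z'_def ode_sol_def
      by (intro has_vector_derivative_diff has_vector_derivative_mult) auto
    then have "((\<lambda>x. C lam x * Z lam x - S lam x * E lam x) has_vector_derivative
        (c * z' + c' * z) - (s * e' + s' * e)) (at x within {0..l / 2})"
      using l by (auto intro: has_vector_derivative_within_subset)
    then have d: "((\<lambda>x. 0) has_vector_derivative (c * z' + c' * z) - (s * e' + s' * e)) (at x within {0..l / 2})"
      by (rule has_vector_derivative_transform[rotated 2])
         (use D0[of _ "of_real k"] xx in \<open>auto simp: D_def lam_def\<close>)
    have d0: "(c * z' + c' * z) - (s * e' + s' * e) = 0"
      using vector_derivative_unique_within_closed_interval[of 0 "l / 2" x "\<lambda>_. 0"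
        "(c * z' + c' * z) - (s * e' + s' * e)" 0] d l xx by simp
    have w: "c * s' = 1 + s * c'" "e * z' = 1 + z * e'"
      using wr[OF x, of lam] by (simp_all add: c_def s_def e_def z_def c'_def s'_def e'_def z'_def algebra_simps)
    \<comment> \<open>By the Wronskian identities \<open>S / C\<close> has derivative
      \<open>1 / C\<^sup>2\<close> and \<open>Z / E\<close> has derivative
      \<open>1 / E\<^sup>2\<close>, and \<open>D = 0\<close> says that the quotients agree. The
      computation is this comparison with denominators cleared.\<close>
    have "c * e * ((c * z' + c' * z) - (s * e' + s' * e)) =
        c\<^sup>2 * (e * z') - e\<^sup>2 * (c * s') + c' * e * (c * z) - c * e' * (s * e)"
      by (simp add: algebra_simps power2_eq_square)
    also have "\<dots> = c\<^sup>2 - e\<^sup>2 + (c * e' + c' * e) * (c * z - s * e)"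
      unfolding w by (simp add: algebra_simps power2_eq_square)
    finally have "c\<^sup>2 = e\<^sup>2" using d0 z0 by simp
    then have "c = e \<or> c = - e" by (simp add: power2_eq_iff)
    then show ?thesis using pos[OF x] by (auto simp: c_def e_def)
  qed
  have "p x + lam = q x + lam"
    using ode_sol_determines_potential[OF C(1) E(1), of "l / 2" lam lam x] CE l x pos(1)
    by fastforce
  then show ?thesis by simp
qed

section \<open>Regularity in time\<close>

lemma C1_interval_iff:
  assumes "0 < l"
  shows "C1_interval l f \<longleftrightarrow>
    (\<exists>f'. (\<forall>x\<in>{0..l}. (f has_vector_derivative f' x) (at x within {0..l})) \<and> continuous_on {0..l} f')"
proof
  assume "C1_interval l f"
  then show "\<exists>f'. (\<forall>x\<in>{0..l}. (f has_vector_derivative f' x) (at x within {0..l})) \<and> continuous_on {0..l} f'"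
    unfolding C1_interval_def vector_derivative_works
    by (intro exI[of _ "\<lambda>x. vector_derivative f (at x within {0..l})"])
next
  assume "\<exists>f'. (\<forall>x\<in>{0..l}. (f has_vector_derivative f' x) (at x within {0..l})) \<and> continuous_on {0..l} f'"
  then obtain f' where f': "\<And>x. x \<in> {0..l} \<Longrightarrow> (f has_vector_derivative f' x) (at x within {0..l})"
    "continuous_on {0..l} f'" by blast
  have eq: "vector_derivative f (at x within {0..l}) = f' x" if "x \<in> {0..l}" for x
    using vector_derivative_within_cbox[OF assms _ f'(1)[OF that, folded cbox_interval]] that by (simp add: cbox_interval)
  have "continuous_on {0..l} (\<lambda>x. vector_derivative f (at x within {0..l}))"
    by (rule continuous_on_eq[OF f'(2)]) (simp add: eq)
  then show "C1_interval l f"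
    unfolding C1_interval_def using differentiableI_vector[OF f'(1)] by blast
qed

lemma C1_interval_D:
  assumes "C1_interval l f"
  shows "x \<in> {0..l} \<Longrightarrow> (f has_vector_derivative vector_derivative f (at x within {0..l})) (at x within {0..l})"
    and "continuous_on {0..l} f" and "continuous_on {0..l} (\<lambda>x. vector_derivative f (at x within {0..l}))"
proof -
  show d: "(f has_vector_derivative vector_derivative f (at x within {0..l})) (at x within {0..l})" if "x \<in> {0..l}" for x
    using assms that by (simp add: C1_interval_def vector_derivative_works)
  show "continuous_on {0..l} f"
    by (rule continuous_on_vector_derivative) (rule d)
  show "continuous_on {0..l} (\<lambda>x. vector_derivative f (at x within {0..l}))"
    using assms by (simp add: C1_interval_def)
qed

lemma C1_interval_linear:
  assumes l: "0 < l" and f: "C1_interval l f" and g: "C1_interval l g"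
  shows "C1_interval l (\<lambda>x. c * f x + d * g x)"
proof -
  let ?D = "\<lambda>f x. vector_derivative f (at x within {0..l})"
  have "\<forall>x\<in>{0..l}. ((\<lambda>x. c * f x + d * g x) has_vector_derivative c * ?D f x + d * ?D g x) (at x within {0..l})"
    by (intro ballI has_vector_derivative_add has_vector_derivative_mult_right C1_interval_D(1) f g)
  moreover have "continuous_on {0..l} (\<lambda>x. c * ?D f x + d * ?D g x)"
    by (intro continuous_intros C1_interval_D(3) f g)
  ultimately show ?thesis
    unfolding C1_interval_iff[OF l] by (intro exI[of _ "\<lambda>x. c * ?D f x + d * ?D g x"] conjI)
qed

lemma C1_interval_cong:
  assumes l: "0 < l" and f: "C1_interval l f" and eq: "\<And>x. x \<in> {0..l} \<Longrightarrow> g x = f x"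
  shows "C1_interval l g"
proof -
  have "(g has_vector_derivative vector_derivative f (at x within {0..l})) (at x within {0..l})" if "x \<in> {0..l}" for x
    by (rule has_vector_derivative_transform[OF that eq C1_interval_D(1)[OF f that]])
  then show ?thesis
    unfolding C1_interval_iff[OF l] using C1_interval_D(3)[OF f]
    by (intro exI[of _ "\<lambda>x. vector_derivative f (at x within {0..l})"] conjI ballI)
qed

lemma C1_interval_zero: "0 < l \<Longrightarrow> C1_interval l (\<lambda>x. 0)"
  unfolding C1_interval_iff by (intro exI[of _ "\<lambda>_. 0"] conjI ballI has_vector_derivative_const continuous_on_const)

lemma C1_interval_sum:
  assumes l: "0 < l" and "\<And>i. i \<in> I \<Longrightarrow> C1_interval l (f i)"
  shows "C1_interval l (\<lambda>x. \<Sum>i\<in>I. c i * f i x)"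
  using assms(2)
proof (induction I rule: infinite_finite_induct)
  case (insert i I)
  then show ?case using C1_interval_linear[OF l, of "f i" "\<lambda>x. \<Sum>i\<in>I. c i * f i x" "c i" 1] by simp
next
  case (infinite I)
  then show ?case using C1_interval_zero[OF l] by simp
next
  case empty
  then show ?case using C1_interval_zero[OF l] by simp
qed

text \<open>Combining the values at \<open>t\<close> and \<open>t / 2\<close> eliminates the leading coefficient, so that the
  coefficients can be recovered one at a time, without Lagrange interpolation.\<close>

lemma C1_interval_coefficients:
  assumes l: "0 < l" and T: "0 < T"
    and F: "\<And>t. 0 < t \<Longrightarrow> t \<le> T \<Longrightarrow> C1_interval l (\<lambda>x. \<Sum>i<m. of_real t ^ i * a i x)"
  shows "i < m \<Longrightarrow> C1_interval l (a i)"
  using F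
proof (induction m arbitrary: a i)
  case (Suc m)
  have lower: "C1_interval l (a i)" if "i < m" for i
  proof -
    have "C1_interval l (\<lambda>x. (1 - 2 ^ m / 2 ^ i) * a i x)"
    proof (rule Suc.IH[OF that])
      fix t :: real assume t: "0 < t" "t \<le> T"
      have "C1_interval l (\<lambda>x. 1 * (\<Sum>i<Suc m. of_real t ^ i * a i x) +
          (- (2 ^ m)) * (\<Sum>i<Suc m. of_real (t / 2) ^ i * a i x))"
        using t Suc.prems(2)[of t] Suc.prems(2)[of "t / 2"] by (intro C1_interval_linear l) auto
      then show "C1_interval l (\<lambda>x. \<Sum>i<m. of_real t ^ i * ((1 - 2 ^ m / 2 ^ i) * a i x))"
      proof (rule C1_interval_cong[OF l])
        fix x
        have "1 * (\<Sum>i<Suc m. of_real t ^ i * a i x) + (- (2 ^ m)) * (\<Sum>i<Suc m. of_real (t / 2) ^ i * a i x) =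
            (\<Sum>i<Suc m. of_real t ^ i * ((1 - 2 ^ m / 2 ^ i) * a i x))"
          unfolding sum_distrib_left sum.distrib[symmetric]
          by (intro sum.cong) (auto simp: power_divide algebra_simps)
        then show "(\<Sum>i<m. of_real t ^ i * ((1 - 2 ^ m / 2 ^ i) * a i x)) =
            1 * (\<Sum>i<Suc m. of_real t ^ i * a i x) + (- (2 ^ m)) * (\<Sum>i<Suc m. of_real (t / 2) ^ i * a i x)"
          by simp
      qed
    qed
    moreover have "(2::complex) ^ m \<noteq> 2 ^ i"
    proof
      assume "(2::complex) ^ m = 2 ^ i"
      then have "norm ((2::complex) ^ m) = norm ((2::complex) ^ i)" by simp
      then have "(2::real) ^ m = 2 ^ i" by (simp add: norm_power)
      then show False using that by simp
    qed
    then have "1 - 2 ^ m / 2 ^ i \<noteq> (0::complex)" by (simp add: field_simps)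
    ultimately show ?thesis
      using C1_interval_linear[OF l, of "\<lambda>x. (1 - 2 ^ m / 2 ^ i) * a i x" "\<lambda>x. (1 - 2 ^ m / 2 ^ i) * a i x"
          "1 / (1 - 2 ^ m / 2 ^ i)" 0] by simp
  qed
  show ?case
  proof (cases "i = m")
    case True
    have "C1_interval l (\<lambda>x. (1 / of_real T ^ m) * (\<Sum>i<Suc m. of_real T ^ i * a i x) +
        (- 1 / of_real T ^ m) * (\<Sum>i<m. of_real T ^ i * a i x))"
      by (rule C1_interval_linear[OF l Suc.prems(2)[OF T order_refl] C1_interval_sum[OF l]]) (simp add: lower)
    then show ?thesis
    proof (rule C1_interval_cong[OF l])
      fix x
      have "of_real T ^ m \<noteq> (0::complex)" using T by simp
      then show "a i x = (1 / of_real T ^ m) * (\<Sum>i<Suc m. of_real T ^ i * a i x) +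
          (- 1 / of_real T ^ m) * (\<Sum>i<m. of_real T ^ i * a i x)"
        unfolding True sum.lessThan_Suc distrib_left by simp
    qed
  next
    case False
    then show ?thesis using Suc.prems(1) lower[of i] by simp
  qed
qed simp

section \<open>Functions on the rectangle that are continuously differentiable in space\<close>

definition C1_space :: "real \<Rightarrow> real \<Rightarrow> (real \<Rightarrow> real \<Rightarrow> complex) \<Rightarrow> bool" where
  "C1_space T l f \<longleftrightarrow> C0_rect T l f \<and> has_dx T l f \<and> C0_rect T l (dx l f)"

lemma C1_space_D:
  assumes "C1_space T l f" "t \<in> {0..T}" "x \<in> {0..l}"
  shows "(f t has_vector_derivative dx l f t x) (at x within {0..l})"
  using assms by (simp add: C1_space_def has_dx_def dx_def vector_derivative_works)

lemma C0_rect_x: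
  assumes "C0_rect T l f" "t \<in> {0..T}"
  shows "continuous_on {0..l} (f t)"
proof -
  have "continuous_on {0..l} (\<lambda>x. (t, x))" by (intro continuous_intros)
  from continuous_on_compose2[OF assms(1)[unfolded C0_rect_def] this] show ?thesis
    using assms(2) by (simp add: image_subset_iff)
qed

lemma C0_rect_t:
  assumes "C0_rect T l f" "x \<in> {0..l}"
  shows "continuous_on {0..T} (\<lambda>t. f t x)"
proof -
  have "continuous_on {0..T} (\<lambda>t. (t, x))" by (intro continuous_intros)
  from continuous_on_compose2[OF assms(1)[unfolded C0_rect_def] this] show ?thesis
    using assms(2) by (simp add: image_subset_iff)
qed

lemma C1_spaceI:
  assumes l: "0 < l"
    and d: "\<And>t x. t \<in> {0..T} \<Longrightarrow> x \<in> {0..l} \<Longrightarrow> (f t has_vector_derivative f' t x) (at x within {0..l})"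
    and c: "C0_rect T l f" "C0_rect T l f'"
  shows "C1_space T l f" and "\<And>t x. t \<in> {0..T} \<Longrightarrow> x \<in> {0..l} \<Longrightarrow> dx l f t x = f' t x"
proof -
  show eq: "dx l f t x = f' t x" if "t \<in> {0..T}" "x \<in> {0..l}" for t x
    using vector_derivative_within_cbox[OF l _ d[OF that, folded cbox_interval]] that by (simp add: dx_def cbox_interval)
  have "continuous_on ({0..T} \<times> {0..l}) (\<lambda>(t, x). dx l f t x)"
    by (rule continuous_on_eq[OF c(2)[unfolded C0_rect_def]]) (auto simp: eq)
  then show "C1_space T l f"
    using c(1) differentiableI_vector[OF d] unfolding C1_space_def has_dx_def C0_rect_def by auto
qed

lemma C1_space_C1_interval:
  assumes "0 < l" "C1_space T l f" "t \<in> {0..T}"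
  shows "C1_interval l (f t)"
  unfolding C1_interval_iff[OF \<open>0 < l\<close>]
  using assms(2)[unfolded C1_space_def]
  by (intro exI[of _ "dx l f t"] conjI ballI C1_space_D[OF assms(2,3)] C0_rect_x[OF _ assms(3)]) blast+

text \<open>Substituting \<open>s = t * r\<close> moves the variable endpoint into the integrand,
  and an integral over the fixed interval \<open>{0..1}\<close> is continuous in its
  parameters.\<close>

lemma C0_rect_time_integral:
  assumes g: "C0_rect T l g"
  shows "C0_rect T l (\<lambda>t x. integral {0..t} (\<lambda>s. g s x))"
proof -
  have eq: "integral {0..t} (\<lambda>s. g s x) = integral {0..1} (\<lambda>r. of_real t * g (t * r) x)"
    if t: "t \<in> {0..T}" and x: "x \<in> {0..l}" for t x
  proof -
    have c: "continuous_on {0..t} (\<lambda>s. g s x)"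
      using C0_rect_t[OF g x] t by (auto intro: continuous_on_subset)
    have "((\<lambda>r. of_real t * g (t * r) x) has_integral
        (integral {0..t * 1} (\<lambda>s. g s x) - integral {0..t * 0} (\<lambda>s. g s x))) {0..1}"
    proof (rule fundamental_theorem_of_calculus)
      fix r :: real assume r: "r \<in> {0..1}"
      have "t * r \<in> {0..t}" using r t by (auto simp: mult_left_le)
      then have 1: "((\<lambda>y. integral {0..y} (\<lambda>s. g s x)) has_vector_derivative g (t * r) x) (at (t * r) within {0..t})"
        by (rule integral_has_vector_derivative[OF c])
      have 2: "((\<lambda>r. t * r) has_vector_derivative t) (at r within {0..1})"
        by (auto intro!: derivative_eq_intros simp: has_vector_derivative_def fun_eq_iff mult.commute)
      have "((\<lambda>y. integral {0..y} (\<lambda>s. g s x)) has_vector_derivative g (t * r) x) (at (t * r) within (\<lambda>r. t * r) ` {0..1})"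
        by (rule has_vector_derivative_within_subset[OF 1]) (use t in \<open>auto simp: mult_left_le\<close>)
      from vector_diff_chain_within[OF 2 this]
      show "((\<lambda>r. integral {0..t * r} (\<lambda>s. g s x)) has_vector_derivative of_real t * g (t * r) x) (at r within {0..1})"
        by (simp add: o_def scaleR_conv_of_real)
    qed simp
    then have "integral {0..1} (\<lambda>r. of_real t * g (t * r) x) =
        integral {0..t * 1} (\<lambda>s. g s x) - integral {0..t * 0} (\<lambda>s. g s x)"
      by (rule integral_unique)
    then show ?thesis by simp
  qed
  have "continuous_on (({0..T} \<times> {0..l}) \<times> cbox 0 1) (\<lambda>(p, r). of_real (fst p) * g (fst p * r) (snd p))"
  proof -
    have "continuous_on (({0..T} \<times> {0..l}) \<times> cbox 0 (1::real)) (\<lambda>z. (\<lambda>(t, x). g t x) (fst (fst z) * snd z, snd (fst z)))"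
    proof (rule continuous_on_compose2[OF g[unfolded C0_rect_def]])
      have "t * r \<le> T" if "0 \<le> t" "t \<le> T" "r \<le> 1" for t r
        using mult_left_le[of r t] that by linarith
      then show "(\<lambda>z. (fst (fst z) * snd z, snd (fst z))) ` (({0..T} \<times> {0..l}) \<times> cbox 0 1) \<subseteq> {0..T} \<times> {0..l}"
        by auto
    qed (intro continuous_intros)
    then have "continuous_on (({0..T} \<times> {0..l}) \<times> cbox 0 (1::real)) (\<lambda>z. of_real (fst (fst z)) * g (fst (fst z) * snd z) (snd (fst z)))"
      by (auto intro!: continuous_intros)
    then show ?thesis by (simp add: case_prod_beta)
  qed
  from integral_continuous_on_param[OF this]
  have "continuous_on ({0..T} \<times> {0..l}) (\<lambda>p. integral {0..1} (\<lambda>r. of_real (fst p) * g (fst p * r) (snd p)))"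
    by simp
  then show ?thesis
    unfolding C0_rect_def by (rule continuous_on_eq) (auto simp: eq)
qed

lemma C0_rect_add: "C0_rect T l f \<Longrightarrow> C0_rect T l g \<Longrightarrow> C0_rect T l (\<lambda>t x. f t x + g t x)"
  and C0_rect_mult: "C0_rect T l f \<Longrightarrow> C0_rect T l g \<Longrightarrow> C0_rect T l (\<lambda>t x. f t x * g t x)"
  unfolding C0_rect_def case_prod_beta by (intro continuous_intros; assumption)+

lemma C0_rect_of_x:
  assumes "continuous_on {0..l} f"
  shows "C0_rect T l (\<lambda>t x. f x)"
  unfolding C0_rect_def case_prod_beta
  by (rule continuous_on_compose2[OF assms]) (auto intro!: continuous_intros)

lemma C0_rect_of_t:
  assumes "continuous_on {0..T} f"
  shows "C0_rect T l (\<lambda>t x. f t)"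
  unfolding C0_rect_def case_prod_beta
  by (rule continuous_on_compose2[OF assms]) (auto intro!: continuous_intros)

text \<open>The weight \<open>w\<close> is \<open>1\<close> for primitives in time and an
  exponential for the Laplace transform.\<close>

lemma C1_space_integral_deriv:
  assumes g: "C1_space T l g" and w: "continuous_on {0..T} w" and t: "t \<in> {0..T}" and x: "x \<in> {0..l}"
  shows "((\<lambda>x. integral {0..t} (\<lambda>s. w s * g s x)) has_vector_derivative integral {0..t} (\<lambda>s. w s * dx l g s x))
    (at x within {0..l})"
proof -
  have sub: "s \<in> {0..T}" if "s \<in> {0..t}" for s using that t by auto
  have wc: "continuous_on {0..t} w" using w t by (auto intro: continuous_on_subset)
  have "((\<lambda>x. integral (cbox 0 t) (\<lambda>s. w s * g s x)) has_vector_derivative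
      integral (cbox 0 t) (\<lambda>s. w s * dx l g s x)) (at x within {0..l})"
  proof (rule leibniz_rule_vector_derivative[where f = "\<lambda>x s. w s * g s x" and fx = "\<lambda>x s. w s * dx l g s x"])
    fix y s assume ys: "y \<in> {0..l}" "s \<in> cbox 0 t"
    show "((\<lambda>x. w s * g s x) has_vector_derivative w s * dx l g s y) (at y within {0..l})"
      using C1_space_D[OF g sub ys(1)] ys(2) by (intro has_vector_derivative_mult_right) auto
  next
    have "C0_rect T l (\<lambda>s x. w s * dx l g s x)"
      using g w by (intro C0_rect_mult C0_rect_of_t) (auto simp: C1_space_def)
    then show "continuous_on ({0..l} \<times> cbox 0 t) (\<lambda>(x, s). w s * dx l g s x)"
      unfolding C0_rect_def case_prod_beta
      by (rule continuous_on_compose2[where f = "\<lambda>z. (snd z, fst z)" and g = "\<lambda>p. w (fst p) * dx l g (fst p) (snd p)", simplified])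
         (use t in \<open>auto intro!: continuous_intros\<close>)
  next
    fix y assume y: "y \<in> {0..l}"
    show "(\<lambda>s. w s * g s y) integrable_on cbox 0 t"
      using y g t unfolding C1_space_def interval_cbox[symmetric]
      by (intro integrable_continuous_interval continuous_on_mult wc continuous_on_subset[OF C0_rect_t[of T l g]]) auto
  qed (use x in auto)
  then show ?thesis by simp
qed

text \<open>Differentiation under the integral presents \<open>dx l f\<close> as a primitive in time
  of \<open>dx l g\<close>; this is the interchange of the two derivatives.\<close>

lemma C1_space_time_integral:
  assumes l: "0 < l" and T: "0 < T" and g: "C1_space T l g" and a: "C1_interval l a"
    and f: "\<And>t x. t \<in> {0..T} \<Longrightarrow> x \<in> {0..l} \<Longrightarrow> f t x = a x + integral {0..t} (\<lambda>s. g s x)"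
  shows "C1_space T l f"
    and "\<And>t x. t \<in> {0..T} \<Longrightarrow> x \<in> {0..l} \<Longrightarrow>
      ((\<lambda>s. dx l f s x) has_vector_derivative dx l g t x) (at t within {0..T})"
proof -
  let ?a' = "\<lambda>x. vector_derivative a (at x within {0..l})"
  let ?f' = "\<lambda>t x. ?a' x + integral {0..t} (\<lambda>s. dx l g s x)"
  have g': "C0_rect T l g" "C0_rect T l (dx l g)" using g by (auto simp: C1_space_def)
  have d: "(f t has_vector_derivative ?f' t x) (at x within {0..l})"
    if t: "t \<in> {0..T}" and x: "x \<in> {0..l}" for t x
  proof (rule has_vector_derivative_transform[OF x f[OF t]])
    have "((\<lambda>x. integral {0..t} (\<lambda>s. 1 * g s x)) has_vector_derivative integral {0..t} (\<lambda>s. 1 * dx l g s x))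
        (at x within {0..l})"
      by (rule C1_space_integral_deriv[OF g _ t x]) (rule continuous_on_const)
    then show "((\<lambda>x. a x + integral {0..t} (\<lambda>s. g s x)) has_vector_derivative ?f' t x) (at x within {0..l})"
      by (intro has_vector_derivative_add C1_interval_D(1)[OF a x]) simp
  qed
  have "C0_rect T l (\<lambda>t x. a x + integral {0..t} (\<lambda>s. g s x))"
    by (intro C0_rect_add C0_rect_time_integral C0_rect_of_x C1_interval_D(2) a g')
  then have c: "C0_rect T l f"
    unfolding C0_rect_def by (rule continuous_on_eq) (auto simp: f)
  have c': "C0_rect T l ?f'"
    by (intro C0_rect_add C0_rect_time_integral C0_rect_of_x C1_interval_D(3) a g')
  show "C1_space T l f"
    by (rule C1_spaceI(1)[OF l d c c'])
  fix t x assume t: "t \<in> {0..T}" and x: "x \<in> {0..l}"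
  have "((\<lambda>t. ?f' t x) has_vector_derivative 0 + dx l g t x) (at t within {0..T})"
    by (intro has_vector_derivative_add has_vector_derivative_const integral_has_vector_derivative
        C0_rect_t[OF g'(2) x] t)
  then show "((\<lambda>s. dx l f s x) has_vector_derivative dx l g t x) (at t within {0..T})"
    by (intro has_vector_derivative_transform[OF t C1_spaceI(2)[OF l d c c' _ x]]) simp_all
qed

text \<open>The remainder is an \<open>m\<close>-fold time integral of \<open>f m\<close> and
  inherits its regularity in \<open>x\<close>. Nothing is claimed yet about the coefficients
  \<open>f i 0\<close>.\<close>

lemma taylor_in_time:
  assumes l: "0 < l" and T: "0 < T"
    and f: "\<And>j t x. j < m \<Longrightarrow> t \<in> {0..T} \<Longrightarrow> x \<in> {0..l} \<Longrightarrow>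
        ((\<lambda>s. f j s x) has_vector_derivative f (Suc j) t x) (at t within {0..T})"
    and top: "C1_space T l (f m)"
  shows "\<exists>G. C1_space T l G \<and> (\<forall>t\<in>{0..T}. \<forall>x\<in>{0..l}.
      f 0 t x = (\<Sum>i<m. of_real t ^ i * (f i 0 x / fact i)) + G t x)"
  using f top
proof (induction m arbitrary: f)
  case 0
  then show ?case by auto
next
  case (Suc m)
  have "\<exists>G. C1_space T l G \<and> (\<forall>t\<in>{0..T}. \<forall>x\<in>{0..l}.
      f (Suc 0) t x = (\<Sum>i<m. of_real t ^ i * (f (Suc i) 0 x / fact i)) + G t x)"
    using Suc.IH[of "\<lambda>j. f (Suc j)"] Suc.prems by simp
  then obtain G where G: "C1_space T l G"
    "\<And>t x. t \<in> {0..T} \<Longrightarrow> x \<in> {0..l} \<Longrightarrow>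
      f (Suc 0) t x = (\<Sum>i<m. of_real t ^ i * (f (Suc i) 0 x / fact i)) + G t x"
    by blast
  define H where "H t x = 0 + integral {0..t} (\<lambda>s. G s x)" for t x
  have "C1_space T l H"
    by (rule C1_space_time_integral(1)[OF l T G(1) C1_interval_zero[OF l]]) (simp add: H_def)
  moreover have "f 0 t x = (\<Sum>i<Suc m. of_real t ^ i * (f i 0 x / fact i)) + H t x"
    if t: "t \<in> {0..T}" and x: "x \<in> {0..l}" for t x
  proof -
    define p where "p t = (\<Sum>i<Suc m. of_real t ^ i * (f i 0 x / fact i))" for t :: real
    have dp: "(p has_vector_derivative (\<Sum>i<m. of_real s ^ i * (f (Suc i) 0 x / fact i))) (at s within {0..T})" for s
    proof -
      have "((\<lambda>z. \<Sum>i<Suc m. z ^ i * (f i 0 x / fact i)) has_field_derivative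
          (\<Sum>i<Suc m. of_nat i * of_real s ^ (i - 1) * (f i 0 x / fact i))) (at (of_real s))"
        by (intro DERIV_sum) (auto intro!: derivative_eq_intros)
      then have "(p has_vector_derivative (\<Sum>i<Suc m. of_nat i * of_real s ^ (i - 1) * (f i 0 x / fact i))) (at s within {0..T})"
        unfolding p_def[abs_def] by (rule has_vector_derivative_real_field)
      also have "(\<Sum>i<Suc m. of_nat i * of_real s ^ (i - 1) * (f i 0 x / fact i)) =
          (\<Sum>i<m. of_nat (Suc i) * of_real s ^ i * (f (Suc i) 0 x / fact (Suc i)))"
        by (subst sum.lessThan_Suc_shift) simp
      also have "\<dots> = (\<Sum>i<m. of_real s ^ i * (f (Suc i) 0 x / fact i))"
        by (intro sum.cong) (auto simp: fact_Suc divide_simps simp del: of_nat_Suc)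
      finally show ?thesis .
    qed
    have cG: "continuous_on {0..T} (\<lambda>s. G s x)"
      using G(1) x by (intro C0_rect_t) (auto simp: C1_space_def)
    define D where "D t = f 0 t x - (p t + H t x)" for t
    have "norm (D t - D 0) \<le> 0 * (t - 0)"
    proof (rule vector_mvt_bound)
      fix s assume s: "s \<in> {0..t}"
      then have s': "s \<in> {0..T}" using t by auto
      have "(D has_vector_derivative f (Suc 0) s x - ((\<Sum>i<m. of_real s ^ i * (f (Suc i) 0 x / fact i)) + (0 + G s x)))
          (at s within {0..T})"
        unfolding D_def[abs_def] H_def
        by (intro has_vector_derivative_diff has_vector_derivative_add has_vector_derivative_const dp
            integral_has_vector_derivative cG s' Suc.prems(1) x) simp
      then show "(D has_vector_derivative 0) (at s within {0..T})"
        using G(2)[OF s' x] by simp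
    qed (use t in auto)
    moreover have "p 0 = f 0 0 x"
      unfolding p_def by (subst sum.lessThan_Suc_shift) simp
    then have "D 0 = 0" by (simp add: D_def H_def)
    ultimately show ?thesis by (simp add: D_def p_def)
  qed
  ultimately show ?case by blast
qed

text \<open>For \<open>0 < j < m\<close> no regularity of \<open>f j\<close> in \<open>x\<close> is
  given. Subtracting the Taylor remainder from \<open>f 0\<close> leaves a polynomial in
  \<open>t\<close> that is \<open>C1_interval\<close> for each \<open>t\<close>, hence so are its
  coefficients and the initial values \<open>f i 0\<close>. Integrating in time from
  \<open>f m\<close> downwards then gives every \<open>f j\<close> the required regularity.\<close>

lemma dx_time_derivatives:
  assumes l: "0 < l" and T: "0 < T"
    and f: "\<And>j t x. j < m \<Longrightarrow> t \<in> {0..T} \<Longrightarrow> x \<in> {0..l} \<Longrightarrow>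
        ((\<lambda>s. f j s x) has_vector_derivative f (Suc j) t x) (at t within {0..T})"
    and bot: "C1_space T l (f 0)" and top: "C1_space T l (f m)"
    and j: "j < m" and t: "t \<in> {0..T}" and x: "x \<in> {0..l}"
  shows "((\<lambda>s. dx l (f j) s x) has_vector_derivative dx l (f (Suc j)) t x) (at t within {0..T})"
proof -
  obtain G where G: "C1_space T l G" "\<And>t x. t \<in> {0..T} \<Longrightarrow> x \<in> {0..l} \<Longrightarrow>
      f 0 t x = (\<Sum>i<m. of_real t ^ i * (f i 0 x / fact i)) + G t x"
    using taylor_in_time[of l T m f] l T f top by blast
  have init: "C1_interval l (f i 0)" if "i < m" for i
  proof -
    have "C1_interval l (\<lambda>x. f i 0 x / fact i)"
    proof (rule C1_interval_coefficients[OF l T _ that])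
      fix t assume "0 < t" "t \<le> T"
      then have t: "t \<in> {0..T}" by simp
      have "C1_interval l (\<lambda>x. 1 * f 0 t x + (- 1) * G t x)"
        by (intro C1_interval_linear l C1_space_C1_interval[OF l _ t] bot G)
      then show "C1_interval l (\<lambda>x. \<Sum>i<m. of_real t ^ i * (f i 0 x / fact i))"
        by (rule C1_interval_cong[OF l]) (simp add: G(2)[OF t])
    qed
    from C1_interval_linear[OF l this this, of "fact i" 0] show ?thesis by simp
  qed
  have step: "f j t x = f j 0 x + integral {0..t} (\<lambda>s. f (Suc j) s x)"
    if "j < m" "t \<in> {0..T}" "x \<in> {0..l}" for j t x
  proof -
    have "((\<lambda>s. f (Suc j) s x) has_integral (f j t x - f j 0 x)) {0..t}"
    proof (rule fundamental_theorem_of_calculus)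
      fix s assume "s \<in> {0..t}"
      then show "((\<lambda>s. f j s x) has_vector_derivative f (Suc j) s x) (at s within {0..t})"
        using that by (intro has_vector_derivative_within_subset[OF f[OF that(1) _ that(3)]]) auto
    qed (use that in auto)
    then show ?thesis by (simp add: integral_unique)
  qed
  have down: "C1_space T l (f (m - i))" if "i \<le> m" for i
    using that
  proof (induction i)
    case 0
    then show ?case using top by simp
  next
    case (Suc i)
    define j where "j = m - Suc i"
    have j: "j < m" "Suc j = m - i" using Suc.prems by (auto simp: j_def)
    have "C1_space T l (f (Suc j))" using Suc j(2) by simp
    from C1_space_time_integral(1)[OF l T this init[OF j(1)] step[OF j(1)]]
    show ?case by (simp add: j_def)
  qed
  have "C1_space T l (f (Suc j))" using down[of "m - Suc j"] j by simp
  from C1_space_time_integral(2)[OF l T this init[OF j] step[OF j] t x] show ?thesis .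
qed

text \<open>\<open>dt\<close> sees only the line at the given \<open>x\<close>, so an iterated time
  derivative can be read off from a chain \<open>h\<close> known on that line alone.\<close>

lemma dt_power_eq:
  assumes T: "0 < T"
    and h: "\<And>j t. j < m \<Longrightarrow> t \<in> {0..T} \<Longrightarrow> (h j has_vector_derivative h (Suc j) t) (at t within {0..T})"
    and F: "\<And>t. t \<in> {0..T} \<Longrightarrow> F t x = h 0 t"
  shows "j \<le> m \<Longrightarrow> t \<in> {0..T} \<Longrightarrow> (dt T ^^ j) F t x = h j t"
proof (induction j arbitrary: t)
  case (Suc j)
  have "((\<lambda>s. (dt T ^^ j) F s x) has_vector_derivative h (Suc j) t) (at t within {0..T})"
    by (rule has_vector_derivative_transform[OF Suc.prems(2) _ h]) (use Suc in auto)
  moreover have "(dt T ^^ Suc j) F t x = vector_derivative (\<lambda>s. (dt T ^^ j) F s x) (at t within {0..T})"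
    unfolding funpow.simps o_apply by (simp only: dt_def[of T "(dt T ^^ j) F"])
  ultimately show ?case
    using vector_derivative_within_cbox[of 0 T t] T Suc.prems(2) by (simp add: cbox_interval)
qed (use F in simp)

section \<open>Finite Laplace transforms\<close>

text \<open>The right-hand side is the same integral over the whole half-line; an explicit primitive
  shows that truncation only lowers it.\<close>

lemma laplace_weight_bound:
  fixes a c e T :: real
  assumes a: "0 < a" and T: "0 \<le> T" and e: "0 \<le> e" and c: "0 \<le> c"
  shows "integral {0..T} (\<lambda>t. exp (- a * t) * (e + c * t)) \<le> e / a + c / a\<^sup>2"
    and "(\<lambda>t. exp (- a * t) * (e + c * t)) integrable_on {0..T}"
proof -
  let ?F = "\<lambda>t. - (exp (- a * t) * ((e + c * t) / a + c / a\<^sup>2))"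
  have hi: "((\<lambda>t. exp (- a * t) * (e + c * t)) has_integral (?F T - ?F 0)) {0..T}"
  proof (rule fundamental_theorem_of_calculus[OF T])
    fix t
    show "(?F has_vector_derivative exp (- a * t) * (e + c * t)) (at t within {0..T})"
      unfolding has_real_derivative_iff_has_vector_derivative[symmetric]
      using a by (auto intro!: derivative_eq_intros simp: field_simps power2_eq_square)
  qed
  then show "(\<lambda>t. exp (- a * t) * (e + c * t)) integrable_on {0..T}" by blast
  have "integral {0..T} (\<lambda>t. exp (- a * t) * (e + c * t)) = ?F T - ?F 0"
    using hi by (rule integral_unique)
  also have "\<dots> \<le> e / a + c / a\<^sup>2" using a e c T by simp
  finally show "integral {0..T} (\<lambda>t. exp (- a * t) * (e + c * t)) \<le> e / a + c / a\<^sup>2" .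
qed

lemma exp_minus_mult_integral_bound:
  fixes g :: "real \<Rightarrow> complex"
  assumes s: "0 < Re s" and T: "0 \<le> T" and g: "continuous_on {0..T} g"
    and b: "\<And>t. t \<in> {0..T} \<Longrightarrow> norm (g t) \<le> e + c * t" and e: "0 \<le> e" and c: "0 \<le> c"
  shows "norm (integral {0..T} (\<lambda>t. exp (- s * of_real t) * g t)) \<le> e / Re s + c / (Re s)\<^sup>2"
proof -
  have "norm (integral {0..T} (\<lambda>t. exp (- s * of_real t) * g t)) \<le>
      integral {0..T} (\<lambda>t. exp (- Re s * t) * (e + c * t))"
  proof (rule integral_norm_bound_integral)
    show "(\<lambda>t. exp (- s * of_real t) * g t) integrable_on {0..T}"
      by (intro integrable_continuous_interval continuous_intros g)
    show "(\<lambda>t. exp (- Re s * t) * (e + c * t)) integrable_on {0..T}"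
      by (rule laplace_weight_bound(2)[OF s T e c])
    show "norm (exp (- s * of_real t) * g t) \<le> exp (- Re s * t) * (e + c * t)" if "t \<in> {0..T}" for t
      using b[OF that] by (simp add: norm_mult)
  qed
  also have "\<dots> \<le> e / Re s + c / (Re s)\<^sup>2"
    by (rule laplace_weight_bound(1)[OF s T e c])
  finally show ?thesis .
qed

text \<open>The boundary term at \<open>T\<close> is the price of a finite time interval; it becomes
  the source of the Schroedinger equation.\<close>

lemma finite_laplace_by_parts:
  fixes h h' :: "real \<Rightarrow> complex"
  assumes T: "0 \<le> T" and h: "\<And>t. t \<in> {0..T} \<Longrightarrow> (h has_vector_derivative h' t) (at t within {0..T})"
    and h': "continuous_on {0..T} h'"
  shows "integral {0..T} (\<lambda>t. exp (- s * of_real t) * h' t) =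
    exp (- s * of_real T) * h T - h 0 + s * integral {0..T} (\<lambda>t. exp (- s * of_real t) * h t)"
proof -
  have hc: "continuous_on {0..T} h"
    by (rule continuous_on_vector_derivative) (rule h)
  have i: "(\<lambda>t. exp (- s * of_real t) * h' t) integrable_on {0..T}"
    "(\<lambda>t. exp (- s * of_real t) * h t) integrable_on {0..T}"
    by (intro integrable_continuous_interval continuous_intros h' hc)+
  have "((\<lambda>t. exp (- s * of_real t) * h' t + (- s * exp (- s * of_real t)) * h t) has_integral
      exp (- s * of_real T) * h T - exp (- s * of_real 0) * h 0) {0..T}"
    by (intro fundamental_theorem_of_calculus T has_vector_derivative_mult exp_has_vector_derivative h)
  then have e1: "integral {0..T} (\<lambda>t. exp (- s * of_real t) * h' t + (- s) * (exp (- s * of_real t) * h t)) =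
      exp (- s * of_real T) * h T - h 0"
    by (simp add: integral_unique mult.assoc)
  have e2: "integral {0..T} (\<lambda>t. exp (- s * of_real t) * h' t + (- s) * (exp (- s * of_real t) * h t)) =
      integral {0..T} (\<lambda>t. exp (- s * of_real t) * h' t) +
      (- s) * integral {0..T} (\<lambda>t. exp (- s * of_real t) * h t)"
    by (simp only: integral_add[OF i(1) integrable_on_mult_right[OF i(2)]] integral_mult_right)
  from e1[unfolded e2] show ?thesis by (simp add: algebra_simps)
qed

lemma power_exp_decay:
  fixes w c :: complex
  assumes w: "0 < Re w" and T: "0 < T"
  shows "((\<lambda>r. (of_real r * w) ^ n * (exp (- (of_real r * w) * of_real T) * c)) \<longlongrightarrow> 0) at_top"
proof (rule Lim_null_comparison)
  define K where "K = norm w ^ n * norm c / (Re w * T) ^ n"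
  show "\<forall>\<^sub>F r in at_top. norm ((of_real r * w) ^ n * (exp (- (of_real r * w) * of_real T) * c)) \<le>
      K * ((Re w * T * r) ^ n / exp (Re w * T * r))"
    using eventually_ge_at_top[of 0]
  proof eventually_elim
    case (elim r)
    then have "norm ((of_real r * w) ^ n * (exp (- (of_real r * w) * of_real T) * c)) =
        (r * norm w) ^ n * (exp (- (Re w * T * r)) * norm c)"
      by (simp add: norm_mult norm_power mult_ac)
    also have "\<dots> = K * ((Re w * T * r) ^ n / exp (Re w * T * r))"
      using w T by (simp add: K_def power_mult_distrib exp_minus field_simps)
    finally show ?case by simp
  qed
  have "filterlim (\<lambda>r. Re w * T * r) at_top at_top"
    using w T by (intro filterlim_tendsto_pos_mult_at_top[OF tendsto_const]) (auto intro: filterlim_ident)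
  from filterlim_compose[OF tendsto_power_div_exp_0 this]
  have "((\<lambda>r. (Re w * T * r) ^ n / exp (Re w * T * r)) \<longlongrightarrow> 0) at_top" .
  then show "((\<lambda>r. K * ((Re w * T * r) ^ n / exp (Re w * T * r))) \<longlongrightarrow> 0) at_top"
    by (rule tendsto_mult_right_zero)
qed

text \<open>On a ray \<open>norm s / Re s\<close> is constant. The constant part \<open>h 0\<close>
  contributes \<open>h 0\<close> up to an exponentially small term, and \<open>h - h 0\<close>
  contributes little because it is small near \<open>0\<close>.\<close>

lemma laplace_initial_value:
  fixes h :: "real \<Rightarrow> complex"
  assumes w: "0 < Re w" and T: "0 < T" and h: "continuous_on {0..T} h"
  shows "((\<lambda>r. (of_real r * w) * integral {0..T} (\<lambda>t. exp (- (of_real r * w) * of_real t) * h t)) \<longlongrightarrow> h 0) at_top"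
proof -
  define L where "L g s = integral {0..T} (\<lambda>t. exp (- s * of_real t) * g t)" for g :: "real \<Rightarrow> complex" and s
  define g where "g t = h t - h 0" for t
  have gc: "continuous_on {0..T} g" unfolding g_def by (intro continuous_intros h)
  have w0: "0 < norm w" using w by auto
  have small: "((\<lambda>r. (of_real r * w) * L g (of_real r * w)) \<longlongrightarrow> 0) at_top"
  proof (rule tendstoI)
    fix e0 :: real assume e0: "0 < e0"
    define e where "e = e0 * Re w / (2 * norm w)"
    have e: "0 < e" using e0 w w0 by (simp add: e_def)
    have "bounded (g ` {0..T})"
      using gc by (intro compact_imp_bounded compact_continuous_image) auto
    then obtain M where M: "\<And>t. t \<in> {0..T} \<Longrightarrow> norm (g t) \<le> M"
      unfolding bounded_iff by blast
    have M0: "0 \<le> M" using M[of 0] T by (auto intro: order_trans[OF norm_ge_zero])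
    obtain d where d: "0 < d" "\<And>t. t \<in> {0..T} \<Longrightarrow> t < d \<Longrightarrow> norm (g t) < e"
    proof -
      have "\<exists>d>0. \<forall>t\<in>{0..T}. dist t 0 < d \<longrightarrow> dist (g t) (g 0) < e"
        using gc[unfolded continuous_on_iff, THEN bspec[where x = 0]] e T by simp
      then obtain d where "0 < d" "\<forall>t\<in>{0..T}. dist t 0 < d \<longrightarrow> dist (g t) (g 0) < e" by blast
      then show thesis by (intro that[of d]) (auto simp: g_def dist_norm)
    qed
    have gb: "norm (g t) \<le> e + M / d * t" if t: "t \<in> {0..T}" for t
    proof (cases "t < d")
      case True
      have "0 \<le> M / d * t" using t d M0 by simp
      then show ?thesis using d(2)[OF t True] by linarith
    next
      case False
      then have "1 \<le> t / d" using d by simp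
      then have "M * 1 \<le> M * (t / d)" using M0 by (intro mult_left_mono)
      then show ?thesis using M[OF t] e by simp
    qed
    define K where "K = norm w * (M / d) / (Re w)\<^sup>2"
    have bound: "norm ((of_real r * w) * L g (of_real r * w)) \<le> e0 / 2 + K / r" if r: "0 < r" for r
    proof -
      have "norm (L g (of_real r * w)) \<le> e / Re (of_real r * w) + (M / d) / (Re (of_real r * w))\<^sup>2"
        unfolding L_def using r w T e M0 d(1) by (intro exp_minus_mult_integral_bound gc gb) auto
      then have "norm (L g (of_real r * w)) \<le> e / (r * Re w) + (M / d) / (r * Re w)\<^sup>2" by simp
      then have "(r * norm w) * norm (L g (of_real r * w)) \<le> (r * norm w) * (e / (r * Re w) + (M / d) / (r * Re w)\<^sup>2)"
        using r by (intro mult_left_mono) auto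
      also have "\<dots> = norm w * e / Re w + K / r"
        using r w by (simp add: K_def distrib_left power2_eq_square)
      also have "norm w * e / Re w = e0 / 2"
        using w w0 by (simp add: e_def)
      finally show ?thesis using r by (simp add: norm_mult)
    qed
    have "((\<lambda>r. K / r) \<longlongrightarrow> 0) at_top"
      by (intro tendsto_divide_0[OF tendsto_const] filterlim_at_top_imp_at_infinity filterlim_ident)
    then have "\<forall>\<^sub>F r in at_top. K / r < e0 / 2"
      using e0 by (intro order_tendstoD(2)) auto
    then show "\<forall>\<^sub>F r in at_top. dist ((of_real r * w) * L g (of_real r * w)) 0 < e0"
      using eventually_gt_at_top[of 0]
    proof eventually_elim
      case (elim r)
      then have "norm ((of_real r * w) * L g (of_real r * w)) < e0"
        using bound[of r] by linarith
      then show ?case by (simp only: dist_norm diff_zero)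
    qed
  qed
  have split: "(of_real r * w) * L h (of_real r * w) =
      (of_real r * w) * L g (of_real r * w) + h 0 - (of_real r * w) ^ 0 * (exp (- (of_real r * w) * of_real T) * h 0)" for r
  proof -
    let ?s = "of_real r * w"
    have 1: "?s * integral {0..T} (\<lambda>t. exp (- ?s * of_real t) * h 0) = h 0 - exp (- ?s * of_real T) * h 0"
      using finite_laplace_by_parts[of T "\<lambda>_. h 0" "\<lambda>_. 0" ?s] T by (simp add: algebra_simps)
    have "L h ?s = integral {0..T} (\<lambda>t. exp (- ?s * of_real t) * g t + exp (- ?s * of_real t) * h 0)"
      by (simp add: L_def g_def algebra_simps)
    also have "\<dots> = L g ?s + integral {0..T} (\<lambda>t. exp (- ?s * of_real t) * h 0)"
      unfolding L_def by (intro integral_add integrable_continuous_interval continuous_intros gc)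
    finally show ?thesis using 1 by (simp add: distrib_left)
  qed
  have "((\<lambda>r. (of_real r * w) * L g (of_real r * w) + h 0 -
      (of_real r * w) ^ 0 * (exp (- (of_real r * w) * of_real T) * h 0)) \<longlongrightarrow> 0 + h 0 - 0) at_top"
    by (intro tendsto_add tendsto_diff small tendsto_const power_exp_decay w T)
  then show ?thesis unfolding split[symmetric] by (simp add: L_def)
qed

text \<open>Each integration by parts trades a factor \<open>s\<close> for a time derivative: the
  value at \<open>0\<close> vanishes and the value at \<open>T\<close> is exponentially small, even
  against powers of \<open>s\<close>. The initial value theorem for \<open>h m\<close>
  remains.\<close>

lemma laplace_watson:
  fixes h :: "nat \<Rightarrow> real \<Rightarrow> complex"
  assumes w: "0 < Re w" and T: "0 < T"
    and h: "\<And>j t. j < m \<Longrightarrow> t \<in> {0..T} \<Longrightarrow> (h j has_vector_derivative h (Suc j) t) (at t within {0..T})"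
    and hm: "continuous_on {0..T} (h m)" and h0: "\<And>j. j < m \<Longrightarrow> h j 0 = 0"
  shows "((\<lambda>r. (of_real r * w) ^ Suc m * integral {0..T} (\<lambda>t. exp (- (of_real r * w) * of_real t) * h 0 t))
      \<longlongrightarrow> h m 0) at_top"
  using h hm h0
proof (induction m arbitrary: h)
  case 0
  then show ?case using laplace_initial_value[OF w T, of "h 0"] by simp
next
  case (Suc m)
  let ?L = "\<lambda>h r. integral {0..T} (\<lambda>t. exp (- (of_real r * w) * of_real t) * h t)"
  have c1: "continuous_on {0..T} (h (Suc 0))"
  proof (cases m)
    case 0
    then show ?thesis using Suc.prems by simp
  next
    case (Suc k)
    show ?thesis
      by (rule continuous_on_vector_derivative) (rule Suc.prems(1), use Suc in auto)
  qed
  have eq: "(of_real r * w) ^ Suc (Suc m) * ?L (h 0) r =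
      (of_real r * w) ^ Suc m * ?L (h (Suc 0)) r -
      (of_real r * w) ^ Suc m * (exp (- (of_real r * w) * of_real T) * h 0 T)" for r
  proof -
    have "?L (h (Suc 0)) r = exp (- (of_real r * w) * of_real T) * h 0 T - h 0 0 + (of_real r * w) * ?L (h 0) r"
      using T Suc.prems(1)[of 0] by (intro finite_laplace_by_parts c1) auto
    then have "(of_real r * w) * ?L (h 0) r = ?L (h (Suc 0)) r - exp (- (of_real r * w) * of_real T) * h 0 T"
      using Suc.prems(3)[of 0] by simp
    then show ?thesis
      by (simp only: power_Suc2[of _ "Suc m"] mult.assoc right_diff_distrib)
  qed
  have "((\<lambda>r. (of_real r * w) ^ Suc m * ?L (h (Suc 0)) r) \<longlongrightarrow> h (Suc m) 0) at_top"
    using Suc.IH[of "\<lambda>j. h (Suc j)"] Suc.prems by simp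
  then have "((\<lambda>r. (of_real r * w) ^ Suc m * ?L (h (Suc 0)) r -
      (of_real r * w) ^ Suc m * (exp (- (of_real r * w) * of_real T) * h 0 T)) \<longlongrightarrow> h (Suc m) 0 - 0) at_top"
    by (intro tendsto_diff power_exp_decay w T)
  then show ?case unfolding eq by simp
qed

section \<open>Extension of identities to the closed domain, and uniform bounds\<close>

lemma rect_closure_eq_0:
  assumes T: "0 < T" and l: "0 < l" and F: "C0_rect T l F"
    and z: "\<And>t x. 0 < t \<Longrightarrow> t < T \<Longrightarrow> 0 < x \<Longrightarrow> x < l \<Longrightarrow> F t x = 0"
    and t: "t \<in> {0..T}" and x: "x \<in> {0..l}"
  shows "F t x = 0"
proof -
  have cl: "closure ({0<..<T} \<times> {0<..<l}) = {0..T} \<times> {0..l}"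
    using T l by (simp add: closure_Times)
  have "(\<lambda>(t, x). F t x) (t, x) = 0"
    by (rule continuous_constant_on_closure[of "{0<..<T} \<times> {0<..<l}"])
       (use F z t x in \<open>auto simp: cl C0_rect_def\<close>)
  then show ?thesis by simp
qed

lemma interval_closure_eq_0:
  fixes f :: "real \<Rightarrow> complex"
  assumes l: "0 < l" and f: "continuous_on {0..l} f"
    and z: "\<And>x. 0 < x \<Longrightarrow> x < l \<Longrightarrow> f x = 0" and x: "x \<in> {0..l}"
  shows "f x = 0"
  by (rule continuous_constant_on_closure[of "{0<..<l}"]) (use f z x l in auto)

lemma continuous_on_interval_bounded:
  fixes f :: "real \<Rightarrow> complex"
  assumes "continuous_on {0..l} f"
  shows "\<exists>M\<ge>0. \<forall>x\<in>{0..l}. norm (f x) \<le> M"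
proof -
  have "bounded (f ` {0..l})"
    using assms by (intro compact_imp_bounded compact_continuous_image) auto
  then obtain M where "\<forall>y\<in>f ` {0..l}. norm y \<le> M" unfolding bounded_iff by blast
  then show ?thesis by (intro exI[of _ "max 0 M"]) (auto intro: max.coboundedI2)
qed

lemma C0_rect_bounded:
  assumes "C0_rect T l f"
  shows "\<exists>M\<ge>0. \<forall>t\<in>{0..T}. \<forall>x\<in>{0..l}. norm (f t x) \<le> M"
proof -
  have "bounded ((\<lambda>(t, x). f t x) ` ({0..T} \<times> {0..l}))"
    using assms unfolding C0_rect_def
    by (intro compact_imp_bounded compact_continuous_image compact_Times) auto
  then obtain M where "\<forall>y\<in>(\<lambda>(t, x). f t x) ` ({0..T} \<times> {0..l}). norm y \<le> M"
    unfolding bounded_iff by blast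
  then have "norm (f t x) \<le> M" if "t \<in> {0..T}" "x \<in> {0..l}" for t x
    using that by fastforce
  then show ?thesis by (intro exI[of _ "max 0 M"]) (auto intro: max.coboundedI2)
qed

section \<open>Reduction of the evolution equation to a Schroedinger equation\<close>

definition laplace_T :: "real \<Rightarrow> (real \<Rightarrow> complex) \<Rightarrow> complex \<Rightarrow> complex" where
  "laplace_T T g s = integral {0..T} (\<lambda>t. exp (- s * of_real t) * g t)"

lemma laplace_T_bound:
  assumes "continuous_on {0..T} g" "0 \<le> T" "0 \<le> Re s" "0 \<le> M" "\<And>t. t \<in> {0..T} \<Longrightarrow> norm (g t) \<le> M"
  shows "norm (laplace_T T g s) \<le> M * T"
proof -
  have "norm (laplace_T T g s) \<le> M * (T - 0)"
    unfolding laplace_T_def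
  proof (rule integral_bound)
    show "continuous_on {0..T} (\<lambda>t. exp (- s * of_real t) * g t)"
      by (intro continuous_intros assms)
    fix t assume t: "t \<in> {0..T}"
    then have "norm (exp (- s * of_real t)) \<le> 1" using assms(3) by simp
    then have "norm (exp (- s * of_real t) * g t) \<le> 1 * M"
      unfolding norm_mult using assms(5)[OF t] by (intro mult_mono) auto
    then show "norm (exp (- s * of_real t) * g t) \<le> M" by simp
  qed (use assms in auto)
  then show ?thesis by simp
qed

text \<open>The potential that remains after the Liouville transformation has removed the first
  order term.\<close>

definition liouville_potential :: "real \<Rightarrow> (real \<Rightarrow> complex) \<Rightarrow> (real \<Rightarrow> complex) \<Rightarrow> real \<Rightarrow> complex" where
  "liouville_potential l r P x = P x + (1/4) * (r x)^2 - (1/2) * vector_derivative r (at x within {0..l})"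

text \<open>\<open>G\<close> and \<open>B\<close> precede the quantifier over \<open>s\<close>: for
  \<open>0 \<le> Re s\<close> the kernel has modulus at most \<open>1\<close> on a bounded time
  interval. The source is the boundary term at \<open>T\<close>; the one at \<open>0\<close>
  vanishes by the initial condition.\<close>

lemma laplace_liouville_reduction:
  assumes l: "0 < l" and T: "0 < T" and r: "C1_interval l r" and P: "C1_interval l P" and u: "C12 T l u"
    and pde: "\<And>t x. 0 < x \<Longrightarrow> x < l \<Longrightarrow> 0 < t \<Longrightarrow> t < T \<Longrightarrow>
           \<sigma> * dt T u t x = dx l (dx l u) t x - r x * dx l u t x - P x * u t x"
    and init: "\<And>x. 0 < x \<Longrightarrow> x < l \<Longrightarrow> u 0 x = 0"
  shows "\<exists>G f V V' B. 0 \<le> G \<and> (\<forall>s. 0 \<le> Re s \<longrightarrow>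
      ode_sol l (\<lambda>x. liouville_potential l r P x + \<sigma> * s) (f s) (V s) (V' s) \<and>
      V s 0 = laplace_T T (\<lambda>t. u t 0) s \<and>
      V' s 0 = laplace_T T (\<lambda>t. dx l u t 0) s - (1/2) * r 0 * V s 0 \<and>
      (\<forall>x\<in>{0..l}. norm (V s x) \<le> B \<and> norm (V' s x) \<le> B \<and> norm (f s x) \<le> G * exp (- (Re s * T))))"
proof -
  let ?D = "\<lambda>x. vector_derivative r (at x within {0..l})"
  have C: "C0_rect T l u" "C0_rect T l (dt T u)" "C0_rect T l (dx l u)" "C0_rect T l (dx l (dx l u))"
    and C1: "C1_space T l u" "C1_space T l (dx l u)"
    using u by (auto simp: C12_def C1_space_def)
  have du: "((\<lambda>s. u s x) has_vector_derivative dt T u t x) (at t within {0..T})"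
    if "t \<in> {0..T}" "x \<in> {0..l}" for t x
    using u that by (simp add: C12_def has_dt_def dt_def vector_derivative_works)
  have init': "u 0 x = 0" if "x \<in> {0..l}" for x
    by (rule interval_closure_eq_0[OF l C0_rect_x[OF C(1)] init that]) (use T in auto)
  have pde': "\<sigma> * dt T u t x - (dx l (dx l u) t x - r x * dx l u t x - P x * u t x) = 0"
    if "t \<in> {0..T}" "x \<in> {0..l}" for t x
  proof (rule rect_closure_eq_0[OF T l _ _ that])
    have c: "continuous_on ({0..T} \<times> {0..l}) (\<lambda>p. g (snd p))" if "continuous_on {0..l} g" for g :: "real \<Rightarrow> complex"
      by (rule continuous_on_compose2[OF that]) (auto intro!: continuous_intros)
    show "C0_rect T l (\<lambda>t x. \<sigma> * dt T u t x - (dx l (dx l u) t x - r x * dx l u t x - P x * u t x))"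
      unfolding C0_rect_def case_prod_beta
      by (intro continuous_on_diff continuous_on_mult continuous_on_const c[OF C1_interval_D(2)[OF r]]
          c[OF C1_interval_D(2)[OF P]] C[unfolded C0_rect_def case_prod_beta])
  qed (use pde in auto)
  \<comment> \<open>Its logarithmic derivative \<open>- r / 2\<close> cancels the first order term,
    and \<open>E 0 = 1\<close> keeps the Dirichlet datum.\<close>
  define E where "E x = exp ((- 1/2) * integral {0..x} r)" for x
  have E: "(E has_vector_derivative (- 1/2 * r x) * E x) (at x within {0..l})" if x: "x \<in> {0..l}" for x
  proof -
    have "((\<lambda>x. (- 1/2) * integral {0..x} r) has_vector_derivative (- 1/2) * r x) (at x within {0..l})"
      by (intro has_vector_derivative_mult_right integral_has_vector_derivative C1_interval_D(2) r x)
    from field_vector_diff_chain_within[OF this, of exp "exp ((- 1/2) * integral {0..x} r)"]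
    show ?thesis
      by (simp add: o_def E_def[abs_def] DERIV_exp has_field_derivative_at_within)
  qed
  have Ec: "continuous_on {0..l} E"
    by (rule continuous_on_vector_derivative) (rule E)
  have E0: "E 0 = 1" by (simp add: E_def)
  obtain M0 where M0: "0 \<le> M0" "\<And>t x. t \<in> {0..T} \<Longrightarrow> x \<in> {0..l} \<Longrightarrow> norm (u t x) \<le> M0"
    using C0_rect_bounded[OF C(1)] by blast
  obtain M1 where M1: "0 \<le> M1" "\<And>t x. t \<in> {0..T} \<Longrightarrow> x \<in> {0..l} \<Longrightarrow> norm (dx l u t x) \<le> M1"
    using C0_rect_bounded[OF C(3)] by blast
  obtain ME where ME: "0 \<le> ME" "\<And>x. x \<in> {0..l} \<Longrightarrow> norm (E x) \<le> ME"
    using continuous_on_interval_bounded[OF Ec] by blast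
  obtain MR where MR: "0 \<le> MR" "\<And>x. x \<in> {0..l} \<Longrightarrow> norm (r x) \<le> MR"
    using continuous_on_interval_bounded[OF C1_interval_D(2)[OF r]] by blast
  define U where "U s x = laplace_T T (\<lambda>t. u t x) s" for s x
  define U1 where "U1 s x = laplace_T T (\<lambda>t. dx l u t x) s" for s x
  define U2 where "U2 s x = laplace_T T (\<lambda>t. dx l (dx l u) t x) s" for s x
  define V where "V s x = E x * U s x" for s x
  define V' where "V' s x = E x * (U1 s x - (1/2) * r x * U s x)" for s x
  define f where "f s x = \<sigma> * exp (- s * of_real T) * E x * u T x" for s x
  define B where "B = ME * (M0 * T) + ME * (M1 * T + MR * (M0 * T))"
  define G where "G = norm \<sigma> * ME * M0"
  have Tin: "T \<in> {0..T}" using T by simp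
  have wc: "continuous_on {0..T} (\<lambda>t. exp (- s * of_real t))" for s :: complex
    by (intro continuous_intros)
  have dU: "(U s has_vector_derivative U1 s x) (at x within {0..l})"
    "(U1 s has_vector_derivative U2 s x) (at x within {0..l})" if "x \<in> {0..l}" for s x
    using C1_space_integral_deriv[OF C1(1) wc Tin that] C1_space_integral_deriv[OF C1(2) wc Tin that]
    unfolding U_def[abs_def] U1_def[abs_def] U2_def laplace_T_def by simp_all
  have U2: "U2 s x = r x * U1 s x + P x * U s x + \<sigma> * (exp (- s * of_real T) * u T x + s * U s x)"
    if x: "x \<in> {0..l}" for s x
  proof -
    have i: "(\<lambda>t. exp (- s * of_real t) * g t x) integrable_on {0..T}" if "C0_rect T l g" for g
      by (intro integrable_continuous_interval continuous_intros C0_rect_t[OF that x])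
    have "laplace_T T (\<lambda>t. dt T u t x) s = exp (- s * of_real T) * u T x - u 0 x + s * U s x"
      unfolding laplace_T_def U_def using T
      by (intro finite_laplace_by_parts du x C0_rect_t[OF C(2)]) auto
    then have 1: "laplace_T T (\<lambda>t. dt T u t x) s = exp (- s * of_real T) * u T x + s * U s x"
      using init'[OF x] by simp
    have "U2 s x = integral {0..T} (\<lambda>t. r x * (exp (- s * of_real t) * dx l u t x) +
        P x * (exp (- s * of_real t) * u t x) + \<sigma> * (exp (- s * of_real t) * dt T u t x))"
      unfolding U2_def laplace_T_def
    proof (rule integral_cong)
      fix t assume t: "t \<in> {0..T}"
      have "dx l (dx l u) t x = r x * dx l u t x + P x * u t x + \<sigma> * dt T u t x"
        using pde'[OF t x] by (simp add: algebra_simps)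
      then show "exp (- s * of_real t) * dx l (dx l u) t x = r x * (exp (- s * of_real t) * dx l u t x) +
        P x * (exp (- s * of_real t) * u t x) + \<sigma> * (exp (- s * of_real t) * dt T u t x)"
        by (simp add: algebra_simps)
    qed
    also have "\<dots> = r x * U1 s x + P x * U s x + \<sigma> * laplace_T T (\<lambda>t. dt T u t x) s"
      unfolding U1_def U_def laplace_T_def
      by (simp only: integral_add integrable_add integrable_on_mult_right i C integral_mult_right)
    finally show ?thesis using 1 by simp
  qed
  have sol: "ode_sol l (\<lambda>x. liouville_potential l r P x + \<sigma> * s) (f s) (V s) (V' s)" for s
    unfolding ode_sol_def
  proof (intro ballI conjI)
    fix x assume x: "x \<in> {0..l}"
    have "((\<lambda>x. E x * U s x) has_vector_derivative E x * U1 s x + ((- 1/2 * r x) * E x) * U s x) (at x within {0..l})"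
      by (intro has_vector_derivative_mult E dU x)
    then show "(V s has_vector_derivative V' s x) (at x within {0..l})"
      unfolding V_def[abs_def] V'_def by (simp add: algebra_simps)
    have "((\<lambda>x. E x * (U1 s x - (1/2) * r x * U s x)) has_vector_derivative
        E x * (U2 s x - (((1/2) * r x) * U1 s x + ((1/2) * ?D x) * U s x)) +
        ((- 1/2 * r x) * E x) * (U1 s x - (1/2) * r x * U s x)) (at x within {0..l})"
      by (intro has_vector_derivative_mult has_vector_derivative_diff has_vector_derivative_mult_right E dU
          C1_interval_D(1) r x)
    moreover have "E x * (U2 s x - (((1/2) * r x) * U1 s x + ((1/2) * ?D x) * U s x)) +
        ((- 1/2 * r x) * E x) * (U1 s x - (1/2) * r x * U s x) =
        (liouville_potential l r P x + \<sigma> * s) * V s x + f s x"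
      unfolding U2[OF x] liouville_potential_def V_def f_def
      by (simp add: algebra_simps power2_eq_square)
    ultimately show "(V' s has_vector_derivative
        (liouville_potential l r P x + \<sigma> * s) * V s x + f s x) (at x within {0..l})"
      unfolding V'_def[abs_def] by simp
  qed
  have bnd: "norm (V s x) \<le> B \<and> norm (V' s x) \<le> B \<and> norm (f s x) \<le> G * exp (- (Re s * T))"
    if s: "0 \<le> Re s" and x: "x \<in> {0..l}" for s x
  proof -
    have u0: "norm (U s x) \<le> M0 * T" and u1: "norm (U1 s x) \<le> M1 * T"
      unfolding U_def U1_def using T s x M0 M1 C
      by (intro laplace_T_bound C0_rect_t[OF C(1)] C0_rect_t[OF C(3)]; simp)+
    have m: "0 \<le> M0 * T" "0 \<le> M1 * T" using M0(1) M1(1) T by auto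
    have b0: "norm (V s x) \<le> ME * (M0 * T)"
      unfolding V_def norm_mult using ME u0 x by (intro mult_mono) auto
    have "norm ((1/2) * r x * U s x) \<le> MR * (M0 * T)"
    proof -
      have "norm ((1/2) * r x) \<le> MR" using MR(1) MR(2)[OF x] by (simp add: norm_mult)
      then show ?thesis unfolding norm_mult[of "(1/2) * r x"] using MR u0 by (intro mult_mono) auto
    qed
    then have "norm (U1 s x - (1/2) * r x * U s x) \<le> M1 * T + MR * (M0 * T)"
      using u1 norm_triangle_ineq4[of "U1 s x" "(1/2) * r x * U s x"] by linarith
    then have b1: "norm (V' s x) \<le> ME * (M1 * T + MR * (M0 * T))"
      unfolding V'_def norm_mult[of "E x"] using ME x by (intro mult_mono) auto
    have p: "0 \<le> ME * (M0 * T)" "0 \<le> ME * (M1 * T + MR * (M0 * T))"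
      using ME MR m by auto
    have "norm (f s x) = (norm \<sigma> * (norm (E x) * norm (u T x))) * exp (- (Re s * T))"
      by (simp add: f_def norm_mult)
    also have "\<dots> \<le> (norm \<sigma> * (ME * M0)) * exp (- (Re s * T))"
      using ME M0 x Tin by (intro mult_right_mono mult_left_mono mult_mono) auto
    finally have "norm (f s x) \<le> G * exp (- (Re s * T))" by (simp add: G_def mult_ac)
    then show ?thesis using b0 b1 p by (simp add: B_def)
  qed
  show ?thesis
  proof (rule exI[of _ G], rule exI[of _ f], rule exI[of _ V], rule exI[of _ V'], rule exI[of _ B],
      intro conjI allI impI ballI)
    show "0 \<le> G" using ME M0 by (simp add: G_def)
    fix s :: complex assume s: "0 \<le> Re s"
    show "ode_sol l (\<lambda>x. liouville_potential l r P x + \<sigma> * s) (f s) (V s) (V' s)"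
      by (rule sol)
    show "V s 0 = laplace_T T (\<lambda>t. u t 0) s"
      by (simp add: V_def E0 U_def)
    show "V' s 0 = laplace_T T (\<lambda>t. dx l u t 0) s - (1/2) * r 0 * V s 0"
      by (simp add: V'_def V_def E0 U1_def)
    fix x assume x: "x \<in> {0..l}"
    show "norm (V s x) \<le> B" "norm (V' s x) \<le> B" "norm (f s x) \<le> G * exp (- (Re s * T))"
      using bnd[OF s x] by blast+
  qed
qed

text \<open>The transform times \<open>s ^ Suc m\<close> tends to the nonzero value at the origin,
  so its modulus eventually exceeds half of that limit. The limit first appears as
  \<open>dx l (f m) 0 0\<close>, and the interchange of derivatives identifies it with the
  hypothesis \<open>m\<close>.\<close>

lemma neumann_laplace_lower_bound:
  assumes l: "0 < l" and T: "0 < T" and w: "0 < Re w"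
    and u: "C12 T l u" "dt_pow_C12 T l m u"
    and m: "(dt T ^^ m) (dx l u) 0 0 \<noteq> 0" and j: "\<And>j. j < m \<Longrightarrow> (dt T ^^ j) (dx l u) 0 0 = 0"
  shows "\<exists>K R. \<forall>\<rho>\<ge>R. 1 \<le> norm (laplace_T T (\<lambda>t. dx l u t 0) (of_real \<rho> * w)) * (K * \<rho> ^ Suc m)"
proof -
  define f where "f j = (dt T ^^ j) u" for j
  define h where "h j t = dx l (f j) t 0" for j t
  have f: "((\<lambda>s. f j s x) has_vector_derivative f (Suc j) t x) (at t within {0..T})"
    if "j < m" "t \<in> {0..T}" "x \<in> {0..l}" for j t x
    using u(2) that by (simp add: dt_pow_C12_def has_dt_def f_def dt_def[of T "(dt T ^^ j) u"] vector_derivative_works)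
  have C1: "C1_space T l (f 0)" "C1_space T l (f m)"
    using u by (auto simp: C12_def C1_space_def f_def dt_pow_C12_def)
  have h: "(h j has_vector_derivative h (Suc j) t) (at t within {0..T})" if "j < m" "t \<in> {0..T}" for j t
    unfolding h_def[abs_def] using dx_time_derivatives[OF l T f C1 that, of 0] l by simp
  have h0: "(dt T ^^ j) (dx l u) 0 0 = h j 0" if "j \<le> m" for j
    by (rule dt_power_eq[where h = h and m = m, OF T h _ that]) (use T in \<open>auto simp: h_def f_def\<close>)
  have hm: "continuous_on {0..T} (h m)"
    unfolding h_def[abs_def] using C1(2) l by (intro C0_rect_t) (auto simp: C1_space_def)
  let ?L = "\<lambda>r. laplace_T T (\<lambda>t. dx l u t 0) (of_real r * w)"
  have "((\<lambda>r. (of_real r * w) ^ Suc m * ?L r) \<longlongrightarrow> h m 0) at_top"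
    using laplace_watson[OF w T h hm] j h0 by (simp add: laplace_T_def h_def f_def)
  then have "((\<lambda>r. norm ((of_real r * w) ^ Suc m * ?L r)) \<longlongrightarrow> norm (h m 0)) at_top"
    by (rule tendsto_norm)
  moreover have c: "0 < norm (h m 0)" using m h0[of m] by simp
  ultimately have "\<forall>\<^sub>F r in at_top. norm (h m 0) / 2 < norm ((of_real r * w) ^ Suc m * ?L r)"
    by (intro order_tendstoD(1)) auto
  then have "\<forall>\<^sub>F r in at_top. norm (h m 0) / 2 < norm ((of_real r * w) ^ Suc m * ?L r) \<and> 0 \<le> r"
    by (intro eventually_conj eventually_ge_at_top)
  then obtain R where R: "\<And>r. R \<le> r \<Longrightarrow> norm (h m 0) / 2 < norm ((of_real r * w) ^ Suc m * ?L r) \<and> 0 \<le> r"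
    unfolding eventually_at_top_linorder by blast
  define K where "K = norm w ^ Suc m * 2 / norm (h m 0)"
  have "1 \<le> norm (?L \<rho>) * (K * \<rho> ^ Suc m)" if "R \<le> \<rho>" for \<rho>
  proof -
    have "norm (h m 0) / 2 < (\<rho> * norm w) ^ Suc m * norm (?L \<rho>)"
      using R[OF that] by (simp only: norm_mult norm_power norm_of_real abs_of_nonneg[OF conjunct2[OF R[OF that]]])
    then have "1 < (\<rho> * norm w) ^ Suc m * norm (?L \<rho>) * 2 / norm (h m 0)"
      using c by (simp add: pos_less_divide_eq)
    also have "\<dots> = norm (?L \<rho>) * (K * \<rho> ^ Suc m)"
      unfolding K_def power_mult_distrib by (simp only: times_divide_eq_left times_divide_eq_right mult_ac)
    finally show ?thesis by simp
  qed
  then show ?thesis by blast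
qed

section \<open>Choice of the ray and conclusion\<close>

theorem corollary5:
  fixes l T :: real
    and r rt P Q :: "real \<Rightarrow> complex"
    and \<sigma> :: complex
    and u ut :: "real \<Rightarrow> real \<Rightarrow> complex"
    and m :: nat
  assumes "0 < l" and "0 < T"
    and "C1_interval l r" and "C1_interval l rt" and "C1_interval l P" and "C1_interval l Q"
    and "\<sigma> \<noteq> 0"
    and "r 0 = rt 0"
    and "C12 T l u" and "C12 T l ut"
    and "\<And>t x. 0 < x \<Longrightarrow> x < l \<Longrightarrow> 0 < t \<Longrightarrow> t < T \<Longrightarrow>
           \<sigma> * dt T u t x = dx l (dx l u) t x - r x * dx l u t x - P x * u t x"
    and "\<And>x. 0 < x \<Longrightarrow> x < l \<Longrightarrow> u 0 x = 0"
    and "\<And>t x. 0 < x \<Longrightarrow> x < l \<Longrightarrow> 0 < t \<Longrightarrow> t < T \<Longrightarrow>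
           \<sigma> * dt T ut t x = dx l (dx l ut) t x - rt x * dx l ut t x - Q x * ut t x"
    and "\<And>x. 0 < x \<Longrightarrow> x < l \<Longrightarrow> ut 0 x = 0"
    and "dt_pow_C12 T l m u" and "dt_pow_C12 T l m ut"
    and "(dt T ^^ m) (dx l u) 0 0 \<noteq> 0"
    and "\<And>j. j < m \<Longrightarrow> (dt T ^^ j) (dx l u) 0 0 = 0"
    and "\<And>t. 0 < t \<Longrightarrow> t < T \<Longrightarrow> u t 0 = ut t 0"
    and "\<And>t. 0 < t \<Longrightarrow> t < T \<Longrightarrow> dx l u t 0 = dx l ut t 0"
  shows "\<forall>x\<in>{0..l/2}.
           P x + (1/4) * (r x)^2 - (1/2) * vector_derivative r (at x within {0..l})
         = Q x + (1/4) * (rt x)^2 - (1/2) * vector_derivative rt (at x within {0..l})"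
proof -
  note l = assms(1) and T = assms(2)
  \<comment> \<open>The root \<open>csqrt \<sigma>\<close> makes the quotient \<open>1\<close>, but
    has real part \<open>0\<close> when \<open>\<sigma>\<close> is negative. In that case
    \<open>(1 + 2 * \<i>)\<^sup>2 = - 3 + 4 * \<i>\<close> has negative real part, as
    required.\<close>
  obtain k0 where k0: "0 < Re k0" "0 < Re (k0\<^sup>2 / \<sigma>)"
  proof (cases "0 < Re (csqrt \<sigma>)")
    case True
    then show thesis using assms(7) by (intro that[of "csqrt \<sigma>"]) auto
  next
    case False
    then have "Re (csqrt \<sigma>) = 0" using csqrt_principal[of \<sigma>] by auto
    then have c: "csqrt \<sigma> = \<i> * of_real (Im (csqrt \<sigma>))" by (simp add: complex_eq_iff)
    define y where "y = Im (csqrt \<sigma>)"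
    have "\<sigma> = (\<i> * of_real y)\<^sup>2" using c power2_csqrt[of \<sigma>] by (simp add: y_def)
    then have s: "\<sigma> = of_real (- (y\<^sup>2))" by (simp add: power_mult_distrib)
    then have y: "y \<noteq> 0" using assms(7) by auto
    have "Re ((Complex 1 2)\<^sup>2 / \<sigma>) = 3 / y\<^sup>2"
      unfolding s Re_divide_of_real by (simp add: power2_eq_square)
    then show thesis using y by (intro that[of "Complex 1 2"]) auto
  qed
  define w where "w = k0\<^sup>2 / \<sigma>"
  have w: "0 < Re w" using k0 by (simp add: w_def)
  obtain G1 f V V' B1 where G1: "0 \<le> G1" and V: "\<And>s. 0 \<le> Re s \<Longrightarrow>
      ode_sol l (\<lambda>x. liouville_potential l r P x + \<sigma> * s) (f s) (V s) (V' s) \<and>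
      V s 0 = laplace_T T (\<lambda>t. u t 0) s \<and>
      V' s 0 = laplace_T T (\<lambda>t. dx l u t 0) s - (1/2) * r 0 * V s 0 \<and>
      (\<forall>x\<in>{0..l}. norm (V s x) \<le> B1 \<and> norm (V' s x) \<le> B1 \<and> norm (f s x) \<le> G1 * exp (- (Re s * T)))"
    by (atomize_elim, rule laplace_liouville_reduction[OF l T assms(3,5,9)]; (rule assms; assumption))
  obtain G2 g W W' B2 where G2: "0 \<le> G2" and W: "\<And>s. 0 \<le> Re s \<Longrightarrow>
      ode_sol l (\<lambda>x. liouville_potential l rt Q x + \<sigma> * s) (g s) (W s) (W' s) \<and>
      W s 0 = laplace_T T (\<lambda>t. ut t 0) s \<and>
      W' s 0 = laplace_T T (\<lambda>t. dx l ut t 0) s - (1/2) * rt 0 * W s 0 \<and>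
      (\<forall>x\<in>{0..l}. norm (W s x) \<le> B2 \<and> norm (W' s x) \<le> B2 \<and> norm (g s x) \<le> G2 * exp (- (Re s * T)))"
    by (atomize_elim, rule laplace_liouville_reduction[OF l T assms(4,6,10)]; (rule assms; assumption))
  obtain K R0 where low: "\<And>\<rho>. R0 \<le> \<rho> \<Longrightarrow>
      1 \<le> norm (laplace_T T (\<lambda>t. dx l u t 0) (of_real \<rho> * w)) * (K * \<rho> ^ Suc m)"
    using neumann_laplace_lower_bound[OF l T w assms(9,15,17)] assms(18) by blast
  have lin: "0 \<in> {0..l}" using l by simp
  have C: "C0_rect T l u" "C0_rect T l ut" "C0_rect T l (dx l u)" "C0_rect T l (dx l ut)"
    using assms(9,10) by (auto simp: C12_def)
  have same: "laplace_T T (\<lambda>t. a t 0) s = laplace_T T (\<lambda>t. b t 0) s"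
    if ab: "C0_rect T l a" "C0_rect T l b" "\<And>t. 0 < t \<Longrightarrow> t < T \<Longrightarrow> a t 0 = b t 0" for a b s
    unfolding laplace_T_def
  proof (rule integral_cong)
    fix t assume t: "t \<in> {0..T}"
    have "a t 0 - b t 0 = 0"
      by (rule interval_closure_eq_0[OF T continuous_on_diff[OF C0_rect_t[OF ab(1) lin] C0_rect_t[OF ab(2) lin]] _ t])
         (simp add: ab(3))
    then show "exp (- s * of_real t) * a t 0 = exp (- s * of_real t) * b t 0" by simp
  qed
  define S where "S t = of_real (t\<^sup>2) * w" for t
  \<comment> \<open>The last entry makes \<open>T * Re (S t) = t\<^sup>2 * T * Re w\<close> at least
    \<open>5 * (t * Re k0) * l\<close>, the decay demanded of the sources.\<close>
  define R where "R = max 1 (max R0 (5 * Re k0 * l / (Re w * T)))"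
  have S0: "0 \<le> Re (S t)" for t using w by (simp add: S_def)
  have Sk: "\<sigma> * S t = (of_real t * k0)\<^sup>2" for t
    using assms(7) by (simp add: S_def w_def power_mult_distrib)
  \<comment> \<open>With \<open>eta = - r 0 / 2\<close> the combination \<open>V' - eta * V\<close>
    at \<open>0\<close> is the transform of \<open>dx l u t 0\<close>. The lower bound has degree
    \<open>Suc m\<close> in \<open>t\<^sup>2\<close>, hence \<open>N = 2 * Suc m\<close>.\<close>
  have pot: "liouville_potential l r P x = liouville_potential l rt Q x" if x: "x \<in> {0..l / 2}" for x
  proof (rule local_borg_marchenko[OF l _ _ k0(1), where R = R and f = "\<lambda>t. f (S t)" and g = "\<lambda>t. g (S t)"
        and V = "\<lambda>t. V (S t)" and V' = "\<lambda>t. V' (S t)" and W = "\<lambda>t. W (S t)" and W' = "\<lambda>t. W' (S t)"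
        and B = "max B1 B2" and G = "max G1 G2" and eta = "- (1/2) * r 0" and K = K and N = "2 * Suc m", OF _ _ _ _ _ _ _ _ _ _ x])
    show "continuous_on {0..l} (liouville_potential l r P)" "continuous_on {0..l} (liouville_potential l rt Q)"
      unfolding liouville_potential_def[abs_def]
      by (intro continuous_intros C1_interval_D(2,3) assms)+
    show "0 \<le> max G1 G2" using G1 by simp
    fix t assume t: "R \<le> t"
    show "ode_sol l (\<lambda>x. liouville_potential l r P x + (of_real t * k0)\<^sup>2) (f (S t)) (V (S t)) (V' (S t))"
      "ode_sol l (\<lambda>x. liouville_potential l rt Q x + (of_real t * k0)\<^sup>2) (g (S t)) (W (S t)) (W' (S t))"
      using V[OF S0[of t]] W[OF S0[of t]] by (simp_all add: Sk)
    show 0: "V (S t) 0 = W (S t) 0"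
      using V[OF S0[of t]] W[OF S0[of t]] same[OF C(1,2) assms(19)] by simp
    show "V' (S t) 0 = W' (S t) 0"
      using V[OF S0[of t]] W[OF S0[of t]] same[OF C(3,4) assms(20)] 0 assms(8) by simp
    have t1: "1 \<le> t" "R0 \<le> t" "5 * Re k0 * l / (Re w * T) \<le> t" using t by (auto simp: R_def)
    have "t * 1 \<le> t * t" using t1 by (intro mult_left_mono) auto
    then have "R0 \<le> t\<^sup>2" using t1 unfolding power2_eq_square by linarith
    moreover have "V' (S t) 0 - (- (1/2) * r 0) * V (S t) 0 = laplace_T T (\<lambda>t. dx l u t 0) (S t)"
      using V[OF S0[of t]] by simp
    ultimately show "1 \<le> norm (V' (S t) 0 - (- (1/2) * r 0) * V (S t) 0) * (K * t ^ (2 * Suc m))"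
      using low[of "t\<^sup>2"] by (simp only: S_def power_mult)
    have "5 * Re k0 * l \<le> t * (Re w * T)" using t1(3) w T by (simp add: pos_divide_le_eq)
    then have "t * (5 * Re k0 * l) \<le> t * (t * (Re w * T))" using t1 by (intro mult_left_mono) auto
    then have "5 * (t * Re k0) * l \<le> Re (S t) * T" by (simp add: S_def power2_eq_square mult_ac)
    then have e: "exp (- (Re (S t) * T)) \<le> exp (- (5 * (t * Re k0) * l))" by simp
    fix x assume x: "x \<in> {0..l}"
    show "norm (V (S t) x) \<le> max B1 B2 \<and> norm (V' (S t) x) \<le> max B1 B2 \<and>
        norm (W (S t) x) \<le> max B1 B2 \<and> norm (W' (S t) x) \<le> max B1 B2"
      using V[OF S0[of t]] W[OF S0[of t]] x by (auto simp: le_max_iff_disj)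
    have "G1 * exp (- (Re (S t) * T)) \<le> max G1 G2 * exp (- (5 * (t * Re k0) * l))"
      "G2 * exp (- (Re (S t) * T)) \<le> max G1 G2 * exp (- (5 * (t * Re k0) * l))"
      using e G1 G2 by (intro mult_mono; simp)+
    then show "norm (f (S t) x) \<le> max G1 G2 * exp (- (5 * (t * Re k0) * l)) \<and>
        norm (g (S t) x) \<le> max G1 G2 * exp (- (5 * (t * Re k0) * l))"
      using V[OF S0[of t]] W[OF S0[of t]] x by (meson order_trans)
  qed
  then show ?thesis by (simp add: liouville_potential_def)
qed

end
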